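(* Let $\Omega\subset\mathbb R^n$ be a bounded domain. For $\varepsilon\ge0$ let $A_\varepsilon:\mathbb R^n_0\to\mathcal S^n_+$ and $H_\varepsilon:\Omega\times\mathbb R\times\mathbb R^n\to\mathbb R$ be continuous functions satisfying the following conditions. (A1) There exists $k>2$ such that, for every small $\varepsilon\ge 0$, the function $f(x)=|x|^k$ satisfies $\operatorname{tr}\big(A_\varepsilon(\nabla f(x))\nabla^2 f(x)\big)\to 0$ as $x\to 0$. (A2') There exists $L_H>0$ such that $|H_\varepsilon(x_1,\rho,\xi)-H_\varepsilon(x_2,\rho,\xi)|\le L_H(1+|\xi|)|x_1-x_2|$ for all $x_1,x_2\in\Omega$, $\rho\in\mathbb R$, $\xi\in\mathbb R^n$ and all $\varepsilon\ge0$. (A3) There exists $\lambda>0$ such that $H_\varepsilon(x,\rho_1,\xi)-H_\varepsilon(x,\rho_2,\xi)\ge\lambda(\rho_1-\rho_2)$ for all $x\in\Omega$, $\xi\in\mathbb R^n$, $\rho_1\ge\rho_2$ and all $\varepsilon\ge0$. (C1) There exist $c_A>0$, $\alpha>0$ and $\beta>\frac{2-k}{2(k-1)}$ (with $k$ as in (A1)) such that $\|A_\varepsilon(\xi)^{1/2}-A_0(\xi)^{1/2}\|\le c_A\varepsilon^\alpha(1+|\xi|^\beta)$ for all small $\varepsilon>0$ and all $\xi\in\mathbb R^n_0$. (C2') For any $R>0$ there exist $c_H>0$ and $\gamma>0$ such that $|H_\varepsilon(x,r,\xi)-H_0(x,r,\xi)|\le c_H\varepsilon^\gamma$ for all small $\varepsilon>0$,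 $x\in\Omega$, $\xi\in\mathbb R^n$ and $r\in\mathbb R$ with $|r|<R$. Let $g_\varepsilon\in C(\partial\Omega)$ and let $u_\varepsilon\in C(\overline\Omega)$ be $\mathcal F$-solutions of $$-\operatorname{tr}(A_\varepsilon(\nabla u)\nabla^2u)+H_\varepsilon(x,u,\nabla u)=0\ \text{ in }\Omega,\qquad u=g_\varepsilon\ \text{ on }\partial\Omega.$$ Assume in addition that the $u_\varepsilon$ are equi-Hölder continuous in $\overline\Omega$, that is, there exist $L>0$ and $0<\theta\le1$ such that $|u_\varepsilon(x_1)-u_\varepsilon(x_2)|\le L|x_1-x_2|^\theta$ for all $x_1,x_2\in\overline\Omega$ and $\varepsilon\ge0$. Then, for all small $\varepsilon>0$, $$\max_{\overline\Omega}|u_\varepsilon-u_0|\le\max_{\partial\Omega}|g_\varepsilon-g_0|+\frac1\lambda\left(C_0\varepsilon^\nu+c_H\varepsilon^\gamma\right),\qquad \nu=\frac{\alpha\theta}{1+(1-\theta)\max\{\beta,0\}},$$ where $C_0>0$ is a constant depending on $k,L_H,\lambda$ from (A1), (A2'), (A3) and on $\alpha,\beta,c_A$ from (C1), and the constants $\gamma,c_H>0$ are given as in (C2').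
   Context: Notation: $\mathbb R^n_0=\mathbb R^n\setminus\{0\}$; $\mathcal S^n_+$ is the set of nonnegative symmetric $n\times n$ matrices; $M^{1/2}$ is the nonnegative square root of $M\in\mathcal S^n_+$; $\|\cdot\|$ is a matrix norm. $\mathcal F$-solutions (elliptic case). Let $A:\mathbb R^n_0\to\mathcal S^n_+$ and $H:\Omega\times\mathbb R\times\mathbb R^n\to\mathbb R$ be continuous. It is assumed that there exists a nonempty set $$\mathcal F\subset\{f\in C^2([0,\infty)): f(0)=f'(0)=f''(0)=0,\ f''(r)>0\ \text{for all } r>0\}$$ such that for all $f\in\mathcal F$ the functions $R_f(x)=\pm f(|x|)$ satisfy $\|A(\nabla R_f(x))\nabla^2R_f(x)\|\to0$ as $x\to0$. A function $\psi\in C^2(\Omega)$ belongs to $C^2_A(\Omega)$ if for every $x_0\in\Omega$ with $\nabla\psi(x_0)=0$ there is $f\in\mathcal F$ such that $|\psi(x)-\psi(x_0)|\le f(|x-x_0|)$ for $x$ near $x_0$. A locally bounded upper semicontinuous $u$ in $\Omega$ is an $\mathcal F$-subsolution of $-\operatorname{tr}(A(\nabla u)\nabla^2u)+H(x,u,\nabla u)=0$ if, whenever $\psi\in C^2_A(\Omega)$ and $u-\psi$ has a local maximum at $x_0\in\Omega$, one has $-\operatorname{tr}(A(\nabla\psi(x_0))\nabla^2\psi(x_0))+H(x_0,u(x_0),\nabla\psi(x_0))\le0$ if $\nabla\psi(x_0)\neq0$, and $H(x_0,u(x_0),\nabla\psi(x_0))\le0$ if $\nabla\psi(x_0)=0$.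 $\mathcal F$-supersolutions are locally bounded lower semicontinuous functions satisfying the analogous conditions with local minimum and reversed inequalities. A function $u\in C(\Omega)$ is an $\mathcal F$-solution if it is both.
   Formalization: The constant C_0 is also allowed to depend on the Hölder constant L (and on the dimension n and the matrix norm); independence of L fails, e.g. for A_ε=(1+ε)², H=λρ on (-1,1) with boundary data g_ε=M, as M grows. *)

theory Defs
  imports "HOL-Analysis.Analysis"
begin

definition grad :: "(real^'n \<Rightarrow> real) \<Rightarrow> real^'n \<Rightarrow> real^'n" where
  "grad f x = (\<chi> i. frechet_derivative f (at x) (axis i 1))"

definition hess :: "(real^'n \<Rightarrow> real) \<Rightarrow> real^'n \<Rightarrow> real^'n^'n" where
  "hess f x = jacobian (grad f) (at x)"

definition C2_on :: "(real^'n) set \<Rightarrow> (real^'n \<Rightarrow> real) \<Rightarrow> bool" where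
  "C2_on \<Omega> f \<longleftrightarrow>
     (\<forall>x\<in>\<Omega>. f differentiable (at x) \<and> grad f differentiable (at x)) \<and> continuous_on \<Omega> (hess f)"

text \<open>The set of nonnegative symmetric matrices: nonnegative in the sense of quadratic forms,
  not entrywise.\<close>

definition sym_nonneg :: "(real^'n^'n) set" where
  "sym_nonneg = {M. transpose M = M \<and> (\<forall>v. 0 \<le> v \<bullet> (M *v v))}"

text \<open>Meaningful on \<^const>\<open>sym_nonneg\<close>, where the nonnegative square root exists and is unique.\<close>

definition mat_sqrt :: "real^'n^'n \<Rightarrow> real^'n^'n" where
  "mat_sqrt M = (THE B. B \<in> sym_nonneg \<and> B ** B = M)"

text \<open>An arbitrary norm on the space of square matrices; submultiplicativity is not required.\<close>

definition is_norm :: "(real^'n^'n \<Rightarrow> real) \<Rightarrow> bool" where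
  "is_norm N \<longleftrightarrow>
     (\<forall>M. 0 \<le> N M) \<and> (\<forall>M. N M = 0 \<longleftrightarrow> M = 0) \<and>
     (\<forall>c M. N (c *\<^sub>R M) = \<bar>c\<bar> * N M) \<and> (\<forall>M M'. N (M + M') \<le> N M + N M')"

text \<open>The functions of class \<open>C\<^sup>2\<close> on the closed half line (one-sided derivatives at \<open>0\<close>) with
  \<open>f(0) = f'(0) = f''(0) = 0\<close> and \<open>f'' > 0\<close> on \<open>(0,\<infinity>)\<close>.  Values at negative arguments are
  irrelevant.\<close>

definition F_class :: "(real \<Rightarrow> real) set" where
  "F_class = {f. \<exists>f1 f2.
     (\<forall>r\<ge>0. (f has_real_derivative f1 r) (at r within {0..})) \<and>
     (\<forall>r\<ge>0. (f1 has_real_derivative f2 r) (at r within {0..})) \<and>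
     continuous_on {0..} f2 \<and>
     f 0 = 0 \<and> f1 0 = 0 \<and> f2 0 = 0 \<and> (\<forall>r>0. f2 r > 0)}"

text \<open>The standing requirement on the set \<open>\<F>\<close> attached to the matrix field \<open>A\<close>.  Punctured limits
  at \<open>0\<close> are taken because \<open>A\<close> is only given away from the origin; the gradient of
  \<open>\<plusminus>f(|x|)\<close> does not vanish for \<open>x \<noteq> 0\<close>.\<close>

definition admissible ::
  "(real^'n^'n \<Rightarrow> real) \<Rightarrow> (real^'n \<Rightarrow> real^'n^'n) \<Rightarrow> (real \<Rightarrow> real) set \<Rightarrow> bool" where
  "admissible N A \<F> \<longleftrightarrow>
     \<F> \<noteq> {} \<and> \<F> \<subseteq> F_class \<and>
     (\<forall>f\<in>\<F>. \<forall>R \<in> {(\<lambda>x. f (norm x)), (\<lambda>x. - f (norm x))}.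
        ((\<lambda>x. N (A (grad R x) ** hess R x)) \<longlongrightarrow> 0) (at 0))"

definition C2_A :: "(real \<Rightarrow> real) set \<Rightarrow> (real^'n) set \<Rightarrow> (real^'n \<Rightarrow> real) set" where
  "C2_A \<F> \<Omega> = {\<psi>. C2_on \<Omega> \<psi> \<and>
     (\<forall>x0\<in>\<Omega>. grad \<psi> x0 = 0 \<longrightarrow>
        (\<exists>f\<in>\<F>. \<forall>\<^sub>F x in nhds x0. \<bar>\<psi> x - \<psi> x0\<bar> \<le> f (norm (x - x0))))}"

definition locally_bounded_on :: "(real^'n) set \<Rightarrow> (real^'n \<Rightarrow> real) \<Rightarrow> bool" where
  "locally_bounded_on \<Omega> u \<longleftrightarrow> (\<forall>x\<in>\<Omega>. \<exists>r>0. bounded (u ` (\<Omega> \<inter> ball x r)))"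

definition usc_on :: "(real^'n) set \<Rightarrow> (real^'n \<Rightarrow> real) \<Rightarrow> bool" where
  "usc_on \<Omega> u \<longleftrightarrow> (\<forall>x\<in>\<Omega>. \<forall>c>u x. \<forall>\<^sub>F y in at x within \<Omega>. u y < c)"

definition lsc_on :: "(real^'n) set \<Rightarrow> (real^'n \<Rightarrow> real) \<Rightarrow> bool" where
  "lsc_on \<Omega> u \<longleftrightarrow> (\<forall>x\<in>\<Omega>. \<forall>c<u x. \<forall>\<^sub>F y in at x within \<Omega>. c < u y)"

text \<open>Below \<open>\<Omega>\<close> is open, so neighbourhoods of \<open>x0 \<in> \<Omega>\<close> in \<open>\<Omega>\<close> and in the whole space
  give the same local extrema.\<close>

definition F_subsolution ::
  "(real \<Rightarrow> real) set \<Rightarrow> (real^'n) set \<Rightarrow> (real^'n \<Rightarrow> real^'n^'n) \<Rightarrow>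
   (real^'n \<Rightarrow> real \<Rightarrow> real^'n \<Rightarrow> real) \<Rightarrow> (real^'n \<Rightarrow> real) \<Rightarrow> bool" where
  "F_subsolution \<F> \<Omega> A H u \<longleftrightarrow>
     locally_bounded_on \<Omega> u \<and> usc_on \<Omega> u \<and>
     (\<forall>\<psi>\<in>C2_A \<F> \<Omega>. \<forall>x0\<in>\<Omega>.
        (\<forall>\<^sub>F x in nhds x0. u x - \<psi> x \<le> u x0 - \<psi> x0) \<longrightarrow>
        (grad \<psi> x0 \<noteq> 0 \<longrightarrow>
           - trace (A (grad \<psi> x0) ** hess \<psi> x0) + H x0 (u x0) (grad \<psi> x0) \<le> 0) \<and>
        (grad \<psi> x0 = 0 \<longrightarrow> H x0 (u x0) (grad \<psi> x0) \<le> 0))"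

definition F_supersolution ::
  "(real \<Rightarrow> real) set \<Rightarrow> (real^'n) set \<Rightarrow> (real^'n \<Rightarrow> real^'n^'n) \<Rightarrow>
   (real^'n \<Rightarrow> real \<Rightarrow> real^'n \<Rightarrow> real) \<Rightarrow> (real^'n \<Rightarrow> real) \<Rightarrow> bool" where
  "F_supersolution \<F> \<Omega> A H u \<longleftrightarrow>
     locally_bounded_on \<Omega> u \<and> lsc_on \<Omega> u \<and>
     (\<forall>\<psi>\<in>C2_A \<F> \<Omega>. \<forall>x0\<in>\<Omega>.
        (\<forall>\<^sub>F x in nhds x0. u x0 - \<psi> x0 \<le> u x - \<psi> x) \<longrightarrow>
        (grad \<psi> x0 \<noteq> 0 \<longrightarrow>
           - trace (A (grad \<psi> x0) ** hess \<psi> x0) + H x0 (u x0) (grad \<psi> x0) \<ge> 0) \<and>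
        (grad \<psi> x0 = 0 \<longrightarrow> H x0 (u x0) (grad \<psi> x0) \<ge> 0))"

definition F_solution ::
  "(real \<Rightarrow> real) set \<Rightarrow> (real^'n) set \<Rightarrow> (real^'n \<Rightarrow> real^'n^'n) \<Rightarrow>
   (real^'n \<Rightarrow> real \<Rightarrow> real^'n \<Rightarrow> real) \<Rightarrow> (real^'n \<Rightarrow> real) \<Rightarrow> bool" where
  "F_solution \<F> \<Omega> A H u \<longleftrightarrow>
     continuous_on \<Omega> u \<and> F_subsolution \<F> \<Omega> A H u \<and> F_supersolution \<F> \<Omega> A H u"

end

theory Submission
  imports Defs
begin

text \<open>
  Doubling of variables with the penalty \<open>K |x - y|\<^sup>k\<close>, \<open>K = L e\<^bsup>\<theta> - k\<^esup>\<close> and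
  \<open>e = \<epsilon>\<^bsup>\<alpha> / (1 + (1 - \<theta>) max \<beta> 0)\<^esup>\<close>.  Hoelder continuity forces \<open>|x - y| \<le> e\<close> at a maximum point, and
  with this choice of \<open>K\<close> the error of the Hamiltonians and the trace term
  \<open>K |x - y|\<^bsup>k - 2\<^esup> \<parallel>A\<^sub>\<epsilon>\<^bsup>1/2\<^esup> - A\<^sub>0\<^bsup>1/2\<^esup>\<parallel>\<^sup>2\<close> are both of order \<open>e\<^sup>\<theta>\<close>.  If \<open>x = y\<close> at the maximum,
  both equations hold with zero gradient; this uses that, because of (A1), degenerate contact of
  order \<open>k\<close> may be tested whatever the class \<open>\<F>\<close> is.  If \<open>x \<noteq> y\<close>, the theorem on sums applies.

  The theorem on sums is obtained from sup-convolutions.  Let \<open>W\<close> be semiconvex with a strict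
  global maximum.  The map sending a contact point of \<open>W\<close> with a supporting hyperplane to its slope
  is Lipschitz and covers a ball, so the contact set \<open>E\<close> is not negligible.  At a point of
  \<open>E\<close> that is both a density point of \<open>E\<close> and a differentiability point of a Lipschitz extension of
  the slope map (Rademacher), \<open>W\<close> has a second order expansion: integrate the slopes along a
  segment, replacing its points by nearby points of \<open>E\<close>.  This avoids Alexandrov's theorem.
\<close>

section \<open>Lebesgue density and the theorem of Rademacher\<close>

text \<open>The power of \<epsilon> in \<open>e\<close> is dictated by the case |x - y| = e. There K
  e^(k-2) = L e^(\<theta>-2) and the slope of the penalty is k K e^(k-1) = k L e^(\<theta>-1), so
  for \<beta> \<ge> 0 condition (C1) gives a trace term of order e^(\<theta>-2)
  \<epsilon>^(2\<alpha>) e^(-2(1-\<theta>)\<beta>). This is of order e^\<theta> precisely when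
  \<epsilon>^\<alpha> = e^(1+(1-\<theta>)\<beta>). The lower bound on \<beta> makes this the worst
  case: |x - y|^(k-2) times the slope to the power 2\<beta> must not blow up as |x - y| tends to 0.
  The theorem on sums is kept approximate. It gives jets at nearby points up to an error \<tau>; the
  matrices are traced against the square roots at those points, and \<tau> tends to 0 only
  afterwards, so that no limit of Hessians is formed. The constants of (C2') are tied to a bound on
  u_0 alone, because (A3) is used to pass from a value of u_\<epsilon> to a value of u_0 before the
  two Hamiltonians are compared.\<close>

lemma lmeasurable_outer_open_diff:
  fixes A :: "'a::euclidean_space set"
  assumes A: "A \<in> lmeasurable" and "e > 0"
  obtains V where "open V" "A \<subseteq> V" "V \<in> lmeasurable" "measure lebesgue (V - A) < e"
proof -
  obtain V where V: "open V" "A \<subseteq> V" "V - A \<in> lmeasurable" "emeasure lebesgue (V - A) < ennreal e"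
    using sets_lebesgue_outer_open[OF fmeasurableD[OF A] \<open>e > 0\<close>] .
  have "V = A \<union> (V - A)" using V by auto
  then have "V \<in> lmeasurable" using fmeasurable.Un[OF A V(3)] by simp
  moreover have "measure lebesgue (V - A) < e"
    using V(3,4) \<open>e > 0\<close> by (simp add: emeasure_eq_measure2 ennreal_less_iff)
  ultimately show thesis using V that by blast
qed

text \<open>Take an open \<open>V\<close> around \<open>A\<close> with \<open>V - A\<close> small.
  Vitali gives disjoint balls in \<open>V\<close>, centred in \<open>S\<close>, that cover almost
  all of \<open>S\<close>. Each contains a hole of \<open>A\<close> occupying a fixed proportion of
  its volume, and the holes lie in \<open>V - A\<close>; hence the balls have small total
  volume.\<close>

lemma porous_imp_negligible_bounded:
  fixes A S :: "'a::euclidean_space set"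
  assumes A: "A \<in> lmeasurable" and "S \<subseteq> A" and "e > 0"
    and porous: "\<And>x d. x \<in> S \<Longrightarrow> d > 0 \<Longrightarrow> \<exists>y. 0 < dist x y \<and> dist x y < d \<and> ball y (e * dist x y) \<inter> A = {}"
  shows "negligible S"
proof -
  define N where "N = DIM('a)"
  \<comment> \<open>The volume ratio between the ball of radius \<open>(1 + e) * dist x y\<close>
    about \<open>x\<close> and the hole of radius \<open>e * dist x y\<close> about
    \<open>y\<close>.\<close>
  define \<kappa> where "\<kappa> = ((1 + e) / e) ^ N"
  have \<kappa>: "\<kappa> > 0" using \<open>e > 0\<close> by (simp add: \<kappa>_def)
  have hole: "ball y (e * dist x y) \<subseteq> cball x ((1 + e) * dist x y)" for x y :: 'a
  proof
    fix z assume "z \<in> ball y (e * dist x y)"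
    then show "z \<in> cball x ((1 + e) * dist x y)"
      using dist_triangle[of x z y] by (simp add: algebra_simps)
  qed
  have meas: "measure lebesgue (cball x ((1 + e) * dist x y)) = \<kappa> * measure lebesgue (ball y (e * dist x y))" for x y :: 'a
  proof -
    have "measure lebesgue (cball x ((1 + e) * dist x y)) = unit_ball_vol (real N) * ((1 + e) * dist x y) ^ N"
      using content_cball[of "(1 + e) * dist x y" x] \<open>e > 0\<close> by (simp add: N_def)
    moreover have "measure lebesgue (ball y (e * dist x y)) = unit_ball_vol (real N) * (e * dist x y) ^ N"
      using content_ball[of "e * dist x y" y] \<open>e > 0\<close> by (simp add: N_def)
    ultimately show ?thesis
      using \<open>e > 0\<close> by (simp add: \<kappa>_def power_mult_distrib power_divide)
  qed
  have "\<exists>T. S \<subseteq> T \<and> T \<in> lmeasurable \<and> measure lebesgue T < \<epsilon>" if "\<epsilon> > 0" for \<epsilon> :: real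
  proof -
    have "\<epsilon> / (2 * \<kappa>) > 0" using that \<kappa> by simp
    then obtain V where V: "open V" "A \<subseteq> V" "V \<in> lmeasurable" "measure lebesgue (V - A) < \<epsilon> / (2 * \<kappa>)"
      using lmeasurable_outer_open_diff[OF A] by metis
    \<comment> \<open>An index pairs a point of \<open>S\<close> with the centre of a hole near it;
      the radius \<open>(1 + e) * dist x y\<close> makes the ball about the point swallow the
      hole.\<close>
    define K where "K = {(x, y). x \<in> S \<and> 0 < dist x y \<and> cball x ((1 + e) * dist x y) \<subseteq> V \<and> ball y (e * dist x y) \<inter> A = {}}"
    obtain C where C: "countable C" "C \<subseteq> K"
      "pairwise (\<lambda>i j. disjnt (cball (fst i) ((1 + e) * dist (fst i) (snd i))) (cball (fst j) ((1 + e) * dist (fst j) (snd j)))) C"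
      "negligible (S - (\<Union>i\<in>C. cball (fst i) ((1 + e) * dist (fst i) (snd i))))"
    proof (rule Vitali_covering_theorem_cballs[of K "\<lambda>i. (1 + e) * dist (fst i) (snd i)" S fst])
      show "0 < (1 + e) * dist (fst i) (snd i)" if "i \<in> K" for i
        using that \<open>e > 0\<close> by (auto simp: K_def)
    next
      fix x and d :: real assume "x \<in> S" "d > 0"
      then have "x \<in> V" using assms V by blast
      then obtain r where r: "r > 0" "cball x r \<subseteq> V" using V open_contains_cball by blast
      obtain y where y: "0 < dist x y" "dist x y < min d r / (1 + e)" "ball y (e * dist x y) \<inter> A = {}"
        using porous[OF \<open>x \<in> S\<close>, of "min d r / (1 + e)"] r \<open>d > 0\<close> \<open>e > 0\<close> by auto
      have *: "(1 + e) * dist x y < min d r" using y(2) \<open>e > 0\<close> by (simp add: field_simps)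
      have "(x, y) \<in> K"
        using y r * \<open>x \<in> S\<close> unfolding K_def by auto
      then show "\<exists>i. i \<in> K \<and> x \<in> cball (fst i) ((1 + e) * dist (fst i) (snd i)) \<and> (1 + e) * dist (fst i) (snd i) < d"
        using * \<open>e > 0\<close> by (intro exI[of _ "(x, y)"]) auto
    qed blast
    define B where "B i = cball (fst i) ((1 + e) * dist (fst i) (snd i))" for i :: "'a \<times> 'a"
    define h where "h i = ball (snd i) (e * dist (fst i) (snd i))" for i :: "'a \<times> 'a"
    have hB: "h i \<subseteq> B i" for i using hole by (simp add: B_def h_def)
    have mB: "measure lebesgue (B i) = \<kappa> * measure lebesgue (h i)" for i using meas by (simp add: B_def h_def)
    have hV: "h i \<subseteq> V - A" if "i \<in> C" for i
    proof -
      have "i \<in> K" using C(2) that by blast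
      then have "B i \<subseteq> V" "h i \<inter> A = {}" by (auto simp: K_def B_def h_def)
      then show ?thesis using hB[of i] by blast
    qed
    have fin: "measure lebesgue (\<Union>i\<in>F. B i) \<le> \<epsilon> / 2" if F: "F \<subseteq> C" "finite F" for F
    proof -
      have "measure lebesgue (\<Union>i\<in>F. B i) \<le> (\<Sum>i\<in>F. measure lebesgue (B i))"
        by (rule measure_UNION_le) (auto simp: F B_def)
      also have "\<dots> = \<kappa> * (\<Sum>i\<in>F. measure lebesgue (h i))" by (simp add: mB sum_distrib_left)
      also have "(\<Sum>i\<in>F. measure lebesgue (h i)) = measure lebesgue (\<Union>i\<in>F. h i)"
      proof (rule measure_UNION'[symmetric])
        show "pairwise (\<lambda>i j. disjnt (h i) (h j)) F"
          using C(3) F(1) hB unfolding B_def[symmetric] pairwise_def disjnt_def by blast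
      qed (auto simp: F h_def)
      also have "\<dots> \<le> measure lebesgue (V - A)"
        using hV F A V by (intro measure_mono_fmeasurable fmeasurable.Diff) (auto simp: h_def)
      finally show ?thesis using V(4) \<kappa> by (simp add: field_simps)
    qed
    have Un: "(\<Union>i\<in>C. B i) \<in> lmeasurable" "measure lebesgue (\<Union>i\<in>C. B i) \<le> \<epsilon> / 2"
    proof -
      have "B i \<in> lmeasurable" for i by (simp add: B_def)
      then show "(\<Union>i\<in>C. B i) \<in> lmeasurable" "measure lebesgue (\<Union>i\<in>C. B i) \<le> \<epsilon> / 2"
        using fmeasurable_UN_bound[OF C(1), of B lebesgue "\<epsilon>/2"] measure_UN_bound[OF C(1), of B lebesgue "\<epsilon>/2"] fin that by auto
    qed
    let ?Z = "S - (\<Union>i\<in>C. B i)"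
    have Z: "negligible ?Z" using C(4) by (simp add: B_def)
    have "measure lebesgue (?Z \<union> (\<Union>i\<in>C. B i)) = measure lebesgue (\<Union>i\<in>C. B i)"
      using measure_Un_null_set[of "\<Union>i\<in>C. B i" lebesgue ?Z] Z Un
      by (simp only: negligible_iff_null_sets Un_commute fmeasurableD)
    then show ?thesis
      using fmeasurable.Un[OF negligible_imp_measurable[OF Z] Un(1)] Un that
      by (intro exI[of _ "?Z \<union> (\<Union>i\<in>C. B i)"]) auto
  qed
  then show ?thesis by (simp add: negligible_outer)
qed

text \<open>The metric shadow of Lebesgue density: at almost every \<open>x\<close> in
  \<open>A\<close>, a nearby point \<open>y\<close> can be replaced by a point of \<open>A\<close>
  at the cost of \<open>e * dist x y\<close>. Where this fails, \<open>A\<close> has holes of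
  proportional size at arbitrarily small scales, so the exceptional set is porous.\<close>

lemma density_negligible:
  fixes A :: "'a::euclidean_space set"
  assumes A: "A \<in> sets lebesgue" and "e > 0"
  shows "negligible {x \<in> A. \<not> (\<exists>d>0. \<forall>y. dist x y < d \<longrightarrow> (\<exists>x'\<in>A. dist x' y \<le> e * dist x y))}" (is "negligible ?S")
proof -
  have "negligible (?S \<inter> ball 0 (real n))" for n
  proof (rule porous_imp_negligible_bounded)
    show "A \<inter> ball 0 (real n) \<in> lmeasurable"
      using A by (intro bounded_set_imp_lmeasurable sets.Int) (auto simp: bounded_Int)
    show "?S \<inter> ball 0 (real n) \<subseteq> A \<inter> ball 0 (real n)" by auto
    show "e > 0" by fact
    fix x d assume x: "x \<in> ?S \<inter> ball 0 (real n)" and d: "(d::real) > 0"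
    then obtain y where y: "dist x y < d" "\<And>x'. x' \<in> A \<Longrightarrow> dist x' y > e * dist x y" by force
    then have "dist x y > 0" using x by (metis (no_types, lifting) IntD1 dist_eq_0_iff less_irrefl mem_Collect_eq mult_zero_right zero_less_dist_iff)
    then show "\<exists>y. 0 < dist x y \<and> dist x y < d \<and> ball y (e * dist x y) \<inter> (A \<inter> ball 0 (real n)) = {}"
      using y by (intro exI[of _ y]) (force simp: dist_commute)
  qed
  then have "negligible (\<Union>n. ?S \<inter> ball 0 (real n))" by (intro negligible_countable_Union) auto
  also have "(\<Union>n. ?S \<inter> ball 0 (real n)) = ?S" by (auto simp: reals_Archimedean2)
  finally show ?thesis .
qed

text \<open>By translation invariance and Tonelli, the measure of \<open>B\<close> times the length of the real line is
  the integral of the lengths of the line sections of \<open>B\<close>.\<close>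

lemma negligible_lines:
  fixes B :: "'a::euclidean_space set" and v :: 'a
  assumes B: "B \<in> sets borel" and lines: "\<And>x. negligible {t::real. x + t *\<^sub>R v \<in> B}"
  shows "negligible B"
proof -
  define f where "f = (\<lambda>(t::real, x::'a). indicator B (x + t *\<^sub>R v) :: ennreal)"
  have fm[measurable]: "f \<in> borel_measurable (lborel \<Otimes>\<^sub>M lborel)"
    unfolding f_def using B by measurable
  have 1: "(\<integral>\<^sup>+x. f (t, x) \<partial>lborel) = emeasure lborel B" for t
  proof -
    have "(\<integral>\<^sup>+x. f (t, x) \<partial>lborel) = (\<integral>\<^sup>+x. indicator B x \<partial>distr lborel borel ((+) (t *\<^sub>R v)))"
      using B by (subst nn_integral_distr) (auto simp: f_def add.commute)
    then show ?thesis using B by (simp add: lborel_distr_plus)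
  qed
  have 2: "(\<integral>\<^sup>+t. f (t, x) \<partial>lborel) = 0" for x
  proof -
    have bm: "(\<lambda>t. x + t *\<^sub>R v) -` B \<in> sets borel"
      using measurable_sets[of "\<lambda>t. x + t *\<^sub>R v" borel borel B] B by simp
    have "(\<integral>\<^sup>+t. f (t, x) \<partial>lborel) = (\<integral>\<^sup>+t. indicator ((\<lambda>t. x + t *\<^sub>R v) -` B) t \<partial>lborel)"
      by (simp add: f_def indicator_def)
    also have "\<dots> = emeasure lborel ((\<lambda>t. x + t *\<^sub>R v) -` B)" using bm by simp
    also have "\<dots> = 0"
      using lines[of x] bm by (simp add: negligible_iff_emeasure0 vimage_def)
    finally show ?thesis .
  qed
  interpret pair_sigma_finite "lborel :: real measure" "lborel :: 'a measure" ..
  have "(\<integral>\<^sup>+t. (\<integral>\<^sup>+x. f (t, x) \<partial>lborel) \<partial>lborel) = (\<integral>\<^sup>+x. (\<integral>\<^sup>+t. f (t, x) \<partial>lborel) \<partial>lborel)"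
    by (rule lborel_pair.Fubini[OF fm, symmetric])
  then have "emeasure lborel B * emeasure lborel (UNIV :: real set) = 0" by (simp add: 1 2)
  then have "emeasure lborel B = 0" by (simp add: emeasure_lborel_UNIV)
  then show ?thesis using B by (simp add: negligible_iff_emeasure0)
qed

section \<open>Differentiability almost everywhere on the real line\<close>

text \<open>The short intervals of slope at most \<open>p\<close> form a Vitali cover of
  \<open>E\<close> inside an open set hardly larger than \<open>E\<close>. A disjoint subfamily
  covers almost all of \<open>E\<close>, and the image intervals have total length at most
  \<open>p\<close> times that of the open set. The bound on slopes is only needed on some
  arbitrarily short intervals around each point.\<close>

lemma slope_le_imp_measure_image_le:
  fixes f :: "real \<Rightarrow> real"
  assumes lip: "L-lipschitz_on UNIV f" and "mono f" and E: "E \<in> lmeasurable" and "p \<ge> 0" and "e > 0"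
    and slope: "\<And>x d. x \<in> E \<Longrightarrow> d > 0 \<Longrightarrow> \<exists>a b. a < x \<and> x < b \<and> b - a < d \<and> f b - f a \<le> p * (b - a)"
  obtains T where "f ` E \<subseteq> T" "T \<in> lmeasurable" "measure lebesgue T \<le> p * measure lebesgue E + e"
proof -
  \<comment> \<open>With the denominator \<open>p + 1\<close> the quotient also makes sense for
    \<open>p = 0\<close>, and still \<open>p * (e / (p + 1)) \<le> e\<close>.\<close>
  obtain V where V: "open V" "E \<subseteq> V" "V \<in> lmeasurable" "measure lebesgue (V - E) < e / (p + 1)"
    using lmeasurable_outer_open_diff[OF E, of "e / (p + 1)"] \<open>p \<ge> 0\<close> \<open>e > 0\<close> by auto
  have V': "measure lebesgue V \<le> measure lebesgue E + e / (p + 1)"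
    using V E by (simp add: measurable_measure_Diff fmeasurableD)
  define K where "K = {(a, b). a < b \<and> {a..b} \<subseteq> V \<and> f b - f a \<le> p * (b - a)}"
  define c where "c i = (fst i + snd i) / 2" for i :: "real \<times> real"
  define r where "r i = (snd i - fst i) / 2" for i :: "real \<times> real"
  have cb: "cball (c i) (r i) = {fst i..snd i}" for i
    by (simp add: cball_eq_atLeastAtMost c_def r_def field_simps)
  obtain C where C: "countable C" "C \<subseteq> K"
      "pairwise (\<lambda>i j. disjnt (cball (c i) (r i)) (cball (c j) (r j))) C"
      "negligible (E - (\<Union>i\<in>C. cball (c i) (r i)))"
  proof (rule Vitali_covering_theorem_cballs[of K r E c])
    show "0 < r i" if "i \<in> K" for i using that by (auto simp: K_def r_def)
  next
    fix x d :: real assume "x \<in> E" "d > 0"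
    then have "x \<in> V" using V by blast
    then obtain s where s: "s > 0" "cball x s \<subseteq> V" using V open_contains_cball by blast
    obtain a b where ab: "a < x" "x < b" "b - a < min d s" "f b - f a \<le> p * (b - a)"
      using slope[OF \<open>x \<in> E\<close>, of "min d s"] s \<open>d > 0\<close> by auto
    have "{a..b} \<subseteq> cball x s" using ab by (auto simp: dist_real_def)
    then have "(a, b) \<in> K" using ab s by (auto simp: K_def)
    moreover have "x \<in> cball (c (a, b)) (r (a, b))" unfolding cb using ab by auto
    ultimately show "\<exists>i. i \<in> K \<and> x \<in> cball (c i) (r i) \<and> r i < d"
      using ab by (intro exI[of _ "(a, b)"]) (auto simp: r_def)
  qed blast
  define J where "J i = {f (fst i)..f (snd i)}" for i
  have Jm: "J i \<in> lmeasurable" for i by (simp add: J_def)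
  have K: "fst i < snd i" "{fst i..snd i} \<subseteq> V" "f (snd i) - f (fst i) \<le> p * (snd i - fst i)" if "i \<in> C" for i
  proof -
    have "i \<in> K" using that C(2) by blast
    then show "fst i < snd i" "{fst i..snd i} \<subseteq> V" "f (snd i) - f (fst i) \<le> p * (snd i - fst i)"
      by (auto simp: K_def simp del: atLeastatMost_subset_iff)
  qed
  have bound: "p * measure lebesgue V \<le> p * measure lebesgue E + e"
  proof -
    have "p * measure lebesgue V \<le> p * (measure lebesgue E + e / (p + 1))"
      using V' \<open>p \<ge> 0\<close> by (rule mult_left_mono)
    also have "\<dots> \<le> p * measure lebesgue E + e"
      using \<open>p \<ge> 0\<close> \<open>e > 0\<close> by (simp add: field_simps)
    finally show ?thesis .
  qed
  have fin: "measure lebesgue (\<Union>i\<in>F. J i) \<le> p * measure lebesgue E + e" if F: "F \<subseteq> C" "finite F" for F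
  proof -
    have "measure lebesgue (\<Union>i\<in>F. J i) \<le> (\<Sum>i\<in>F. measure lebesgue (J i))"
      using F Jm by (intro measure_UNION_le) auto
    also have "\<dots> \<le> (\<Sum>i\<in>F. p * measure lebesgue {fst i..snd i})"
    proof (rule sum_mono)
      fix i assume "i \<in> F"
      then have i: "i \<in> C" using F by auto
      have "f (fst i) \<le> f (snd i)" using \<open>mono f\<close> K(1)[OF i] by (simp add: monoD)
      then show "measure lebesgue (J i) \<le> p * measure lebesgue {fst i..snd i}"
        using K[OF i] by (simp add: J_def)
    qed
    also have "\<dots> = p * (\<Sum>i\<in>F. measure lebesgue {fst i..snd i})" by (simp add: sum_distrib_left)
    also have "(\<Sum>i\<in>F. measure lebesgue {fst i..snd i}) = measure lebesgue (\<Union>i\<in>F. {fst i..snd i})"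
    proof (rule measure_UNION'[symmetric])
      show "pairwise (\<lambda>i j. disjnt {fst i..snd i} {fst j..snd j}) F"
        using C(3) F(1) unfolding cb by (rule pairwise_subset)
    qed (use F in auto)
    also have "\<dots> \<le> measure lebesgue V"
      using K(2) F V by (intro measure_mono_fmeasurable) (auto simp: subset_iff)
    finally show ?thesis using bound \<open>p \<ge> 0\<close> by (simp add: mult_left_mono)
  qed
  have "0 \<le> p * measure lebesgue E + e" using \<open>p \<ge> 0\<close> \<open>e > 0\<close> by simp
  then have Un: "(\<Union>i\<in>C. J i) \<in> lmeasurable" "measure lebesgue (\<Union>i\<in>C. J i) \<le> p * measure lebesgue E + e"
    using fmeasurable_UN_bound[OF C(1), of J, OF Jm fin] measure_UN_bound[OF C(1), of J, OF Jm fin] by auto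
  \<comment> \<open>The intervals miss a null set, and a Lipschitz map sends it to a null
    set.\<close>
  define Z where "Z = f ` (E - (\<Union>i\<in>C. {fst i..snd i}))"
  have Z: "negligible Z" unfolding Z_def
  proof (rule negligible_locally_Lipschitz_image)
    show "negligible (E - (\<Union>i\<in>C. {fst i..snd i}))" using C(4) by (simp add: cb)
    show "\<exists>U B. open U \<and> x \<in> U \<and> (\<forall>y\<in>(E - (\<Union>i\<in>C. {fst i..snd i})) \<inter> U. norm (f y - f x) \<le> B * norm (y - x))" for x
      using lipschitz_on_normD[OF lip] by (intro exI[of _ UNIV] exI[of _ L]) auto
  qed simp
  show thesis
  proof
    show "f ` E \<subseteq> (\<Union>i\<in>C. J i) \<union> Z"
    proof
      fix y assume "y \<in> f ` E"
      then obtain x where x: "x \<in> E" "y = f x" by auto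
      show "y \<in> (\<Union>i\<in>C. J i) \<union> Z"
      proof (cases "x \<in> (\<Union>i\<in>C. {fst i..snd i})")
        case True
        then obtain i where i: "i \<in> C" "fst i \<le> x" "x \<le> snd i" by auto
        then have "y \<in> J i" using x \<open>mono f\<close> by (simp add: J_def monoD)
        then show ?thesis using i by blast
      qed (use x in \<open>simp add: Z_def\<close>)
    qed
    show "(\<Union>i\<in>C. J i) \<union> Z \<in> lmeasurable" using Un Z by (auto intro: fmeasurable.Un negligible_imp_measurable)
    show "measure lebesgue ((\<Union>i\<in>C. J i) \<union> Z) \<le> p * measure lebesgue E + e"
      using Un Z by (simp add: measure_Un_null_set negligible_iff_null_sets fmeasurableD)
  qed
qed

text \<open>Small slopes bound the measure of \<open>f ` E\<close> by \<open>p |E|\<close>; large slopes are small slopes of the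
  inverse function, so that \<open>|E| \<le> |f ` E| / q\<close>.\<close>

lemma negligible_two_slopes:
  fixes f :: "real \<Rightarrow> real"
  assumes lo: "\<And>x y. x \<le> y \<Longrightarrow> y - x \<le> f y - f x" and up: "\<And>x y. x \<le> y \<Longrightarrow> f y - f x \<le> M * (y - x)"
    and "0 < p" "p < q"
  shows "negligible ({x. \<forall>d>0. \<exists>a b. a < x \<and> x < b \<and> b - a < d \<and> f b - f a < p * (b - a)} \<inter>
     {x. \<forall>d>0. \<exists>a b. a < x \<and> x < b \<and> b - a < d \<and> f b - f a > q * (b - a)})" (is "negligible (?E1 \<inter> ?E2)")
proof -
  have M: "M \<ge> 1" using lo[of 0 1] up[of 0 1] by simp
  \<comment> \<open>It is enough to let \<open>d\<close> run through the numbers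
    \<open>inverse (real (Suc n))\<close>; the set is then a countable intersection of unions of
    open intervals, whatever the property \<open>P\<close> is.\<close>
  have Gd: "{x. \<forall>d>0. \<exists>a b. a < x \<and> x < b \<and> b - a < d \<and> P a b} \<in> sets borel" for P :: "real \<Rightarrow> real \<Rightarrow> bool"
  proof -
    let ?S = "\<lambda>n::nat. \<Union>i\<in>{i. snd i - fst i < inverse (real (Suc n)) \<and> P (fst i) (snd i)}. {fst i<..<snd i}"
    have mem: "x \<in> ?S n \<longleftrightarrow> (\<exists>a b. a < x \<and> x < b \<and> b - a < inverse (real (Suc n)) \<and> P a b)" for x n
      by (simp only: UN_iff mem_Collect_eq greaterThanLessThan_iff Bex_def split_paired_Ex fst_conv snd_conv) blast
    have small: "\<exists>n. inverse (real (Suc n)) < d" if "d > 0" for d :: real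
      using reals_Archimedean[OF that] .
    have eq: "{x. \<forall>d>0. \<exists>a b. a < x \<and> x < b \<and> b - a < d \<and> P a b} = (\<Inter>n. ?S n)" (is "?L = ?R")
    proof (intro set_eqI iffI)
      fix x assume x: "x \<in> ?L"
      have "x \<in> ?S n" for n
      proof -
        have "0 < inverse (real (Suc n))" by simp
        then show ?thesis unfolding mem using CollectD[OF x] by (elim allE impE)
      qed
      then show "x \<in> ?R" by (rule INT_I)
    next
      fix x assume x: "x \<in> ?R"
      have "\<exists>a b. a < x \<and> x < b \<and> b - a < d \<and> P a b" if d: "d > 0" for d
      proof -
        obtain n where n: "inverse (real (Suc n)) < d" using small[OF d] ..
        have "x \<in> ?S n" using x by (rule INT_D) simp
        then obtain a b where "a < x" "x < b" "b - a < inverse (real (Suc n))" "P a b" unfolding mem by (elim exE conjE)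
        then show ?thesis using n by (intro exI[of _ a] exI[of _ b]) (simp del: of_nat_Suc)
      qed
      then show "x \<in> ?L" by simp
    qed
    have "open (?S n)" for n by (rule open_UN) auto
    then show ?thesis unfolding eq by (intro sets.countable_INT) auto
  qed
  define E where "E = ?E1 \<inter> ?E2"
  have E: "E \<in> sets borel" unfolding E_def by (intro sets.Int Gd)
  have sm: "x < y \<Longrightarrow> f x < f y" for x y using lo[of x y] by simp
  have "mono f" using sm by (intro monoI) (metis order_le_less)
  have "inj f" by (metis injI linorder_neqE_linordered_idom order_less_irrefl sm)
  have lipf: "M-lipschitz_on UNIV f"
  proof (rule lipschitz_onI)
    show "dist (f x) (f y) \<le> M * dist x y" for x y
      using up[of x y] up[of y x] lo[of x y] lo[of y x] by (cases "x \<le> y") (auto simp: dist_real_def abs_if)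
  qed (use M in auto)
  have contf: "continuous_on UNIV f" using lipf by (rule lipschitz_on_continuous_on)
  have surj: "\<exists>x. f x = y" for y
  proof -
    have "f (- \<bar>y - f 0\<bar>) \<le> y" using lo[of "- \<bar>y - f 0\<bar>" 0] by simp
    moreover have "y \<le> f \<bar>y - f 0\<bar>" using lo[of 0 "\<bar>y - f 0\<bar>"] by simp
    ultimately show ?thesis using IVT'[of f "- \<bar>y - f 0\<bar>" y "\<bar>y - f 0\<bar>"] contf continuous_on_subset by fastforce
  qed
  \<comment> \<open>By \<open>lo\<close> the inverse is 1-Lipschitz, so the covering estimate
    applies to it as well as to \<open>f\<close>.\<close>
  define g where "g = inv f"
  have fg[simp]: "f (g y) = y" for y using surj unfolding g_def by (metis f_inv_into_f rangeI)
  have gf[simp]: "g (f x) = x" for x unfolding g_def using \<open>inj f\<close> by simp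
  have mg: "g x \<le> g y \<longleftrightarrow> x \<le> y" for x y using sm[of "g x" "g y"] sm[of "g y" "g x"] by (metis fg linorder_not_le order_less_le)
  have "mono g" using mg by (intro monoI) simp
  have lipg: "1-lipschitz_on UNIV g"
  proof (rule lipschitz_onI)
    show "dist (g x) (g y) \<le> 1 * dist x y" for x y
      using lo[of "g x" "g y"] lo[of "g y" "g x"] mg[of x y] mg[of y x]
      by (cases "x \<le> y") (auto simp: dist_real_def abs_if)
  qed auto
  have contg: "continuous_on UNIV g" using lipg by (rule lipschitz_on_continuous_on)
  \<comment> \<open>Truncation makes all measures finite, so that the two estimates below can be
    combined.\<close>
  have "negligible (E \<inter> {-real n..real n})" for n
  proof -
    define F where "F = E \<inter> {-real n..real n}"
    have Fb: "F \<in> sets borel" using E by (simp add: F_def)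
    have F: "F \<in> lmeasurable" using Fb by (intro bounded_set_imp_lmeasurable) (auto simp: F_def bounded_Int)
    have "f ` F = g -` F" by (auto simp: image_iff) (metis fg)
    then have fFb: "f ` F \<in> sets borel"
      using measurable_sets[of g borel borel F] Fb contg borel_measurable_continuous_onI by auto
    have "bounded (f ` F)"
    proof (rule bounded_subset)
      show "f ` F \<subseteq> {f (-real n)..f (real n)}" using \<open>mono f\<close> by (auto simp: F_def monoD)
    qed simp
    then have fF: "f ` F \<in> lmeasurable" using fFb by (intro bounded_set_imp_lmeasurable) auto
    let ?m = "measure lebesgue"
    have A1: "?m (f ` F) \<le> p * ?m F"
    proof (rule field_le_epsilon)
      fix e :: real assume "e > 0"
      obtain T where "f ` F \<subseteq> T" "T \<in> lmeasurable" "?m T \<le> p * ?m F + e"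
      proof (rule slope_le_imp_measure_image_le[OF lipf \<open>mono f\<close> F, of p e])
        fix x d :: real assume "x \<in> F" "d > 0"
        then show "\<exists>a b. a < x \<and> x < b \<and> b - a < d \<and> f b - f a \<le> p * (b - a)"
          unfolding F_def E_def by (blast intro: less_imp_le)
      qed (use \<open>0 < p\<close> \<open>e > 0\<close> in auto)
      then show "?m (f ` F) \<le> p * ?m F + e"
        using fF measure_mono_fmeasurable[of "f ` F" T lebesgue] by (simp add: fmeasurableD)
    qed
    have A2: "?m F \<le> (1 / q) * ?m (f ` F)"
    proof (rule field_le_epsilon)
      fix e :: real assume "e > 0"
      obtain T where "g ` f ` F \<subseteq> T" "T \<in> lmeasurable" "?m T \<le> (1 / q) * ?m (f ` F) + e"
      proof (rule slope_le_imp_measure_image_le[OF lipg \<open>mono g\<close> fF, of "1 / q" e])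
        fix y d :: real assume "y \<in> f ` F" "d > 0"
        then obtain x where x: "x \<in> E" "y = f x" by (auto simp: F_def)
        \<comment> \<open>An interval shorter than \<open>d / M\<close> has an image shorter than
          \<open>d\<close>; slopes of \<open>g\<close> are required on intervals shorter than
          \<open>d\<close>.\<close>
        obtain a b where ab: "a < x" "x < b" "b - a < d / M" "f b - f a > q * (b - a)"
        proof -
          have "\<forall>d>0. \<exists>a b. a < x \<and> x < b \<and> b - a < d \<and> f b - f a > q * (b - a)"
            using x(1) unfolding E_def by (elim IntE CollectE)
          moreover have "d / M > 0" using \<open>d > 0\<close> M by simp
          ultimately show thesis using that by blast
        qed
        have "f b - f a \<le> M * (b - a)" using up ab by auto
        also have "\<dots> < d" using ab(3) M by (simp add: field_simps)
        finally have "f b - f a < d" .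
        then show "\<exists>a b. a < y \<and> y < b \<and> b - a < d \<and> g b - g a \<le> (1 / q) * (b - a)"
          using ab sm x \<open>0 < p\<close> \<open>p < q\<close> by (intro exI[of _ "f a"] exI[of _ "f b"]) (auto simp: field_simps)
      qed (use \<open>0 < p\<close> \<open>p < q\<close> \<open>e > 0\<close> in auto)
      then show "?m F \<le> (1 / q) * ?m (f ` F) + e"
        using F measure_mono_fmeasurable[of F T lebesgue] by (simp add: fmeasurableD image_image)
    qed
    have "q * ?m F \<le> p * ?m F" using A1 A2 \<open>0 < p\<close> \<open>p < q\<close> by (simp add: field_simps)
    then have "?m F = 0" using \<open>p < q\<close> measure_nonneg[of lebesgue F]
      by (metis less_le_not_le mult_less_cancel_right order_le_less)
    then show ?thesis using F unfolding F_def by (simp add: negligible_iff_measure)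
  qed
  then have "negligible (\<Union>n. E \<inter> {-real n..real n})" by (intro negligible_countable_Union) auto
  also have "(\<Union>n. E \<inter> {-real n..real n}) = E"
  proof -
    have "\<exists>n. x \<in> {-real n..real n}" for x :: real
    proof -
      obtain n :: nat where "\<bar>x\<bar> \<le> real n" using real_arch_simple by blast
      then have "x \<in> {-real n..real n}" by auto
      then show ?thesis by blast
    qed
    then show ?thesis by blast
  qed
  finally show ?thesis by (simp add: E_def)
qed

text \<open>Off the countably many null sets \<open>E p q\<close> with rational
  \<open>p < q\<close>, for each such pair the slopes on short intervals around \<open>x\<close> are
  all at least \<open>p\<close> or all at most \<open>q\<close>. Hence lower and upper slopes
  squeeze to one number, which is the derivative.\<close>

lemma differentiable_ae_bilipschitz:
  fixes f :: "real \<Rightarrow> real"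
  assumes lo: "\<And>x y. x \<le> y \<Longrightarrow> y - x \<le> f y - f x" and up: "\<And>x y. x \<le> y \<Longrightarrow> f y - f x \<le> M * (y - x)"
  shows "negligible {x. \<not> f differentiable (at x)}"
proof -
  define E where "E p q = ({x. \<forall>d>0. \<exists>a b. a < x \<and> x < b \<and> b - a < d \<and> f b - f a < p * (b - a)} \<inter>
     {x. \<forall>d>0. \<exists>a b. a < x \<and> x < b \<and> b - a < d \<and> f b - f a > q * (b - a)})" for p q
  define I where "I = {(p, q). p \<in> \<rat> \<and> q \<in> \<rat> \<and> 0 < p \<and> p < (q::real)}"
  have "I \<subseteq> \<rat> \<times> \<rat>" by (auto simp: I_def)
  then have "countable I" by (rule countable_subset) (simp add: countable_rat)
  have "negligible (\<Union>(p, q)\<in>I. E p q)"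
  proof (rule negligible_countable_Union)
    show "countable ((\<lambda>(p, q). E p q) ` I)" using \<open>countable I\<close> by simp
    show "negligible s" if "s \<in> (\<lambda>(p, q). E p q) ` I" for s
      using that negligible_two_slopes[of f M, OF lo up] by (auto simp: I_def E_def)
  qed
  moreover have "{x. \<not> f differentiable (at x)} \<subseteq> (\<Union>(p, q)\<in>I. E p q)"
  proof (clarify, rule ccontr)
    fix x assume nd: "\<not> f differentiable (at x)" and "x \<notin> (\<Union>(p, q)\<in>I. E p q)"
    then have nE: "x \<notin> E p q" if "p \<in> \<rat>" "q \<in> \<rat>" "0 < p" "p < q" for p q
      using that by (auto simp: I_def)
    define ge where "ge p \<longleftrightarrow> (\<exists>d>0. \<forall>a b. a < x \<and> x < b \<and> b - a < d \<longrightarrow> p * (b - a) \<le> f b - f a)" for p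
    define le where "le q \<longleftrightarrow> (\<exists>d>0. \<forall>a b. a < x \<and> x < b \<and> b - a < d \<longrightarrow> f b - f a \<le> q * (b - a))" for q
    have dich: "ge p \<or> le q" if "p \<in> \<rat>" "q \<in> \<rat>" "0 < p" "p < q" for p q
    proof (rule ccontr)
      assume *: "\<not> (ge p \<or> le q)"
      have "x \<in> E p q"
        unfolding E_def
      proof (intro IntI CollectI allI impI)
        fix d :: real assume "d > 0"
        then show "\<exists>a b. a < x \<and> x < b \<and> b - a < d \<and> f b - f a < p * (b - a)"
          using * unfolding ge_def by (meson not_le)
        show "\<exists>a b. a < x \<and> x < b \<and> b - a < d \<and> f b - f a > q * (b - a)"
          using * \<open>d > 0\<close> unfolding le_def by (meson not_le)
      qed
      then show False using nE[OF that] by simp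
    qed
    have ge1: "ge 1" unfolding ge_def using lo by (intro exI[of _ 1]) auto
    have geM: "p \<le> M" if p: "ge p" for p
    proof -
      obtain d where d: "d > 0" "\<And>a b. a < x \<and> x < b \<and> b - a < d \<Longrightarrow> p * (b - a) \<le> f b - f a"
        using p ge_def by auto
      have "p * (2 * (d/3)) \<le> f (x + d/3) - f (x - d/3)" using d(2)[of "x - d/3" "x + d/3"] d(1) by (simp add: algebra_simps)
      also have "\<dots> \<le> M * (2 * (d/3))" using up[of "x - d/3" "x + d/3"] d(1) by (simp add: algebra_simps)
      finally show ?thesis using d(1) by simp
    qed
    \<comment> \<open>The candidate derivative: the supremum of the numbers that bound all slopes on
      short enough intervals around \<open>x\<close> from below.\<close>
    define D where "D = Sup {p. ge p}"
    have bdd: "bdd_above {p. ge p}" using geM by (auto simp: bdd_above_def)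
    have D1: "D \<ge> 1" unfolding D_def using ge1 bdd by (intro cSup_upper) auto
    have ge': "ge (D - \<eta>)" if \<eta>: "\<eta> > 0" for \<eta>
    proof -
      obtain p where p: "ge p" "D - \<eta> < p"
      proof -
        have ne: "{p. ge p} \<noteq> {}" using ge1 by blast
        have "D - \<eta> < Sup {p. ge p}" using \<eta> by (simp add: D_def)
        then show thesis using less_cSupD[OF ne] that by blast
      qed
      obtain d where d: "d > 0" "\<And>a b. a < x \<and> x < b \<and> b - a < d \<Longrightarrow> p * (b - a) \<le> f b - f a"
        using p ge_def by auto
      show ?thesis unfolding ge_def
      proof (intro exI[of _ d] conjI allI impI)
        fix a b assume ab: "a < x \<and> x < b \<and> b - a < d"
        have "(D - \<eta>) * (b - a) \<le> p * (b - a)" using p ab by (intro mult_right_mono) auto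
        then show "(D - \<eta>) * (b - a) \<le> f b - f a" using d(2)[OF ab] by simp
      qed (use d in auto)
    qed
    \<comment> \<open>Two rationals \<open>p < q\<close> are placed between \<open>D\<close> and
      \<open>D + \<eta>\<close>. Since \<open>p\<close> exceeds the supremum, \<open>ge p\<close>
      fails, and the dichotomy leaves \<open>le q\<close>.\<close>
    have le': "le (D + \<eta>)" if \<eta>: "\<eta> > 0" for \<eta>
    proof -
      obtain p where p: "p \<in> \<rat>" "D < p" "p < D + \<eta>" using Rats_dense_in_real[of D "D + \<eta>"] \<eta> by auto
      obtain q where q: "q \<in> \<rat>" "p < q" "q < D + \<eta>" using Rats_dense_in_real[of p "D + \<eta>"] p by auto
      have "\<not> ge p" using p(2) cSup_upper[of p "{p. ge p}"] bdd unfolding D_def by auto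
      then have "le q" using dich[of p q] p q D1 by auto
      then obtain d where d: "d > 0" "\<And>a b. a < x \<and> x < b \<and> b - a < d \<Longrightarrow> f b - f a \<le> q * (b - a)"
        using le_def by auto
      show ?thesis unfolding le_def
      proof (intro exI[of _ d] conjI allI impI)
        fix a b assume ab: "a < x \<and> x < b \<and> b - a < d"
        have "q * (b - a) \<le> (D + \<eta>) * (b - a)" using q ab by (intro mult_right_mono) auto
        then show "f b - f a \<le> (D + \<eta>) * (b - a)" using d(2)[OF ab] by simp
      qed (use d in auto)
    qed
    have "(f has_derivative (\<lambda>h. D * h)) (at x)"
      unfolding has_derivative_at_alt
    proof (intro conjI allI impI)
      show "bounded_linear ((*) D)" by (rule bounded_linear_mult_right)
      fix \<eta> :: real assume \<eta>: "\<eta> > 0"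
      obtain d1 where d1: "d1 > 0" "\<And>a b. a < x \<and> x < b \<and> b - a < d1 \<Longrightarrow> (D - \<eta>) * (b - a) \<le> f b - f a"
        using ge'[OF \<eta>] ge_def by auto
      obtain d2 where d2: "d2 > 0" "\<And>a b. a < x \<and> x < b \<and> b - a < d2 \<Longrightarrow> f b - f a \<le> (D + \<eta>) * (b - a)"
        using le'[OF \<eta>] le_def by auto
      define d where "d = min d1 d2"
      have d: "d > 0" using d1 d2 by (simp add: d_def)
      have key: "\<bar>f b - f a - D * (b - a)\<bar> \<le> \<eta> * (b - a)" if "a < x" "x < b" "b - a < d" for a b
        using d1(2)[of a b] d2(2)[of a b] that by (auto simp: d_def algebra_simps abs_le_iff)
      have M: "M \<ge> 1" using lo[of 0 1] up[of 0 1] by simp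
      \<comment> \<open>The slopes so far belong to intervals with \<open>x\<close> strictly inside,
        whereas the derivative needs \<open>x\<close> as an endpoint. Both ends are pushed outwards
        by a small \<open>s\<close> and the change is controlled by the bounds on
        \<open>f\<close>.\<close>
      have key2: "\<bar>f b - f a - D * (b - a)\<bar> \<le> \<eta> * (b - a)" if ab: "a \<le> x" "x \<le> b" "b - a < d" for a b
      proof (rule field_le_epsilon)
        fix e :: real assume e: "e > 0"
        \<comment> \<open>The first entry keeps the error \<open>2 * (M + D + \<eta>) * s\<close>
          below \<open>e\<close>, the second keeps the enlarged interval shorter than
          \<open>d\<close>.\<close>
        define s where "s = min (e / (2 * (M + D + \<eta>))) ((d - (b - a)) / 4)"
        have pos: "M + D + \<eta> > 0" using M D1 \<eta> by simp
        have s: "s > 0" using e pos ab by (simp add: s_def)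
        have "s \<le> e / (2 * (M + D + \<eta>))" by (simp add: s_def)
        then have s2: "2 * (M + D + \<eta>) * s \<le> e" using pos by (simp add: field_simps)
        have "s \<le> (d - (b - a)) / 4" unfolding s_def by (rule min.cobounded2)
        then have s3: "4 * s \<le> d - (b - a)" by simp
        have 1: "\<bar>f (b + s) - f (a - s) - D * (b + s - (a - s))\<bar> \<le> \<eta> * (b + s - (a - s))"
          using key[of "a - s" "b + s"] s s3 ab by auto
        have 2: "0 \<le> f (b + s) - f b" "f (b + s) - f b \<le> M * s" "0 \<le> f a - f (a - s)" "f a - f (a - s) \<le> M * s"
          using lo[of b "b + s"] up[of b "b + s"] lo[of "a - s" a] up[of "a - s" a] s by auto
        have "D * s \<ge> 0" using D1 s by simp
        then show "\<bar>f b - f a - D * (b - a)\<bar> \<le> \<eta> * (b - a) + e"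
          using 1 2 s2 by (auto simp: abs_le_iff algebra_simps)
      qed
      show "\<exists>d>0. \<forall>y. norm (y - x) < d \<longrightarrow> norm (f y - f x - D * (y - x)) \<le> \<eta> * norm (y - x)"
      proof (intro exI[of _ d] conjI d allI impI)
        fix y assume y: "norm (y - x) < d"
        show "norm (f y - f x - D * (y - x)) \<le> \<eta> * norm (y - x)"
        proof (cases "x \<le> y")
          case True then show ?thesis using key2[of x y] y by simp
        next
          case False
          then have "\<bar>f x - f y - D * (x - y)\<bar> \<le> \<eta> * (x - y)" using key2[of y x] y by simp
          moreover have "\<bar>f x - f y - D * (x - y)\<bar> = \<bar>f y - f x - D * (y - x)\<bar>"
            by (simp add: algebra_simps abs_minus_commute)
          ultimately show ?thesis using False by simp
        qed
      qed
    qed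
    then show False using nd by (auto simp: differentiable_def)
  qed
  ultimately show ?thesis by (rule negligible_subset)
qed

text \<open>Adding \<open>(L + 1) * x\<close> shifts all slopes from [-L, L] into [1, 2 L + 1] and
  does not affect differentiability.\<close>

lemma differentiable_ae_lipschitz_real:
  fixes f :: "real \<Rightarrow> real"
  assumes "L-lipschitz_on UNIV f"
  shows "negligible {x. \<not> f differentiable (at x)}"
proof -
  define g where "g x = f x + (L + 1) * x" for x
  have *: "\<bar>f y - f x\<bar> \<le> L * \<bar>y - x\<bar>" for x y using lipschitz_on_normD[OF assms, of y x] by simp
  have "negligible {x. \<not> g differentiable (at x)}"
  proof (rule differentiable_ae_bilipschitz[of g "2 * L + 1"])
    show "y - x \<le> g y - g x" if "x \<le> y" for x y
      using *[of y x] that by (simp add: g_def algebra_simps abs_le_iff)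
    show "g y - g x \<le> (2 * L + 1) * (y - x)" if "x \<le> y" for x y
      using *[of y x] that by (simp add: g_def algebra_simps abs_le_iff)
  qed
  moreover have "f differentiable (at x)" if "g differentiable (at x)" for x
  proof -
    have "(\<lambda>x. g x - (L + 1) * x) differentiable (at x)"
      using that by (intro derivative_intros)
    moreover have "(\<lambda>x. g x - (L + 1) * x) = f" by (auto simp: g_def)
    ultimately show ?thesis by simp
  qed
  ultimately show ?thesis by (elim negligible_subset) blast
qed

section \<open>From lines to total differentiability\<close>

text \<open>Differentiability along lines is weakened to an oscillation of at most \<eta> of the
  difference quotients on a fixed scale. For each scale this is an intersection of closed
  conditions, so the exceptional set is Borel and \<open>negligible_lines\<close> applies.\<close>

lemma directional_quotient_cauchy_ae:
  fixes f :: "'a::euclidean_space \<Rightarrow> real"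
  assumes lip: "L-lipschitz_on UNIV f" and "\<eta> > 0"
  shows "negligible {x. \<not> (\<exists>D. \<exists>d>0. \<forall>s. \<bar>s\<bar> < d \<longrightarrow> \<bar>f (x + s *\<^sub>R v) - f x - s * D\<bar> \<le> \<eta> * \<bar>s\<bar>)}"
proof -
  have contf: "continuous_on UNIV f" using lip by (rule lipschitz_on_continuous_on)
  have cont: "continuous_on UNIV (\<lambda>x. f (x + c))" for c
    by (rule continuous_on_compose2[OF contf]) (auto intro!: continuous_intros)
  define q where "q s x = (f (x + s *\<^sub>R v) - f x) / s" for s x
  have contq: "continuous_on UNIV (q s)" for s
    unfolding q_def divide_inverse by (intro continuous_intros cont contf)
  define F where "F j = {x. \<forall>s t. 0 < \<bar>s\<bar> \<and> \<bar>s\<bar> < inverse (real (Suc j)) \<and> 0 < \<bar>t\<bar> \<and> \<bar>t\<bar> < inverse (real (Suc j)) \<longrightarrow> \<bar>q s x - q t x\<bar> \<le> \<eta>}" for j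
  have "closed (F j)" for j
    unfolding F_def
    by (intro closed_Collect_all closed_Collect_imp closed_Collect_le contq continuous_intros) auto
  then have "- (\<Union>j. F j) \<in> sets borel" by auto
  moreover have "negligible {t. x + t *\<^sub>R v \<in> - (\<Union>j. F j)}" for x
  proof -
    define g where "g t = f (x + t *\<^sub>R v)" for t
    have "(L * norm v)-lipschitz_on UNIV g"
    proof (rule lipschitz_onI)
      show "dist (g s) (g t) \<le> L * norm v * dist s t" for s t
        using lipschitz_on_normD[OF lip, of "x + s *\<^sub>R v" "x + t *\<^sub>R v"]
        by (simp add: g_def dist_norm flip: scaleR_diff_left) (simp add: mult_ac)
      show "0 \<le> L * norm v" using lipschitz_on_nonneg[OF lip] by simp
    qed
    then have "negligible {t. \<not> g differentiable (at t)}" by (rule differentiable_ae_lipschitz_real)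
    moreover have "x + t *\<^sub>R v \<in> (\<Union>j. F j)" if gd: "g differentiable (at t)" for t
    proof -
      obtain D where "(g has_real_derivative D) (at t)" using gd by (auto simp: real_differentiable_def)
      then have "(\<lambda>s. (g (t + s) - g t) / s) \<midarrow>0\<rightarrow> D" by (simp add: DERIV_def)
      then have "\<forall>\<^sub>F s in at 0. dist ((g (t + s) - g t) / s) D < \<eta> / 2" using \<open>\<eta> > 0\<close> by (intro tendstoD) auto
      then obtain d where d: "d > 0" "\<And>s. s \<noteq> 0 \<Longrightarrow> \<bar>s\<bar> < d \<Longrightarrow> \<bar>(g (t + s) - g t) / s - D\<bar> < \<eta> / 2"
        unfolding eventually_at by (auto simp: dist_real_def)
      have qg: "q s (x + t *\<^sub>R v) = (g (t + s) - g t) / s" for s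
        by (simp add: q_def g_def algebra_simps)
      obtain j where j: "inverse (real (Suc j)) < d" using reals_Archimedean[OF d(1)] by blast
      have "x + t *\<^sub>R v \<in> F j" unfolding F_def
      proof (intro CollectI allI impI, elim conjE)
        fix r s :: real assume rs: "0 < \<bar>r\<bar>" "\<bar>r\<bar> < inverse (real (Suc j))" "0 < \<bar>s\<bar>" "\<bar>s\<bar> < inverse (real (Suc j))"
        show "\<bar>q r (x + t *\<^sub>R v) - q s (x + t *\<^sub>R v)\<bar> \<le> \<eta>"
        proof -
          have "\<bar>(g (t + r) - g t) / r - D\<bar> < \<eta> / 2" "\<bar>(g (t + s) - g t) / s - D\<bar> < \<eta> / 2"
            using d(2)[of r] d(2)[of s] j rs by (auto simp del: of_nat_Suc)
          then show ?thesis unfolding qg by linarith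
        qed
      qed
      then show ?thesis by blast
    qed
    ultimately show ?thesis by (elim negligible_subset) blast
  qed
  ultimately have "negligible (- (\<Union>j. F j))" by (rule negligible_lines)
  moreover have "\<exists>D. \<exists>d>0. \<forall>s. \<bar>s\<bar> < d \<longrightarrow> \<bar>f (x + s *\<^sub>R v) - f x - s * D\<bar> \<le> \<eta> * \<bar>s\<bar>" if x: "x \<in> F j" for x j
  proof -
    \<comment> \<open>Any single quotient at the scale of \<open>F j\<close> can serve as the
      approximate derivative, since all of them differ by at most \<eta>.\<close>
    let ?D = "q (inverse (real (Suc j)) / 2) x"
    have "\<bar>f (x + s *\<^sub>R v) - f x - s * ?D\<bar> \<le> \<eta> * \<bar>s\<bar>" if s: "\<bar>s\<bar> < inverse (real (Suc j))" for s
    proof (cases "s = 0")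
      case False
      have "0 < inverse (real (Suc j))" by simp
      then have "0 < \<bar>inverse (real (Suc j)) / 2\<bar>" "\<bar>inverse (real (Suc j)) / 2\<bar> < inverse (real (Suc j))" by linarith+
      then have *: "\<bar>q s x - ?D\<bar> \<le> \<eta>"
      proof -
        have "\<bar>q s x - q t x\<bar> \<le> \<eta>" if "0 < \<bar>t\<bar>" "\<bar>t\<bar> < inverse (real (Suc j))" for t
          using x s False that unfolding F_def by simp
        then show ?thesis using \<open>0 < \<bar>inverse (real (Suc j)) / 2\<bar>\<close> \<open>\<bar>inverse (real (Suc j)) / 2\<bar> < _\<close> by blast
      qed
      have "f (x + s *\<^sub>R v) - f x - s * ?D = s * (q s x - ?D)"
        using False by (simp add: q_def field_simps)
      then show ?thesis using mult_left_mono[OF *, of "\<bar>s\<bar>"] by (simp add: abs_mult mult.commute)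
    qed simp
    moreover have "0 < inverse (real (Suc j))" by simp
    ultimately show ?thesis by blast
  qed
  ultimately show ?thesis by (elim negligible_subset) blast
qed

text \<open>Near a density point of a set on which the partial difference quotients are uniformly close to
  \<open>\<alpha>\<close>, any increment is reached by coordinate steps that start close to points of this set.\<close>

lemma approx_differentiable_ae:
  fixes f :: "'a::euclidean_space \<Rightarrow> real"
  assumes lip: "L-lipschitz_on UNIV f" and "\<eta> > 0"
  shows "negligible {x. \<not> (\<exists>\<alpha>. \<exists>d>0. \<forall>h. norm h < d \<longrightarrow> \<bar>f (x + h) - f x - \<alpha> \<bullet> h\<bar> \<le> real DIM('a) * (2 * \<eta>) * norm h)}"
proof -
  have L: "L \<ge> 0" using lipschitz_on_nonneg[OF lip] .
  \<comment> \<open>A coordinate step will be moved to a start point at distance at most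
    \<open>e * norm h\<close>; this costs \<open>L * e * norm h\<close> at each end, together at
    most \<open>\<eta> * norm h\<close>.\<close>
  define e where "e = \<eta> / (2 * L + 1)"
  have e: "e > 0" "2 * L * e \<le> \<eta>" using L \<open>\<eta> > 0\<close> by (auto simp: e_def field_simps)
  have contf: "continuous_on UNIV f" using lip by (rule lipschitz_on_continuous_on)
  have cont: "continuous_on UNIV (\<lambda>x. f (x + c))" for c
    by (rule continuous_on_compose2[OF contf]) (auto intro!: continuous_intros)
  \<comment> \<open>The vector \<alpha> stands for the gradient up to \<eta>. It is taken from a
    countable dense set, so that the density exceptions of all the closed sets
    \<open>A j \<alpha>\<close> form one null set.\<close>
  define A where "A j \<alpha> = {x. \<forall>b\<in>Basis. \<forall>s. \<bar>s\<bar> < inverse (real (Suc j)) \<longrightarrow> \<bar>f (x + s *\<^sub>R b) - f x - s * (\<alpha> \<bullet> b)\<bar> \<le> \<eta> * \<bar>s\<bar>}" for j \<alpha>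
  have clA: "closed (A j \<alpha>)" for j \<alpha>
    unfolding A_def Ball_def
    by (intro closed_Collect_all closed_Collect_imp closed_Collect_le cont contf continuous_intros) auto
  obtain Q :: "'a set" where Q: "countable Q" "\<And>X. open X \<Longrightarrow> X \<noteq> {} \<Longrightarrow> \<exists>d\<in>Q. d \<in> X"
    using countable_dense_exists by metis
  define N1 where "N1 = (\<Union>b\<in>Basis. {x. \<not> (\<exists>D. \<exists>d>0. \<forall>s. \<bar>s\<bar> < d \<longrightarrow> \<bar>f (x + s *\<^sub>R b) - f x - s * D\<bar> \<le> (\<eta>/2) * \<bar>s\<bar>)})"
  have N1: "negligible N1" unfolding N1_def
    by (rule negligible_Union) (use directional_quotient_cauchy_ae[OF lip, of "\<eta>/2"] \<open>\<eta> > 0\<close> in auto)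
  define N2 where "N2 = (\<Union>(j, \<alpha>)\<in>UNIV \<times> Q. {x \<in> A j \<alpha>. \<not> (\<exists>d>0. \<forall>y. dist x y < d \<longrightarrow> (\<exists>x'\<in>A j \<alpha>. dist x' y \<le> e * dist x y))})"
  have N2: "negligible N2" unfolding N2_def
  proof (rule negligible_countable_Union)
    fix S assume "S \<in> (\<lambda>(j, \<alpha>). {x \<in> A j \<alpha>. \<not> (\<exists>d>0. \<forall>y. dist x y < d \<longrightarrow> (\<exists>x'\<in>A j \<alpha>. dist x' y \<le> e * dist x y))}) ` (UNIV \<times> Q)"
    then obtain j \<alpha> where S: "S = {x \<in> A j \<alpha>. \<not> (\<exists>d>0. \<forall>y. dist x y < d \<longrightarrow> (\<exists>x'\<in>A j \<alpha>. dist x' y \<le> e * dist x y))}" by auto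
    show "negligible S" unfolding S by (rule density_negligible) (use clA e in auto)
  qed (use Q in simp)
  have main: "\<exists>\<alpha>. \<exists>d>0. \<forall>h. norm h < d \<longrightarrow> \<bar>f (x + h) - f x - \<alpha> \<bullet> h\<bar> \<le> real DIM('a) * (2 * \<eta>) * norm h"
    if x: "x \<notin> N1" "x \<notin> N2" for x
  proof -
    have "\<forall>b\<in>Basis. \<exists>D. \<exists>d>0. \<forall>s. \<bar>s\<bar> < d \<longrightarrow> \<bar>f (x + s *\<^sub>R b) - f x - s * D\<bar> \<le> (\<eta>/2) * \<bar>s\<bar>"
      using x(1) unfolding N1_def by blast
    then obtain D d where Dd: "\<And>b. b \<in> Basis \<Longrightarrow> d b > 0"
       "\<And>b s. b \<in> Basis \<Longrightarrow> \<bar>s\<bar> < d b \<Longrightarrow> \<bar>f (x + s *\<^sub>R b) - f x - s * D b\<bar> \<le> (\<eta>/2) * \<bar>s\<bar>"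
      by metis
    define a where "a = (\<Sum>b\<in>Basis. D b *\<^sub>R b)"
    have ab: "a \<bullet> b = D b" if "b \<in> Basis" for b using that by (simp add: a_def)
    \<comment> \<open>Half of \<eta> is left for replacing the approximate partial derivatives
      \<open>D b\<close> by the components of \<alpha>; the other half is already in the
      quotients.\<close>
    obtain \<alpha> where \<alpha>: "\<alpha> \<in> Q" "dist a \<alpha> < \<eta> / 2"
      using Q(2)[of "ball a (\<eta>/2)"] \<open>\<eta> > 0\<close> by auto
    obtain dm where dm: "dm > 0" "\<And>b. b \<in> Basis \<Longrightarrow> dm \<le> d b"
    proof
      show "Min (d ` Basis) > 0" using Dd(1) by simp
      show "\<And>b. b \<in> Basis \<Longrightarrow> Min (d ` Basis) \<le> d b" by simp
    qed
    obtain j where j: "inverse (real (Suc j)) < dm" using reals_Archimedean[OF dm(1)] by blast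
    have xA: "x \<in> A j \<alpha>" unfolding A_def
    proof (intro CollectI ballI allI impI)
      fix b :: 'a and s :: real assume b: "b \<in> Basis" and s: "\<bar>s\<bar> < inverse (real (Suc j))"
      have 1: "\<bar>f (x + s *\<^sub>R b) - f x - s * D b\<bar> \<le> (\<eta>/2) * \<bar>s\<bar>" using Dd(2)[OF b] dm(2)[OF b] s j by simp
      have "\<bar>D b - \<alpha> \<bullet> b\<bar> \<le> norm (a - \<alpha>)" using Basis_le_norm[OF b, of "a - \<alpha>"] ab[OF b] by (simp add: inner_diff_left)
      then have "\<bar>D b - \<alpha> \<bullet> b\<bar> \<le> \<eta> / 2" using \<alpha>(2) by (simp add: dist_norm)
      then have 2: "\<bar>s * (D b - \<alpha> \<bullet> b)\<bar> \<le> (\<eta>/2) * \<bar>s\<bar>"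
        unfolding abs_mult by (subst mult.commute) (rule mult_right_mono, auto)
      show "\<bar>f (x + s *\<^sub>R b) - f x - s * (\<alpha> \<bullet> b)\<bar> \<le> \<eta> * \<bar>s\<bar>"
        using abs_triangle_ineq[of "f (x + s *\<^sub>R b) - f x - s * D b" "s * (D b - \<alpha> \<bullet> b)"] 1 2 by (simp add: algebra_simps)
    qed
    then obtain d0 where d0: "d0 > 0" "\<And>y. dist x y < d0 \<Longrightarrow> \<exists>x'\<in>A j \<alpha>. dist x' y \<le> e * dist x y"
      using x(2) \<alpha>(1) unfolding N2_def by blast
    define \<delta> where "\<delta> = min d0 (inverse (real (Suc j)))"
    have "\<delta> > 0" using d0 by (simp add: \<delta>_def)
    moreover have "\<bar>f (x + h) - f x - \<alpha> \<bullet> h\<bar> \<le> real DIM('a) * (2 * \<eta>) * norm h" if h: "norm h < \<delta>" for h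
    proof -
      have part: "norm (\<Sum>b\<in>F. (h \<bullet> b) *\<^sub>R b) \<le> norm h" if "F \<subseteq> Basis" for F
      proof -
        have "finite F" using that finite_Basis finite_subset by blast
        show ?thesis
        proof (rule norm_le_componentwise)
          fix i :: 'a assume i: "i \<in> Basis"
          have "(\<Sum>b\<in>F. (h \<bullet> b) *\<^sub>R b) \<bullet> i = (\<Sum>b\<in>F. if b = i then h \<bullet> i else 0)"
            unfolding inner_sum_left using that i by (intro sum.cong) (auto simp: inner_Basis)
          also have "\<dots> = (if i \<in> F then h \<bullet> i else 0)" using \<open>finite F\<close> by simp
          finally show "\<bar>(\<Sum>b\<in>F. (h \<bullet> b) *\<^sub>R b) \<bullet> i\<bar> \<le> \<bar>h \<bullet> i\<bar>" by simp
        qed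
      qed
      \<comment> \<open>Induction over the coordinates already moved. The next step starts at
        \<open>y\<close>, is compared with the same step from a point \<open>x'\<close> of
        \<open>A j \<alpha>\<close>, and costs \<open>2 * \<eta> * norm h\<close>: half for the
        step, half for the displacement of its two ends.\<close>
      have walk: "\<bar>f (x + (\<Sum>b\<in>F. (h \<bullet> b) *\<^sub>R b)) - f x - (\<Sum>b\<in>F. (h \<bullet> b) * (\<alpha> \<bullet> b))\<bar> \<le> real (card F) * (2 * \<eta>) * norm h"
        if "F \<subseteq> Basis" for F
      proof -
        have "finite F" using that finite_Basis finite_subset by blast
        then show ?thesis using that
        proof (induction F)
          case empty then show ?case by simp
        next
          case (insert b F)
          define y where "y = x + (\<Sum>b\<in>F. (h \<bullet> b) *\<^sub>R b)"
          have yh: "dist x y \<le> norm h" using part[of F] insert.prems by (simp add: y_def dist_norm)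
          then obtain x' where x': "x' \<in> A j \<alpha>" "dist x' y \<le> e * dist x y"
            using d0(2)[of y] h by (auto simp: \<delta>_def)
          have x'y: "dist x' y \<le> e * norm h" using x'(2) yh e by (meson mult_left_mono order_trans less_imp_le)
          have hb: "\<bar>h \<bullet> b\<bar> \<le> norm h" using insert.prems by (simp add: Basis_le_norm)
          have 1: "\<bar>f (x' + (h \<bullet> b) *\<^sub>R b) - f x' - (h \<bullet> b) * (\<alpha> \<bullet> b)\<bar> \<le> \<eta> * \<bar>h \<bullet> b\<bar>"
            using x'(1) insert.prems hb h unfolding A_def \<delta>_def by auto
          have 2: "\<bar>f y - f x'\<bar> \<le> L * (e * norm h)"
          proof -
            have "\<bar>f y - f x'\<bar> \<le> L * dist x' y" using lipschitz_onD[OF lip, of x' y] by (simp add: dist_real_def dist_commute abs_minus_commute)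
            also have "\<dots> \<le> L * (e * norm h)" using x'y L by (rule mult_left_mono)
            finally show ?thesis .
          qed
          have 3: "\<bar>f (y + (h \<bullet> b) *\<^sub>R b) - f (x' + (h \<bullet> b) *\<^sub>R b)\<bar> \<le> L * (e * norm h)"
          proof -
            have "\<bar>f (y + (h \<bullet> b) *\<^sub>R b) - f (x' + (h \<bullet> b) *\<^sub>R b)\<bar> \<le> L * dist x' y"
              using lipschitz_onD[OF lip, of "y + (h \<bullet> b) *\<^sub>R b" "x' + (h \<bullet> b) *\<^sub>R b"] by (simp add: dist_real_def dist_commute)
            also have "\<dots> \<le> L * (e * norm h)" using x'y L by (rule mult_left_mono)
            finally show ?thesis .
          qed
          have 4: "\<bar>f y - f x - (\<Sum>b\<in>F. (h \<bullet> b) * (\<alpha> \<bullet> b))\<bar> \<le> real (card F) * (2 * \<eta>) * norm h"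
            using insert by (simp add: y_def)
          have 5: "\<eta> * \<bar>h \<bullet> b\<bar> \<le> \<eta> * norm h" using hb \<open>\<eta> > 0\<close> by simp
          have 6: "2 * L * e * norm h \<le> \<eta> * norm h" using e(2) by (rule mult_right_mono) simp
          have s1: "x + (\<Sum>b\<in>insert b F. (h \<bullet> b) *\<^sub>R b) = y + (h \<bullet> b) *\<^sub>R b"
            using insert by (simp add: y_def add_ac)
          have s2: "(\<Sum>b\<in>insert b F. (h \<bullet> b) * (\<alpha> \<bullet> b)) = (h \<bullet> b) * (\<alpha> \<bullet> b) + (\<Sum>b\<in>F. (h \<bullet> b) * (\<alpha> \<bullet> b))"
            using insert by simp
          have s3: "real (card (insert b F)) * (2 * \<eta>) * norm h = real (card F) * (2 * \<eta>) * norm h + 2 * \<eta> * norm h"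
            using insert by (simp add: algebra_simps)
          have "2 * (L * (e * norm h)) = 2 * L * e * norm h" by simp
          then show ?case unfolding s1 s2 s3 using 1 2 3 4 5 6 by (simp only: abs_le_iff) linarith
        qed
      qed
      have "x + (\<Sum>b\<in>Basis. (h \<bullet> b) *\<^sub>R b) = x + h" by (simp add: euclidean_representation)
      moreover have "(\<Sum>b\<in>Basis. (h \<bullet> b) * (\<alpha> \<bullet> b)) = \<alpha> \<bullet> h"
        by (subst euclidean_inner[of \<alpha> h]) (simp add: mult.commute)
      ultimately show ?thesis using walk[of Basis] by simp
    qed
    ultimately show ?thesis by blast
  qed
  have "negligible (N1 \<union> N2)" using N1 N2 by simp
  then show ?thesis by (rule negligible_subset) (use main in blast)
qed

text \<open>At almost every point there is an approximate gradient for each accuracy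
  \<open>inverse (real (Suc n))\<close>. Two of them describe the same increments near
  \<open>x\<close>, so they differ by at most the sum of their accuracies; hence they form a Cauchy
  sequence, whose limit is the gradient.\<close>

theorem rademacher_real:
  fixes f :: "'a::euclidean_space \<Rightarrow> real"
  assumes lip: "L-lipschitz_on UNIV f"
  shows "negligible {x. \<not> f differentiable (at x)}"
proof -
  define P where "P \<eta> x \<alpha> d \<longleftrightarrow> d > 0 \<and> (\<forall>h. norm h < d \<longrightarrow> \<bar>f (x + h) - f x - \<alpha> \<bullet> h\<bar> \<le> \<eta> * norm h)" for \<eta> x \<alpha> d
  have N: "negligible {x. \<not> (\<exists>\<alpha> d. P \<eta> x \<alpha> d)}" if "\<eta> > 0" for \<eta>
    using approx_differentiable_ae[OF lip, of "\<eta> / (2 * real DIM('a))"] that unfolding P_def by simp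
  have "negligible (\<Union>n::nat. {x. \<not> (\<exists>\<alpha> d. P (inverse (real (Suc n))) x \<alpha> d)})"
    by (rule negligible_countable_Union) (use N in \<open>auto simp del: of_nat_Suc\<close>)
  moreover have "f differentiable (at x)" if x: "\<forall>n. \<exists>\<alpha> d. P (inverse (real (Suc n))) x \<alpha> d" for x
  proof -
    obtain \<alpha> d where P: "\<And>n. P (inverse (real (Suc n))) x (\<alpha> n) (d n)" using x by metis
    define i where "i n = inverse (real (Suc n))" for n
    have i0: "i \<longlonglongrightarrow> 0" unfolding i_def by (rule LIMSEQ_inverse_real_of_nat)
    have Pd: "d n > 0" "norm h < d n \<Longrightarrow> \<bar>f (x + h) - f x - \<alpha> n \<bullet> h\<bar> \<le> i n * norm h" for n h
      using P[of n] by (auto simp: P_def i_def)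
    have close: "norm (\<alpha> n - \<alpha> m) \<le> i n + i m" for n m
    proof (cases "\<alpha> n = \<alpha> m")
      case False
      \<comment> \<open>Both expansions are evaluated at a short multiple of the difference of the
        two approximate gradients, where the discrepancy is largest.\<close>
      define w where "w = \<alpha> n - \<alpha> m"
      have w: "norm w > 0" using False by (simp add: w_def)
      define t where "t = min (d n) (d m) / (2 * norm w)"
      have t: "t > 0" using Pd(1)[of n] Pd(1)[of m] w by (simp add: t_def)
      have nt: "norm (t *\<^sub>R w) < min (d n) (d m)"
      proof -
        have "norm (t *\<^sub>R w) = min (d n) (d m) / 2"
          using Pd(1)[of n] Pd(1)[of m] w by (simp add: t_def)
        moreover have "min (d n) (d m) > 0" using Pd(1)[of n] Pd(1)[of m] by simp
        ultimately show ?thesis by linarith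
      qed
      have "\<bar>\<alpha> n \<bullet> (t *\<^sub>R w) - \<alpha> m \<bullet> (t *\<^sub>R w)\<bar> \<le> (i n + i m) * norm (t *\<^sub>R w)"
        using Pd(2)[of "t *\<^sub>R w" n] Pd(2)[of "t *\<^sub>R w" m] nt by (simp add: distrib_right)
      moreover have "\<alpha> n \<bullet> (t *\<^sub>R w) - \<alpha> m \<bullet> (t *\<^sub>R w) = t * (norm w * norm w)"
        unfolding inner_diff_left[symmetric] w_def[symmetric] by (simp add: dot_square_norm power2_eq_square)
      ultimately have "t * norm w * norm w \<le> t * norm w * (i n + i m)" using t by (simp add: abs_mult mult_ac)
      then show ?thesis using t w by (simp add: w_def)
    qed (simp add: i_def)
    have "Cauchy \<alpha>"
    proof (rule metric_CauchyI)
      fix e :: real assume "e > 0"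
      then have "\<forall>\<^sub>F n in sequentially. i n < e / 2" using i0 by (intro order_tendstoD) auto
      then obtain M where "\<And>n. n \<ge> M \<Longrightarrow> i n < e / 2" by (auto simp: eventually_sequentially)
      then have "dist (\<alpha> m) (\<alpha> n) < e" if "m \<ge> M" "n \<ge> M" for m n
        using close[of m n] that by (smt (verit, best) dist_norm field_sum_of_halves)
      then show "\<exists>M. \<forall>m\<ge>M. \<forall>n\<ge>M. dist (\<alpha> m) (\<alpha> n) < e" by blast
    qed
    then obtain a where a: "\<alpha> \<longlonglongrightarrow> a" using Cauchy_convergent convergent_def by blast
    have close': "norm (\<alpha> n - a) \<le> i n" for n
    proof (rule LIMSEQ_le)
      show "(\<lambda>m. norm (\<alpha> n - \<alpha> m)) \<longlonglongrightarrow> norm (\<alpha> n - a)" by (intro tendsto_intros a)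
      show "(\<lambda>m. i n + i m) \<longlonglongrightarrow> i n" using tendsto_add[OF tendsto_const i0, of "i n"] by simp
    qed (use close in auto)
    have "(f has_derivative (\<lambda>h. a \<bullet> h)) (at x)"
      unfolding has_derivative_at_alt
    proof (intro conjI allI impI)
      show "bounded_linear ((\<bullet>) a)" by (rule bounded_linear_inner_right)
      fix e :: real assume "e > 0"
      then have "\<forall>\<^sub>F n in sequentially. i n < e / 2" using i0 by (intro order_tendstoD) auto
      then obtain n where n: "i n < e / 2" by (auto simp: eventually_sequentially)
      show "\<exists>d>0. \<forall>y. norm (y - x) < d \<longrightarrow> norm (f y - f x - a \<bullet> (y - x)) \<le> e * norm (y - x)"
      proof (intro exI[of _ "d n"] conjI allI impI Pd)
        fix y assume y: "norm (y - x) < d n"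
        have 1: "\<bar>f y - f x - \<alpha> n \<bullet> (y - x)\<bar> \<le> i n * norm (y - x)" using Pd(2)[OF y] by simp
        have 2: "\<bar>(\<alpha> n - a) \<bullet> (y - x)\<bar> \<le> i n * norm (y - x)"
          using Cauchy_Schwarz_ineq2[of "\<alpha> n - a" "y - x"] close'[of n] by (meson mult_right_mono norm_ge_zero order_trans)
        have "\<bar>f y - f x - a \<bullet> (y - x)\<bar> \<le> (2 * i n) * norm (y - x)"
          using 1 2 by (simp add: inner_diff_left)
        also have "\<dots> \<le> e * norm (y - x)" using n by (intro mult_right_mono) auto
        finally show "norm (f y - f x - a \<bullet> (y - x)) \<le> e * norm (y - x)" by simp
      qed
    qed
    then show ?thesis by (auto simp: differentiable_def)
  qed
  ultimately show ?thesis by (elim negligible_subset) blast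
qed

theorem rademacher:
  fixes f :: "'a::euclidean_space \<Rightarrow> 'b::euclidean_space"
  assumes lip: "L-lipschitz_on UNIV f"
  shows "negligible {x. \<not> f differentiable (at x)}"
proof -
  have "negligible (\<Union>b\<in>Basis. {x. \<not> (\<lambda>x. f x \<bullet> b) differentiable (at x)})"
  proof (rule negligible_Union)
    fix S assume "S \<in> (\<lambda>b. {x. \<not> (\<lambda>x. f x \<bullet> b) differentiable (at x)}) ` (Basis :: 'b set)"
    then obtain b :: 'b where b: "b \<in> Basis" "S = {x. \<not> (\<lambda>x. f x \<bullet> b) differentiable (at x)}" by auto
    have "L-lipschitz_on UNIV (\<lambda>x. f x \<bullet> b)"
    proof (rule lipschitz_onI)
      show "dist (f x \<bullet> b) (f y \<bullet> b) \<le> L * dist x y" for x y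
        using Basis_le_norm[OF b(1), of "f x - f y"] lipschitz_onD[OF lip, of x y]
        by (simp add: dist_norm inner_diff_left)
    qed (use lipschitz_on_nonneg[OF lip] in auto)
    then show "negligible S" unfolding b(2) by (rule rademacher_real)
  qed simp
  moreover have "f differentiable (at x)" if "\<forall>b\<in>Basis. (\<lambda>x. f x \<bullet> b) differentiable (at x)" for x
    using that differentiable_componentwise_within[of f x UNIV] by simp
  ultimately show ?thesis by (elim negligible_subset) blast
qed

section \<open>Second order expansions at contact points\<close>

text \<open>McShane's extension: the infimum of the cones \<open>f y + L * dist x y\<close>, which
  are bounded below thanks to any one point of \<open>E\<close>.\<close>

lemma lipschitz_extend_real:
  fixes f :: "'a::metric_space \<Rightarrow> real"
  assumes lip: "L-lipschitz_on E f"
  shows "\<exists>F. L-lipschitz_on UNIV F \<and> (\<forall>x\<in>E. F x = f x)"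
proof (cases "E = {}")
  case True
  then show ?thesis using lipschitz_on_nonneg[OF lip] by (intro exI[of _ "\<lambda>_. 0"]) (auto simp: lipschitz_on_def)
next
  case False
  then obtain e0 where e0: "e0 \<in> E" by blast
  have L: "L \<ge> 0" using lipschitz_on_nonneg[OF lip] .
  define F where "F x = (INF y\<in>E. f y + L * dist x y)" for x
  have bdd: "bdd_below ((\<lambda>y. f y + L * dist x y) ` E)" for x
  proof (rule bdd_belowI2)
    fix y assume "y \<in> E"
    then have "f e0 - f y \<le> L * dist e0 y" using lipschitz_onD[OF lip e0, of y] by (simp add: dist_real_def)
    also have "\<dots> \<le> L * (dist x e0 + dist x y)" using L dist_triangle3[of e0 y x] by (intro mult_left_mono) (auto simp: dist_commute)
    finally show "f e0 - L * dist x e0 \<le> f y + L * dist x y" by (simp add: algebra_simps)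
  qed
  show ?thesis
  proof (intro exI[of _ F] conjI ballI)
    have *: "F x \<le> F x' + L * dist x x'" for x x'
    proof -
      have "F x - L * dist x x' \<le> F x'" unfolding F_def[of x']
      proof (rule cINF_greatest)
        fix y assume y: "y \<in> E"
        have "F x \<le> f y + L * dist x y" unfolding F_def using bdd y by (rule cINF_lower)
        also have "L * dist x y \<le> L * (dist x x' + dist x' y)" using L dist_triangle by (intro mult_left_mono)
        finally show "F x - L * dist x x' \<le> f y + L * dist x' y" by (simp add: algebra_simps)
      qed (use False in auto)
      then show ?thesis by simp
    qed
    show "L-lipschitz_on UNIV F"
    proof (rule lipschitz_onI)
      show "dist (F x) (F y) \<le> L * dist x y" for x y
        using *[of x y] *[of y x] by (simp add: dist_real_def abs_le_iff dist_commute)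
    qed (rule L)
    fix x assume x: "x \<in> E"
    show "F x = f x"
    proof (rule antisym)
      show "F x \<le> f x" using cINF_lower[OF bdd x, of x] by (simp add: F_def)
      show "f x \<le> F x" unfolding F_def
      proof (rule cINF_greatest)
        fix y assume "y \<in> E"
        then show "f x \<le> f y + L * dist x y" using lipschitz_onD[OF lip x, of y] by (simp add: dist_real_def)
      qed (use False in auto)
    qed
  qed
qed

text \<open>McShane's extension in each coordinate. The constant grows by the dimension, which is
  harmless as the extension is only fed into Rademacher's theorem.\<close>

lemma lipschitz_extend:
  fixes f :: "'a::metric_space \<Rightarrow> 'b::euclidean_space"
  assumes lip: "L-lipschitz_on E f"
  shows "\<exists>F M. M-lipschitz_on UNIV F \<and> (\<forall>x\<in>E. F x = f x)"
proof -
  have L: "L \<ge> 0" using lipschitz_on_nonneg[OF lip] .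
  have "\<exists>F. L-lipschitz_on UNIV F \<and> (\<forall>x\<in>E. F x = f x \<bullet> b)" if b: "b \<in> Basis" for b
  proof -
    have "L-lipschitz_on E (\<lambda>x. f x \<bullet> b)"
    proof (rule lipschitz_onI)
      show "dist (f x \<bullet> b) (f y \<bullet> b) \<le> L * dist x y" if "x \<in> E" "y \<in> E" for x y
        using Basis_le_norm[OF b, of "f x - f y"] lipschitz_onD[OF lip that]
        by (simp add: dist_norm inner_diff_left)
    qed (rule L)
    then show ?thesis by (rule lipschitz_extend_real)
  qed
  then have "\<exists>G. \<forall>b\<in>Basis. L-lipschitz_on UNIV (G b) \<and> (\<forall>x\<in>E. G b x = f x \<bullet> b)"
    by (intro bchoice ballI)
  then obtain G where G: "\<And>b. b \<in> Basis \<Longrightarrow> L-lipschitz_on UNIV (G b)" "\<And>b x. b \<in> Basis \<Longrightarrow> x \<in> E \<Longrightarrow> G b x = f x \<bullet> b"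
    by blast
  show ?thesis
  proof (intro exI[of _ "\<lambda>x. \<Sum>b\<in>Basis. G b x *\<^sub>R b"] exI[of _ "real DIM('b) * L"] conjI ballI)
    show "(real DIM('b) * L)-lipschitz_on UNIV (\<lambda>x. \<Sum>b\<in>Basis. G b x *\<^sub>R b)"
    proof (rule lipschitz_onI)
      fix x y
      have "norm ((\<Sum>b\<in>Basis. G b x *\<^sub>R b) - (\<Sum>b\<in>Basis. G b y *\<^sub>R b)) = norm (\<Sum>b\<in>Basis. (G b x - G b y) *\<^sub>R b)"
        by (simp add: sum_subtractf scaleR_diff_left)
      also have "\<dots> \<le> (\<Sum>b\<in>(Basis::'b set). L * dist x y)"
      proof (rule sum_norm_le)
        fix b :: 'b assume "b \<in> Basis"
        then show "norm ((G b x - G b y) *\<^sub>R b) \<le> L * dist x y"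
          using lipschitz_onD[OF G(1), of b x y] by (simp add: dist_real_def)
      qed
      finally show "dist (\<Sum>b\<in>Basis. G b x *\<^sub>R b) (\<Sum>b\<in>Basis. G b y *\<^sub>R b) \<le> real DIM('b) * L * dist x y"
        by (simp add: dist_norm)
    qed (use L in simp)
    show "(\<Sum>b\<in>Basis. G b x *\<^sub>R b) = f x" if "x \<in> E" for x
      using G(2) that by (simp add: euclidean_representation)
  qed
qed

text \<open>The segment from \<open>z\<close> to \<open>z + h\<close> is cut into
  \<open>N = 1 / \<eta>\<close> pieces. On each piece the paraboloids touching at a nearby point of
  \<open>E\<close> give the increment of \<open>W\<close> up to a multiple of
  \<open>\<eta>\<^sup>2 * (norm h)\<^sup>2\<close>, which survives summation over \<open>N\<close>
  pieces with a factor \<eta>. The slope at that point is linearised by differentiability of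
  \<open>F\<close> at the single point \<open>z\<close>.\<close>

lemma second_order_expansion_at_density_point:
  fixes W :: "'a::euclidean_space \<Rightarrow> real" and G :: "'a \<Rightarrow> 'a"
  assumes touch: "\<And>x y. x \<in> E \<Longrightarrow> \<bar>W y - W x - G x \<bullet> (y - x)\<bar> \<le> C * (norm (y - x))\<^sup>2"
    and z: "z \<in> E"
    and dens: "\<And>e. e > 0 \<Longrightarrow> \<exists>d>0. \<forall>y. dist z y < d \<longrightarrow> (\<exists>x\<in>E. dist x y \<le> e * dist z y)"
    and D: "(F has_derivative D) (at z)" and FG: "\<And>x. x \<in> E \<Longrightarrow> F x = G x"
    and "e > 0"
  shows "\<exists>d>0. \<forall>h. norm h < d \<longrightarrow> \<bar>W (z + h) - W z - G z \<bullet> h - D h \<bullet> h / 2\<bar> \<le> e * (norm h)\<^sup>2"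
proof -
  interpret D: bounded_linear D using D by (rule has_derivative_bounded_linear)
  define B where "B = onorm D"
  have B: "norm (D h) \<le> B * norm h" for h unfolding B_def by (rule onorm[OF D.bounded_linear_axioms])
  have B0: "B \<ge> 0" unfolding B_def by (rule onorm_pos_le[OF D.bounded_linear_axioms])
  obtain b :: 'a where b: "norm b = 1" using vector_choose_size[of 1] by auto
  have C0: "C \<ge> 0" using touch[OF z, of "z + b"] b by (simp add: order_trans[OF abs_ge_zero])
  obtain N :: nat where N: "real N > (3 * B + 2 + 5 * C) / e" using reals_Archimedean2 by blast
  have "(3 * B + 2 + 5 * C) / e \<ge> 0" using B0 C0 \<open>e > 0\<close> by simp
  then have N0: "N > 0" using N by (cases N) auto
  define \<eta> where "\<eta> = 1 / real N"
  have \<eta>: "\<eta> > 0" "\<eta> \<le> 1" using N0 by (auto simp: \<eta>_def)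
  have \<eta>e: "(3 * B + 2 + 5 * C) * \<eta> < e" using N N0 \<open>e > 0\<close> by (simp add: \<eta>_def field_simps)
  obtain d1 where d1: "d1 > 0" "\<And>y. dist z y < d1 \<Longrightarrow> \<exists>x\<in>E. dist x y \<le> \<eta> * dist z y"
    using dens[OF \<eta>(1)] by blast
  obtain d2 where d2: "d2 > 0" "\<And>y. norm (y - z) < d2 \<Longrightarrow> norm (F y - F z - D (y - z)) \<le> \<eta> * norm (y - z)"
    using D \<eta>(1) unfolding has_derivative_at_alt by blast
  \<comment> \<open>The replaced points lie within \<open>2 * norm h\<close> of \<open>z\<close>,
    hence the bound \<open>d2 / 2\<close>.\<close>
  have "\<bar>W (z + h) - W z - G z \<bullet> h - D h \<bullet> h / 2\<bar> \<le> e * (norm h)\<^sup>2" if h: "norm h < min d1 (d2 / 2)" for h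
  proof -
    define t where "t j = real j * \<eta>" for j
    have t: "0 \<le> t j" "j \<le> N \<Longrightarrow> t j \<le> 1" for j using \<eta> N0 by (auto simp: t_def \<eta>_def)
    define y where "y j = z + t j *\<^sub>R h" for j
    have zy: "dist z (y j) \<le> norm h" if "j \<le> N" for j
      using t[of j] that by (simp add: y_def dist_norm mult_left_le_one_le)
    have "\<exists>x. x \<in> E \<and> dist x (y j) \<le> \<eta> * norm h" if j: "j \<le> N" for j
    proof -
      obtain x where "x \<in> E" "dist x (y j) \<le> \<eta> * dist z (y j)" using d1(2)[of "y j"] zy[OF j] h by auto
      then show ?thesis using zy[OF j] \<eta>(1) by (meson mult_left_mono order_trans less_imp_le)
    qed
    then obtain x where x: "\<And>j. j \<le> N \<Longrightarrow> x j \<in> E" "\<And>j. j \<le> N \<Longrightarrow> dist (x j) (y j) \<le> \<eta> * norm h"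
      by metis
    have step: "\<bar>W (y (Suc j)) - W (y j) - \<eta> * (G z \<bullet> h) - \<eta> * t j * (D h \<bullet> h)\<bar> \<le> \<eta> * ((B * \<eta> + 2 * \<eta> + 5 * C * \<eta>) * (norm h)\<^sup>2)"
      if j: "j < N" for j
    proof -
      have jN: "j \<le> N" using j by simp
      have y1: "y (Suc j) = y j + \<eta> *\<^sub>R h" by (simp add: y_def t_def algebra_simps)
      have nx: "norm (y j - x j) \<le> \<eta> * norm h" using x(2)[OF jN] by (simp add: dist_norm norm_minus_commute)
      have nx1: "norm (y (Suc j) - x j) \<le> 2 * (\<eta> * norm h)"
        using nx norm_triangle_ineq[of "y j - x j" "\<eta> *\<^sub>R h"] \<eta> by (simp add: y1 algebra_simps)
      have 1: "\<bar>W (y j) - W (x j) - G (x j) \<bullet> (y j - x j)\<bar> \<le> C * (\<eta> * norm h)\<^sup>2"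
        using touch[OF x(1)[OF jN], of "y j"] nx C0 by (meson mult_left_mono order_trans power_mono norm_ge_zero)
      have 2: "\<bar>W (y (Suc j)) - W (x j) - G (x j) \<bullet> (y (Suc j) - x j)\<bar> \<le> C * (2 * (\<eta> * norm h))\<^sup>2"
        using touch[OF x(1)[OF jN], of "y (Suc j)"] nx1 C0 by (meson mult_left_mono order_trans power_mono norm_ge_zero)
      have Geq: "G (x j) \<bullet> (y (Suc j) - x j) - G (x j) \<bullet> (y j - x j) = \<eta> * (G (x j) \<bullet> h)"
        by (simp add: y1 flip: inner_diff_right)
      have xz: "norm (x j - z) \<le> 2 * norm h"
      proof -
        have "norm (x j - z) \<le> norm (x j - y j) + norm (y j - z)" using norm_triangle_ineq[of "x j - y j" "y j - z"] by simp
        also have "\<dots> \<le> \<eta> * norm h + norm h" using nx zy[OF jN] by (simp add: dist_norm norm_minus_commute add_mono)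
        also have "\<dots> \<le> 2 * norm h" using \<eta> by (simp add: mult_left_le_one_le)
        finally show ?thesis .
      qed
      have 3: "norm (G (x j) - G z - D (x j - z)) \<le> \<eta> * (2 * norm h)"
      proof -
        have "norm (F (x j) - F z - D (x j - z)) \<le> \<eta> * norm (x j - z)" using d2(2)[of "x j"] xz h by simp
        also have "\<dots> \<le> \<eta> * (2 * norm h)" using xz \<eta> by (intro mult_left_mono) auto
        finally show ?thesis using FG x(1)[OF jN] z by simp
      qed
      have 4: "norm (D (x j - z) - t j *\<^sub>R D h) \<le> B * (\<eta> * norm h)"
      proof -
        have "D (x j - z) - t j *\<^sub>R D h = D (x j - y j)"
          by (simp add: y_def D.diff D.add D.scaleR)
        then have "norm (D (x j - z) - t j *\<^sub>R D h) \<le> B * norm (x j - y j)" using B by simp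
        also have "\<dots> \<le> B * (\<eta> * norm h)" using nx B0 by (simp add: norm_minus_commute mult_left_mono)
        finally show ?thesis .
      qed
      have 5: "\<bar>(G (x j) - G z - t j *\<^sub>R D h) \<bullet> h\<bar> \<le> (\<eta> * (2 * norm h) + B * (\<eta> * norm h)) * norm h"
      proof -
        have "norm (G (x j) - G z - t j *\<^sub>R D h) \<le> \<eta> * (2 * norm h) + B * (\<eta> * norm h)"
          using 3 4 norm_triangle_ineq[of "G (x j) - G z - D (x j - z)" "D (x j - z) - t j *\<^sub>R D h"] by simp
        then show ?thesis using Cauchy_Schwarz_ineq2[of "G (x j) - G z - t j *\<^sub>R D h" h]
          by (meson mult_right_mono norm_ge_zero order_trans)
      qed
      have 6: "\<bar>\<eta> * (G (x j) \<bullet> h) - \<eta> * (G z \<bullet> h) - \<eta> * t j * (D h \<bullet> h)\<bar> \<le> \<eta> * ((\<eta> * (2 * norm h) + B * (\<eta> * norm h)) * norm h)"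
      proof -
        have "\<eta> * (G (x j) \<bullet> h) - \<eta> * (G z \<bullet> h) - \<eta> * t j * (D h \<bullet> h) = \<eta> * ((G (x j) - G z - t j *\<^sub>R D h) \<bullet> h)"
          by (simp add: inner_diff_left algebra_simps)
        then show ?thesis using 5 \<eta> by (simp add: abs_mult mult_left_mono)
      qed
      have "\<bar>W (y (Suc j)) - W (y j) - \<eta> * (G z \<bullet> h) - \<eta> * t j * (D h \<bullet> h)\<bar>
         \<le> \<eta> * ((\<eta> * (2 * norm h) + B * (\<eta> * norm h)) * norm h) + C * (\<eta> * norm h)\<^sup>2 + C * (2 * (\<eta> * norm h))\<^sup>2"
        using 1 2 6 Geq by (simp only: abs_le_iff) linarith
      also have "\<dots> = \<eta> * ((B * \<eta> + 2 * \<eta> + 5 * C * \<eta>) * (norm h)\<^sup>2)"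
        by (simp add: power2_eq_square algebra_simps)
      finally show ?thesis .
    qed
    define R where "R j = W (y (Suc j)) - W (y j) - \<eta> * (G z \<bullet> h) - \<eta> * t j * (D h \<bullet> h)" for j
    have sumR: "\<bar>\<Sum>j<N. R j\<bar> \<le> (B * \<eta> + 2 * \<eta> + 5 * C * \<eta>) * (norm h)\<^sup>2"
    proof -
      have "\<bar>\<Sum>j<N. R j\<bar> \<le> (\<Sum>j<N. \<eta> * ((B * \<eta> + 2 * \<eta> + 5 * C * \<eta>) * (norm h)\<^sup>2))"
        using step unfolding R_def by (intro order_trans[OF sum_abs] sum_mono) auto
      also have "\<dots> = (B * \<eta> + 2 * \<eta> + 5 * C * \<eta>) * (norm h)\<^sup>2"
        using N0 by (simp add: \<eta>_def)
      finally show ?thesis .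
    qed
    have "(\<Sum>j<N. R j) = (\<Sum>j<N. W (y (Suc j)) - W (y j)) - real N * \<eta> * (G z \<bullet> h) - \<eta> * (\<Sum>j<N. t j) * (D h \<bullet> h)"
      unfolding R_def by (simp add: sum_subtractf sum_distrib_left sum_distrib_right mult_ac)
    also have "(\<Sum>j<N. W (y (Suc j)) - W (y j)) = W (z + h) - W z"
      using N0 sum_lessThan_telescope[of "\<lambda>j. W (y j)" N] by (simp add: y_def t_def \<eta>_def)
    also have "real N * \<eta> = 1" using N0 by (simp add: \<eta>_def)
    \<comment> \<open>The left Riemann sum of \<open>t\<close> over [0, 1]; the main part 1/2 yields
      the quadratic term, the defect \<open>\<eta> / 2\<close> goes into the error.\<close>
    also have "\<eta> * (\<Sum>j<N. t j) = 1/2 - \<eta> / 2"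
    proof -
      have "(\<Sum>j<N. t j) = \<eta> * (\<Sum>j<N. real j)" by (simp add: t_def sum_distrib_left mult.commute)
      also have "(\<Sum>j<N. real j) = real N * (real N - 1) / 2"
        by (induction N) (auto simp: field_simps)
      finally have st: "(\<Sum>j<N. t j) = \<eta> * (real N * (real N - 1) / 2)" .
      show ?thesis unfolding st \<eta>_def using N0 by (simp add: field_simps)
    qed
    finally have eq: "(\<Sum>j<N. R j) = W (z + h) - W z - G z \<bullet> h - D h \<bullet> h / 2 + \<eta> / 2 * (D h \<bullet> h)"
      by (simp add: algebra_simps)
    have Dh: "\<bar>D h \<bullet> h\<bar> \<le> B * (norm h)\<^sup>2"
      using Cauchy_Schwarz_ineq2[of "D h" h] B[of h] unfolding power2_eq_square
      by (metis (no_types, opaque_lifting) mult.assoc mult_right_mono norm_ge_zero order_trans)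
    have "\<bar>\<eta> / 2 * (D h \<bullet> h)\<bar> \<le> 2 * \<eta> * (B * (norm h)\<^sup>2)"
      unfolding abs_mult using Dh \<eta> B0 by (intro mult_mono) auto
    then have "\<bar>W (z + h) - W z - G z \<bullet> h - D h \<bullet> h / 2\<bar> \<le> (B * \<eta> + 2 * \<eta> + 5 * C * \<eta>) * (norm h)\<^sup>2 + 2 * \<eta> * (B * (norm h)\<^sup>2)"
      using sumR eq by linarith
    also have "\<dots> = (3 * B + 2 + 5 * C) * \<eta> * (norm h)\<^sup>2" by (simp add: algebra_simps)
    also have "\<dots> \<le> e * (norm h)\<^sup>2" using \<eta>e by (intro mult_right_mono) auto
    finally show ?thesis .
  qed
  then show ?thesis using d1 d2 by (intro exI[of _ "min d1 (d2 / 2)"]) auto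
qed

text \<open>\<open>T z q\<close> says that the hyperplane of slope \<open>q\<close> supports
  \<open>W\<close> from above at \<open>z\<close>. The decay \<open>above\<close> confines contact
  points to the ball of radius \<open>\<rho> / m\<close>; the semiconvexity \<open>below\<close>
  turns contact into two-sided touching by paraboloids, from which uniqueness and Lipschitz
  dependence of the slope follow. As all slopes of norm at most \<rho> occur and Lipschitz maps
  preserve null sets, the contact set is not null.\<close>

lemma jensen_alexandrov:
  fixes W :: "'a::euclidean_space \<Rightarrow> real"
  assumes cont: "continuous_on UNIV W" and W0: "W 0 = 0"
    and above: "\<And>z. W z \<le> - m * (norm z)\<^sup>2" and "m > 0"
    and below: "\<And>z. \<exists>s. \<forall>z'. W z' \<ge> W z + s \<bullet> (z' - z) - C * (norm (z' - z))\<^sup>2"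
    and "\<rho> > 0"
  shows "\<exists>z q D. norm z \<le> \<rho> / m \<and> norm q \<le> \<rho> \<and> (\<forall>z'. W z' \<le> W z + q \<bullet> (z' - z)) \<and> bounded_linear D \<and>
    (\<forall>e>0. \<exists>d>0. \<forall>h. norm h < d \<longrightarrow> \<bar>W (z + h) - W z - q \<bullet> h - D h \<bullet> h / 2\<bar> \<le> e * (norm h)\<^sup>2)"
proof -
  define T where "T z q \<longleftrightarrow> norm q \<le> \<rho> \<and> (\<forall>z'. W z' \<le> W z + q \<bullet> (z' - z))" for z q
  define E where "E = {z. \<exists>q. T z q}"
  have bound: "norm z \<le> \<rho> / m" if "T z q" for z q
  proof -
    have "0 \<le> W z + q \<bullet> (0 - z)" using that W0 unfolding T_def by metis
    also have "\<dots> \<le> - m * (norm z)\<^sup>2 + norm q * norm z"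
      using above[of z] Cauchy_Schwarz_ineq2[of q "- z"] by simp
    also have "\<dots> \<le> - m * (norm z)\<^sup>2 + \<rho> * norm z" using that by (simp add: T_def mult_right_mono)
    finally have "m * norm z * norm z \<le> \<rho> * norm z" by (simp add: power2_eq_square mult_ac)
    then have "m * norm z \<le> \<rho>" using \<open>\<rho> > 0\<close> by (cases "norm z = 0") auto
    then show ?thesis using \<open>m > 0\<close> by (simp add: field_simps)
  qed
  have touch: "\<bar>W y - W x - q \<bullet> (y - x)\<bar> \<le> C * (norm (y - x))\<^sup>2" if "T x q" for x y q
  proof -
    obtain s where s: "\<And>z'. W z' \<ge> W x + s \<bullet> (z' - x) - C * (norm (z' - x))\<^sup>2" using below by blast
    have up: "W z' \<le> W x + q \<bullet> (z' - x)" for z' using that by (simp add: T_def)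
    \<comment> \<open>The slope from below and the slope from above agree: along
      \<open>t *\<^sub>R (s - q)\<close> a gap would grow linearly in \<open>t\<close>, while only a
      quadratic gap is allowed.\<close>
    have "(s - q) \<bullet> (s - q) = 0"
    proof (rule ccontr)
      define w where "w = s - q"
      assume "(s - q) \<bullet> (s - q) \<noteq> 0"
      then have w: "norm w > 0" by (simp add: w_def)
      have ineq: "t * (w \<bullet> w) \<le> C * (t\<^sup>2 * (w \<bullet> w))" for t
      proof -
        have "(s - q) \<bullet> (t *\<^sub>R w) \<le> C * (norm (t *\<^sub>R w))\<^sup>2"
          using s[of "x + t *\<^sub>R w"] up[of "x + t *\<^sub>R w"] by (simp add: inner_diff_left algebra_simps)
        then show ?thesis unfolding w_def[symmetric] by (simp add: power_mult_distrib dot_square_norm)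
      qed
      have "w \<bullet> w > 0" using w by simp
      then have *: "t \<le> C * t\<^sup>2" for t using ineq[of t] by (simp add: mult.assoc[symmetric])
      have "C > 0" using *[of 1] by simp
      then show False using *[of "1 / (2 * C)"] by (simp add: power2_eq_square field_simps)
    qed
    then have "s = q" by simp
    then show ?thesis using s[of y] up[of y] by (simp add: abs_le_iff)
  qed
  have C0: "C \<ge> 0" if "T x q" for x q
  proof -
    obtain b :: 'a where "norm b = 1" using vector_choose_size[of 1] by auto
    then show ?thesis using touch[OF that, of "x + b"] by (simp add: order_trans[OF abs_ge_zero])
  qed
  have lip: "norm (q - q') * norm (z - z') \<le> 2 * C * norm (z - z') * norm (z - z')" if T: "T z q" "T z' q'" for z z' q q'
  proof (cases "q = q'")
    case False
    \<comment> \<open>From \<open>z'\<close> a step as long as \<open>z' - z\<close> is taken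
      against \<open>q - q'\<close>, so that \<open>(q - q') \<bullet> (z' - w)\<close> is the
      product of the two norms. Comparing the touching inequalities at \<open>w\<close> and
      \<open>z'\<close> bounds it.\<close>
    define w where "w = z' - (norm (z' - z) / norm (q - q')) *\<^sub>R (q - q')"
    have wz: "norm (w - z') = norm (z' - z)" using False by (simp add: w_def)
    have "W w \<le> W z + q \<bullet> (w - z)" using T(1) by (simp add: T_def)
    moreover have "W w \<ge> W z' + q' \<bullet> (w - z') - C * (norm (z' - z))\<^sup>2" using touch[OF T(2), of w] wz by (simp add: abs_le_iff)
    moreover have "W z' \<ge> W z + q \<bullet> (z' - z) - C * (norm (z' - z))\<^sup>2" using touch[OF T(1), of z'] by (simp add: abs_le_iff)
    ultimately have "q \<bullet> (z' - z) + q' \<bullet> (w - z') - 2 * (C * (norm (z' - z))\<^sup>2) \<le> q \<bullet> (w - z)" by linarith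
    then have "(q - q') \<bullet> (z' - w) \<le> 2 * C * (norm (z' - z))\<^sup>2" by (simp add: inner_diff_left inner_diff_right algebra_simps)
    moreover have "(q - q') \<bullet> (z' - w) = norm (q - q') * norm (z' - z)"
      using False by (simp add: w_def dot_square_norm power2_eq_square)
    ultimately show ?thesis by (simp add: power2_eq_square norm_minus_commute mult_ac)
  qed (use C0[OF T(1)] in simp)
  \<comment> \<open>The contact point maximises \<open>W z - q \<bullet> z\<close>. Beyond the
    radius \<open>\<rho> / m\<close> the decay of \<open>W\<close> beats the slope and the value is
    at most 0, the value at the origin, so a maximum over the ball is global.\<close>
  have ex: "\<exists>z. T z q" if q: "norm q \<le> \<rho>" for q
  proof -
    have "continuous_on (cball 0 (\<rho> / m)) (\<lambda>z. W z - q \<bullet> z)"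
      by (intro continuous_intros continuous_on_subset[OF cont]) auto
    then obtain z where z: "z \<in> cball 0 (\<rho> / m)" "\<And>z'. z' \<in> cball 0 (\<rho> / m) \<Longrightarrow> W z' - q \<bullet> z' \<le> W z - q \<bullet> z"
    proof -
      have "\<rho> / m > 0" using \<open>\<rho> > 0\<close> \<open>m > 0\<close> by simp
      then have "cball (0::'a) (\<rho> / m) \<noteq> {}" by simp
      then show thesis
        using continuous_attains_sup[of "cball (0::'a) (\<rho> / m)" "\<lambda>z. W z - q \<bullet> z"] that
          \<open>continuous_on (cball 0 (\<rho> / m)) (\<lambda>z. W z - q \<bullet> z)\<close> compact_cball by blast
    qed
    have "0 \<le> W z - q \<bullet> z" using z(2)[of 0] W0 \<open>\<rho> > 0\<close> \<open>m > 0\<close> by simp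
    moreover have "W z' - q \<bullet> z' \<le> 0" if "z' \<notin> cball 0 (\<rho> / m)" for z'
    proof -
      have n: "\<rho> < m * norm z'" using that \<open>m > 0\<close> by (simp add: field_simps)
      have "W z' - q \<bullet> z' \<le> - m * (norm z')\<^sup>2 + norm q * norm z'"
        using above[of z'] Cauchy_Schwarz_ineq2[of q z'] by simp
      also have "\<dots> \<le> - m * (norm z')\<^sup>2 + \<rho> * norm z'" using q by (simp add: mult_right_mono)
      also have "\<dots> = (\<rho> - m * norm z') * norm z'" by (simp add: algebra_simps power2_eq_square)
      also have "\<dots> \<le> 0" using n by (intro mult_nonpos_nonneg) auto
      finally show ?thesis .
    qed
    ultimately have "W z' - q \<bullet> z' \<le> W z - q \<bullet> z" for z' using z(2)[of z'] by (cases "z' \<in> cball 0 (\<rho> / m)") force+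
    then show ?thesis using q by (intro exI[of _ z]) (simp add: T_def inner_diff_right algebra_simps)
  qed
  have "\<forall>z\<in>E. \<exists>q. T z q" by (simp add: E_def)
  then obtain G where G: "\<And>z. z \<in> E \<Longrightarrow> T z (G z)" using bchoice[of E T] by blast
  have C: "C \<ge> 0" using ex[of 0] C0 \<open>\<rho> > 0\<close> by auto
  have uniq: "q = G z" if "T z q" for z q
  proof (rule ccontr)
    assume ne: "q \<noteq> G z"
    have "T z (G z)" using that G by (auto simp: E_def)
    then have b: "\<bar>(q - G z) \<bullet> (y - z)\<bar> \<le> 2 * C * (norm (y - z))\<^sup>2" for y
      using touch[OF that, of y] touch[of z "G z" y] by (simp add: inner_diff_left abs_le_iff)
    define w where "w = q - G z"
    have "w \<bullet> w > 0" using ne by (simp add: w_def)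
    moreover have "t * (w \<bullet> w) \<le> 2 * C * (t\<^sup>2 * (w \<bullet> w))" for t
      using b[of "z + t *\<^sub>R w"] by (simp add: w_def[symmetric] abs_le_iff power_mult_distrib dot_square_norm)
    ultimately have *: "t \<le> 2 * C * t\<^sup>2" for t by (metis mult.assoc mult_le_cancel_right_pos)
    have "C > 0" using *[of 1] by simp
    then show False using *[of "1 / (4 * C)"] by (simp add: power2_eq_square field_simps)
  qed
  have lipG: "(2 * C)-lipschitz_on E G"
  proof (rule lipschitz_onI)
    show "dist (G z) (G z') \<le> 2 * C * dist z z'" if "z \<in> E" "z' \<in> E" for z z'
      using lip[OF G[OF that(1)] G[OF that(2)]] C uniq[of z] uniq[of z'] G that
      by (cases "z = z'") (auto simp: dist_norm)
  qed (use C in simp)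
  \<comment> \<open>The set is the projection of a closed bounded set of pairs (point, slope); this
    gives measurability.\<close>
  have "compact E"
  proof -
    have "E = fst ` {p. T (fst p) (snd p)}"
    proof (intro set_eqI iffI)
      fix z assume "z \<in> E"
      then obtain q where "T z q" by (auto simp: E_def)
      then show "z \<in> fst ` {p. T (fst p) (snd p)}" by (intro image_eqI[of _ _ "(z, q)"]) simp_all
    qed (auto simp: E_def)
    moreover have "compact {p. T (fst p) (snd p)}"
    proof (rule compact_eq_bounded_closed[THEN iffD2], intro conjI)
      show "bounded {p. T (fst p) (snd p)}"
        by (rule bounded_subset[OF bounded_Times[OF bounded_cball[of 0 "\<rho> / m"] bounded_cball[of 0 \<rho>]]])
          (use bound in \<open>auto simp: T_def\<close>)
      have W: "continuous_on UNIV (\<lambda>p::'a \<times> 'a. W (fst p))"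
        by (rule continuous_on_compose2[OF cont]) (auto intro!: continuous_intros)
      show "closed {p. T (fst p) (snd p)}" unfolding T_def
        by (intro closed_Collect_conj closed_Collect_all closed_Collect_le continuous_intros W)
    qed
    then have "compact (fst ` {p. T (fst p) (snd p)})"
      by (intro compact_continuous_image continuous_intros)
    ultimately show ?thesis by simp
  qed
  then have Em: "E \<in> sets lebesgue" by (simp add: compact_imp_closed)
  have GE: "cball 0 \<rho> \<subseteq> G ` E"
  proof
    fix q :: 'a assume "q \<in> cball 0 \<rho>"
    then obtain z where "T z q" using ex[of q] by auto
    then show "q \<in> G ` E" using uniq by (auto simp: E_def)
  qed
  have notneg: "\<not> negligible E"
  proof
    assume "negligible E"
    then have "negligible (G ` E)"
    proof (rule negligible_locally_Lipschitz_image[rotated])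
      show "\<exists>U B. open U \<and> x \<in> U \<and> (\<forall>y\<in>E \<inter> U. norm (G y - G x) \<le> B * norm (y - x))" if "x \<in> E" for x
        using lipschitz_on_normD[OF lipG] that by (intro exI[of _ UNIV] exI[of _ "2 * C"]) auto
    qed simp
    then have "negligible (cball (0::'a) \<rho>)" using GE by (rule negligible_subset)
    then have "negligible (ball (0::'a) \<rho>)" by (rule negligible_subset) auto
    then show False using open_not_negligible[of "ball (0::'a) \<rho>"] \<open>\<rho> > 0\<close> by auto
  qed
  obtain F M where F: "M-lipschitz_on UNIV F" "\<And>x. x \<in> E \<Longrightarrow> F x = G x" using lipschitz_extend[OF lipG] by blast
  define N1 where "N1 = {x. \<not> F differentiable (at x)}"
  define N2 where "N2 = (\<Union>n::nat. {x \<in> E. \<not> (\<exists>d>0. \<forall>y. dist x y < d \<longrightarrow> (\<exists>x'\<in>E. dist x' y \<le> inverse (real (Suc n)) * dist x y))})"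
  have "negligible N1" unfolding N1_def using F(1) by (rule rademacher)
  moreover have "negligible N2" unfolding N2_def
  proof (rule negligible_countable_Union)
    fix S assume "S \<in> range (\<lambda>n::nat. {x \<in> E. \<not> (\<exists>d>0. \<forall>y. dist x y < d \<longrightarrow> (\<exists>x'\<in>E. dist x' y \<le> inverse (real (Suc n)) * dist x y))})"
    then obtain n where S: "S = {x \<in> E. \<not> (\<exists>d>0. \<forall>y. dist x y < d \<longrightarrow> (\<exists>x'\<in>E. dist x' y \<le> inverse (real (Suc n)) * dist x y))}" by auto
    show "negligible S" unfolding S by (rule density_negligible[OF Em]) simp
  qed simp
  ultimately have N12: "negligible (N1 \<union> N2)" by simp
  have "\<not> E \<subseteq> N1 \<union> N2"
  proof
    assume "E \<subseteq> N1 \<union> N2"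
    then have "negligible E" by (rule negligible_subset[OF N12])
    then show False using notneg by simp
  qed
  then obtain z where z: "z \<in> E" "z \<notin> N1" "z \<notin> N2" by auto
  have dens: "\<exists>d>0. \<forall>y. dist z y < d \<longrightarrow> (\<exists>x\<in>E. dist x y \<le> e * dist z y)" if e: "e > 0" for e
  proof -
    obtain n where n: "inverse (real (Suc n)) < e" using reals_Archimedean[OF e] by blast
    obtain d where d: "d > 0" "\<And>y. dist z y < d \<Longrightarrow> \<exists>x\<in>E. dist x y \<le> inverse (real (Suc n)) * dist z y"
      using z unfolding N2_def by blast
    have "\<exists>x\<in>E. dist x y \<le> e * dist z y" if y: "dist z y < d" for y
    proof -
      obtain x where "x \<in> E" "dist x y \<le> inverse (real (Suc n)) * dist z y" using d(2)[OF y] by blast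
      moreover have "inverse (real (Suc n)) * dist z y \<le> e * dist z y" using n by (intro mult_right_mono) auto
      ultimately show ?thesis by force
    qed
    then show ?thesis using d(1) by blast
  qed
  obtain D where D: "(F has_derivative D) (at z)" using z(2) by (auto simp: N1_def differentiable_def)
  have "T z (G z)" using G[OF z(1)] .
  moreover have "bounded_linear D" using D by (rule has_derivative_bounded_linear)
  moreover have "\<exists>d>0. \<forall>h. norm h < d \<longrightarrow> \<bar>W (z + h) - W z - G z \<bullet> h - D h \<bullet> h / 2\<bar> \<le> e * (norm h)\<^sup>2" if "e > 0" for e
    by (rule second_order_expansion_at_density_point[OF touch[OF G] z(1) dens D F(2) that])
  ultimately show ?thesis using bound[of z "G z"] unfolding T_def by blast
qed

section \<open>The theorem on sums\<close>

text \<open>The supremum runs over a closed ball because \<open>U\<close> is controlled only near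
  the contact point; it is then attained for continuous \<open>U\<close>, and no growth condition
  enters. Smaller \<delta> means less regularisation.\<close>

definition sup_conv :: "real \<Rightarrow> real \<Rightarrow> ('a::euclidean_space \<Rightarrow> real) \<Rightarrow> 'a \<Rightarrow> real" where
  "sup_conv r \<delta> U \<xi> = (SUP x\<in>cball 0 r. U x - (norm (x - \<xi>))\<^sup>2 / (2 * \<delta>))"

lemma sup_conv_attained:
  fixes U :: "'a::euclidean_space \<Rightarrow> real"
  assumes "continuous_on (cball 0 r) U" and "r > 0" and "\<delta> > 0"
  shows "\<exists>x\<in>cball 0 r. sup_conv r \<delta> U \<xi> = U x - (norm (x - \<xi>))\<^sup>2 / (2 * \<delta>)"
    and "y \<in> cball 0 r \<Longrightarrow> U y - (norm (y - \<xi>))\<^sup>2 / (2 * \<delta>) \<le> sup_conv r \<delta> U \<xi>"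
proof -
  have "continuous_on (cball 0 r) (\<lambda>x. U x - (norm (x - \<xi>))\<^sup>2 / (2 * \<delta>))"
    using assms by (intro continuous_intros) auto
  moreover have "cball (0::'a) r \<noteq> {}" using \<open>r > 0\<close> by simp
  ultimately obtain x where x: "x \<in> cball 0 r"
    "\<And>y. y \<in> cball 0 r \<Longrightarrow> U y - (norm (y - \<xi>))\<^sup>2 / (2 * \<delta>) \<le> U x - (norm (x - \<xi>))\<^sup>2 / (2 * \<delta>)"
    using continuous_attains_sup[OF compact_cball] by blast
  have "sup_conv r \<delta> U \<xi> = U x - (norm (x - \<xi>))\<^sup>2 / (2 * \<delta>)"
    unfolding sup_conv_def using x by (intro cSup_eq_maximum) auto
  then show "\<exists>x\<in>cball 0 r. sup_conv r \<delta> U \<xi> = U x - (norm (x - \<xi>))\<^sup>2 / (2 * \<delta>)"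
    and "y \<in> cball 0 r \<Longrightarrow> U y - (norm (y - \<xi>))\<^sup>2 / (2 * \<delta>) \<le> sup_conv r \<delta> U \<xi>"
    using x by auto
qed

lemma norm_sq_add: "(norm (a + b :: 'a::real_inner))\<^sup>2 = (norm a)\<^sup>2 + 2 * (a \<bullet> b) + (norm b)\<^sup>2"
  unfolding power2_norm_eq_inner by (simp add: inner_add_left inner_add_right inner_commute)

lemma norm_sq_diff: "(norm (a - b :: 'a::real_inner))\<^sup>2 = (norm a)\<^sup>2 - 2 * (a \<bullet> b) + (norm b)\<^sup>2"
  unfolding power2_norm_eq_inner by (simp add: inner_diff_left inner_diff_right inner_commute)

lemma norm_sq_add_le: "(norm (a + b :: 'a::real_inner))\<^sup>2 \<le> 2 * ((norm a)\<^sup>2 + (norm b)\<^sup>2)"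
proof -
  have "0 \<le> (norm (a - b))\<^sup>2" by simp
  then show ?thesis unfolding norm_sq_add norm_sq_diff by simp
qed

text \<open>Freezing the point \<open>x\<close> that is optimal for \<xi> leaves a concave
  paraboloid below the sup-convolution, touching it at \<xi>; its slope there is
  \<open>(x - \<xi>) /\<^sub>R \<delta>\<close>. This is semiconvexity with an explicit
  subgradient.\<close>

lemma sup_conv_subgradient:
  fixes U :: "'a::euclidean_space \<Rightarrow> real"
  assumes U: "continuous_on (cball 0 r) U" "r > 0" "\<delta> > 0"
    and x: "x \<in> cball 0 r" "sup_conv r \<delta> U \<xi> = U x - (norm (x - \<xi>))\<^sup>2 / (2 * \<delta>)"
  shows "sup_conv r \<delta> U \<xi>' \<ge> sup_conv r \<delta> U \<xi> + ((x - \<xi>) /\<^sub>R \<delta>) \<bullet> (\<xi>' - \<xi>) - (norm (\<xi>' - \<xi>))\<^sup>2 / (2 * \<delta>)"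
proof -
  have e: "(norm (x - \<xi>'))\<^sup>2 = (norm (x - \<xi>))\<^sup>2 - 2 * ((x - \<xi>) \<bullet> (\<xi>' - \<xi>)) + (norm (\<xi>' - \<xi>))\<^sup>2"
    using norm_sq_diff[of "x - \<xi>" "\<xi>' - \<xi>"] by simp
  have "U x - (norm (x - \<xi>'))\<^sup>2 / (2 * \<delta>) = sup_conv r \<delta> U \<xi> + ((x - \<xi>) /\<^sub>R \<delta>) \<bullet> (\<xi>' - \<xi>) - (norm (\<xi>' - \<xi>))\<^sup>2 / (2 * \<delta>)"
  proof -
    have "u - (A - 2 * q + c) / (2 * \<delta>) = u - A / (2 * \<delta>) + inverse \<delta> * q - c / (2 * \<delta>)" for u A q c :: real
      using \<open>\<delta> > 0\<close> by (simp add: field_simps)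
    then show ?thesis unfolding x(2) e inner_scaleR_left .
  qed
  then show ?thesis using sup_conv_attained(2)[OF U x(1), of \<xi>'] by simp
qed

text \<open>The subgradients are bounded by \<open>(r + norm \<xi>) / \<delta>\<close>, and the
  resulting lower bound is used with the two points in both orders.\<close>

lemma continuous_on_sup_conv:
  fixes U :: "'a::euclidean_space \<Rightarrow> real"
  assumes U: "continuous_on (cball 0 r) U" "r > 0" "\<delta> > 0"
  shows "continuous_on UNIV (sup_conv r \<delta> U)"
proof -
  have lower: "sup_conv r \<delta> U \<xi>' \<ge> sup_conv r \<delta> U \<xi> - (r + norm \<xi>) / \<delta> * norm (\<xi>' - \<xi>) - (norm (\<xi>' - \<xi>))\<^sup>2 / (2 * \<delta>)" for \<xi> \<xi>'
  proof -
    obtain x where x: "x \<in> cball 0 r" "sup_conv r \<delta> U \<xi> = U x - (norm (x - \<xi>))\<^sup>2 / (2 * \<delta>)"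
      using sup_conv_attained(1)[OF U] by blast
    have "norm (x - \<xi>) \<le> r + norm \<xi>" using x norm_triangle_ineq4[of x \<xi>] by simp
    then have "norm ((x - \<xi>) /\<^sub>R \<delta>) \<le> (r + norm \<xi>) / \<delta>"
      using \<open>\<delta> > 0\<close> by (simp add: divide_inverse mult.commute mult_left_mono)
    then have "\<bar>((x - \<xi>) /\<^sub>R \<delta>) \<bullet> (\<xi>' - \<xi>)\<bar> \<le> (r + norm \<xi>) / \<delta> * norm (\<xi>' - \<xi>)"
      by (meson Cauchy_Schwarz_ineq2 mult_right_mono norm_ge_zero order_trans)
    then show ?thesis using sup_conv_subgradient[OF U x, of \<xi>'] by linarith
  qed
  have "(sup_conv r \<delta> U \<longlongrightarrow> sup_conv r \<delta> U \<xi>) (at \<xi>)" for \<xi>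
  proof (rule tendsto_sandwich)
    show "\<forall>\<^sub>F \<xi>' in at \<xi>. sup_conv r \<delta> U \<xi> - (r + norm \<xi>) / \<delta> * norm (\<xi>' - \<xi>) - (norm (\<xi>' - \<xi>))\<^sup>2 / (2 * \<delta>) \<le> sup_conv r \<delta> U \<xi>'"
      using lower by (intro always_eventually allI) simp
    show "\<forall>\<^sub>F \<xi>' in at \<xi>. sup_conv r \<delta> U \<xi>' \<le> sup_conv r \<delta> U \<xi> + (r + norm \<xi>') / \<delta> * norm (\<xi> - \<xi>') + (norm (\<xi> - \<xi>'))\<^sup>2 / (2 * \<delta>)"
    proof (intro always_eventually allI)
      fix \<xi>'
      show "sup_conv r \<delta> U \<xi>' \<le> sup_conv r \<delta> U \<xi> + (r + norm \<xi>') / \<delta> * norm (\<xi> - \<xi>') + (norm (\<xi> - \<xi>'))\<^sup>2 / (2 * \<delta>)"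
        using lower[of \<xi>' \<xi>] by linarith
    qed
    have "((\<lambda>\<xi>'. sup_conv r \<delta> U \<xi> - (r + norm \<xi>) / \<delta> * norm (\<xi>' - \<xi>) - (norm (\<xi>' - \<xi>))\<^sup>2 / (2 * \<delta>)) \<longlongrightarrow>
        sup_conv r \<delta> U \<xi> - (r + norm \<xi>) / \<delta> * norm (\<xi> - \<xi>) - (norm (\<xi> - \<xi>))\<^sup>2 / (2 * \<delta>)) (at \<xi>)"
      using \<open>\<delta> > 0\<close> by (intro tendsto_intros) auto
    then show "((\<lambda>\<xi>'. sup_conv r \<delta> U \<xi> - (r + norm \<xi>) / \<delta> * norm (\<xi>' - \<xi>) - (norm (\<xi>' - \<xi>))\<^sup>2 / (2 * \<delta>)) \<longlongrightarrow> sup_conv r \<delta> U \<xi>) (at \<xi>)"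
      by simp
    have "((\<lambda>\<xi>'. sup_conv r \<delta> U \<xi> + (r + norm \<xi>') / \<delta> * norm (\<xi> - \<xi>') + (norm (\<xi> - \<xi>'))\<^sup>2 / (2 * \<delta>)) \<longlongrightarrow>
        sup_conv r \<delta> U \<xi> + (r + norm \<xi>) / \<delta> * norm (\<xi> - \<xi>) + (norm (\<xi> - \<xi>))\<^sup>2 / (2 * \<delta>)) (at \<xi>)"
      using \<open>\<delta> > 0\<close> by (intro tendsto_intros) auto
    then show "((\<lambda>\<xi>'. sup_conv r \<delta> U \<xi> + (r + norm \<xi>') / \<delta> * norm (\<xi> - \<xi>') + (norm (\<xi> - \<xi>'))\<^sup>2 / (2 * \<delta>)) \<longlongrightarrow> sup_conv r \<delta> U \<xi>) (at \<xi>)"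
      by simp
  qed
  then have "\<forall>\<xi>\<in>UNIV. isCont (sup_conv r \<delta> U) \<xi>" unfolding isCont_def by blast
  then show ?thesis by (rule continuous_at_imp_continuous_on)
qed

text \<open>The quadratic upper bound survives regularisation with a constant larger by a multiple
  of \<delta>. If \<open>s\<close> denotes how much the difference of the optimal points departs
  from \<open>\<xi> - \<zeta>\<close>, the penalties cost at least
  \<open>(norm s)\<^sup>2 / (4 * \<delta>)\<close>, which absorbs all terms containing
  \<open>s\<close>.\<close>

lemma sup_conv_sum_le:
  fixes U V :: "'a::euclidean_space \<Rightarrow> real"
  assumes U: "continuous_on (cball 0 r) U" and V: "continuous_on (cball 0 r) V" and r: "r > 0"
    and B: "B \<ge> 0" and UV: "\<And>x y. x \<in> cball 0 r \<Longrightarrow> y \<in> cball 0 r \<Longrightarrow> U x + V y \<le> B / 2 * (norm (x - y))\<^sup>2"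
    and \<delta>: "\<delta> > 0" "4 * \<delta> * B \<le> 1"
  shows "sup_conv r \<delta> U \<xi> + sup_conv r \<delta> V \<zeta> \<le> (B / 2 + 2 * \<delta> * B\<^sup>2) * (norm (\<xi> - \<zeta>))\<^sup>2"
proof -
  obtain x where x: "x \<in> cball 0 r" "sup_conv r \<delta> U \<xi> = U x - (norm (x - \<xi>))\<^sup>2 / (2 * \<delta>)"
    using sup_conv_attained(1)[OF U r \<delta>(1)] by blast
  obtain y where y: "y \<in> cball 0 r" "sup_conv r \<delta> V \<zeta> = V y - (norm (y - \<zeta>))\<^sup>2 / (2 * \<delta>)"
    using sup_conv_attained(1)[OF V r \<delta>(1)] by blast
  define w where "w = \<xi> - \<zeta>"
  define s where "s = (x - \<xi>) - (y - \<zeta>)"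
  have xy: "x - y = w + s" by (simp add: w_def s_def)
  have s2: "(norm s)\<^sup>2 \<le> 2 * ((norm (x - \<xi>))\<^sup>2 + (norm (y - \<zeta>))\<^sup>2)"
    using norm_sq_add_le[of "x - \<xi>" "- (y - \<zeta>)"] by (simp only: s_def norm_minus_cancel add_uminus_conv_diff)
  have "(norm s)\<^sup>2 / (4 * \<delta>) \<le> (norm (x - \<xi>))\<^sup>2 / (2 * \<delta>) + (norm (y - \<zeta>))\<^sup>2 / (2 * \<delta>)"
    using s2 \<delta>(1) by (simp add: field_simps)
  then have "sup_conv r \<delta> U \<xi> + sup_conv r \<delta> V \<zeta> \<le> B / 2 * (norm (w + s))\<^sup>2 - (norm s)\<^sup>2 / (4 * \<delta>)"
    using UV[OF x(1) y(1)] unfolding x(2) y(2) xy by linarith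
  also have "B / 2 * (norm (w + s))\<^sup>2 \<le> B / 2 * (norm w)\<^sup>2 + B * (norm w * norm s) + B / 2 * (norm s)\<^sup>2"
  proof -
    have "B * (w \<bullet> s) \<le> B * (norm w * norm s)" using B norm_cauchy_schwarz by (intro mult_left_mono)
    then show ?thesis unfolding norm_sq_add by (simp add: algebra_simps)
  qed
  \<comment> \<open>Half of the penalty pays for the square of \<open>s\<close>; the other half is
    kept for the mixed term.\<close>
  also have "B / 2 * (norm s)\<^sup>2 \<le> (norm s)\<^sup>2 / (8 * \<delta>)"
  proof -
    have "B / 2 \<le> 1 / (8 * \<delta>)" using \<delta> by (simp add: field_simps)
    then have "B / 2 * (norm s)\<^sup>2 \<le> 1 / (8 * \<delta>) * (norm s)\<^sup>2" by (rule mult_right_mono) simp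
    then show ?thesis by simp
  qed
  finally have 1: "sup_conv r \<delta> U \<xi> + sup_conv r \<delta> V \<zeta> \<le>
      B / 2 * (norm w)\<^sup>2 + B * (norm w * norm s) + (norm s)\<^sup>2 / (8 * \<delta>) - (norm s)\<^sup>2 / (4 * \<delta>)" by simp
  \<comment> \<open>Completing the square for the mixed term against the remaining half of the
    penalty.\<close>
  have "0 \<le> (norm s - 4 * \<delta> * B * norm w)\<^sup>2 / (8 * \<delta>)" using \<delta> by simp
  also have "\<dots> = (norm s)\<^sup>2 / (8 * \<delta>) - B * (norm w * norm s) + 2 * \<delta> * B\<^sup>2 * (norm w)\<^sup>2"
    using \<delta> by (simp add: power2_diff field_simps) (simp add: power2_eq_square algebra_simps)
  finally have 2: "B * (norm w * norm s) \<le> (norm s)\<^sup>2 / (8 * \<delta>) + 2 * \<delta> * B\<^sup>2 * (norm w)\<^sup>2" by simp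
  have "(norm s)\<^sup>2 / (8 * \<delta>) + (norm s)\<^sup>2 / (8 * \<delta>) = (norm s)\<^sup>2 / (4 * \<delta>)" using \<delta> by (simp add: field_simps)
  then show ?thesis using 1 2 unfolding w_def[symmetric] by (simp add: algebra_simps)
qed

text \<open>With \<open>h = t *\<^sub>R (q - p)\<close> and \<open>t\<close> small a linear term
  cannot be dominated by a quadratic one.\<close>

lemma eq_gradient_of_quadratic_bounds:
  fixes p q :: "'a::real_inner"
  assumes "d > 0" and "\<And>h. norm h < d \<Longrightarrow> (q - p) \<bullet> h \<le> c * (norm h)\<^sup>2"
  shows "q = p"
proof (rule ccontr)
  assume "q \<noteq> p"
  define w where "w = q - p"
  have w: "norm w > 0" using \<open>q \<noteq> p\<close> by (simp add: w_def)
  define c' where "c' = \<bar>c\<bar> + 1"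
  define t where "t = min (d / (2 * norm w)) (1 / (2 * c'))"
  have c': "c' > 0" by (simp add: c'_def)
  have t: "t > 0" using w \<open>d > 0\<close> c' by (simp add: t_def)
  have "t \<le> d / (2 * norm w)" by (simp add: t_def)
  then have "norm (t *\<^sub>R w) < d" using w t \<open>d > 0\<close> by (simp add: field_simps)
  then have "w \<bullet> (t *\<^sub>R w) \<le> c * (norm (t *\<^sub>R w))\<^sup>2" using assms(2) w_def by blast
  then have "t * (norm w)\<^sup>2 \<le> (c * t) * t * (norm w)\<^sup>2"
    by (simp add: dot_square_norm power_mult_distrib power2_eq_square mult_ac)
  then have "1 \<le> c * t" using t w by (simp add: mult_le_cancel_right)
  also have "c * t \<le> c' * t" using t by (intro mult_right_mono) (auto simp: c'_def)
  also have "\<dots> \<le> c' * (1 / (2 * c'))" using c' by (intro mult_left_mono) (auto simp: t_def)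
  also have "\<dots> < 1" using c' by simp
  finally have "(1::real) < 1" .
  then show False by simp
qed

lemma sup_conv_upper_expansion:
  fixes U :: "'a::euclidean_space \<Rightarrow> real"
  assumes U: "continuous_on (cball 0 r) U" "r > 0" "\<delta> > 0"
    and exp: "\<And>e. e > 0 \<Longrightarrow> \<exists>d>0. \<forall>h. norm h < d \<longrightarrow> \<bar>sup_conv r \<delta> U (\<xi> + h) - sup_conv r \<delta> U \<xi> - p \<bullet> h - Q h / 2\<bar> \<le> e * (norm h)\<^sup>2"
    and Qb: "\<And>h. Q h \<le> c * (norm h)\<^sup>2"
    and small: "norm \<xi> + \<delta> * norm p < r"
  obtains x where "norm (x - \<xi>) = \<delta> * norm p"
    "\<And>e. e > 0 \<Longrightarrow> \<forall>\<^sub>F h in nhds 0. U (x + h) \<le> U x + p \<bullet> h + Q h / 2 + e * (norm h)\<^sup>2"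
proof -
  let ?a = "sup_conv r \<delta> U"
  obtain x where x: "x \<in> cball 0 r" "?a \<xi> = U x - (norm (x - \<xi>))\<^sup>2 / (2 * \<delta>)"
    using sup_conv_attained(1)[OF U] by blast
  obtain d where d: "d > 0" "\<And>h. norm h < d \<Longrightarrow> \<bar>?a (\<xi> + h) - ?a \<xi> - p \<bullet> h - Q h / 2\<bar> \<le> 1 * (norm h)\<^sup>2"
    using exp[of 1] by auto
  have "(x - \<xi>) /\<^sub>R \<delta> = p"
  proof (rule eq_gradient_of_quadratic_bounds[OF d(1)])
    fix h :: 'a assume h: "norm h < d"
    have "?a (\<xi> + h) \<ge> ?a \<xi> + ((x - \<xi>) /\<^sub>R \<delta>) \<bullet> h - (norm h)\<^sup>2 / (2 * \<delta>)"
      using sup_conv_subgradient[OF U x, of "\<xi> + h"] by simp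
    moreover have "?a (\<xi> + h) \<le> ?a \<xi> + p \<bullet> h + Q h / 2 + (norm h)\<^sup>2" using d(2)[OF h] by (simp add: abs_le_iff)
    ultimately have "((x - \<xi>) /\<^sub>R \<delta> - p) \<bullet> h \<le> Q h / 2 + (norm h)\<^sup>2 + (norm h)\<^sup>2 / (2 * \<delta>)"
      unfolding inner_diff_left by linarith
    also have "\<dots> \<le> (c / 2 + 1 + 1 / (2 * \<delta>)) * (norm h)\<^sup>2" using Qb[of h] by (simp add: algebra_simps)
    finally show "((x - \<xi>) /\<^sub>R \<delta> - p) \<bullet> h \<le> (c / 2 + 1 + 1 / (2 * \<delta>)) * (norm h)\<^sup>2" .
  qed
  then have "x - \<xi> = \<delta> *\<^sub>R p" using \<open>\<delta> > 0\<close> by auto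
  then have nx: "norm (x - \<xi>) = \<delta> * norm p" using \<open>\<delta> > 0\<close> by simp
  have xr: "norm x < r" using norm_triangle_ineq[of "x - \<xi>" \<xi>] nx small by simp
  show thesis
  proof
    show "norm (x - \<xi>) = \<delta> * norm p" by (rule nx)
    fix e :: real assume "e > 0"
    then obtain d where d: "d > 0" "\<And>h. norm h < d \<Longrightarrow> \<bar>?a (\<xi> + h) - ?a \<xi> - p \<bullet> h - Q h / 2\<bar> \<le> e * (norm h)\<^sup>2"
      using exp by blast
    show "\<forall>\<^sub>F h in nhds 0. U (x + h) \<le> U x + p \<bullet> h + Q h / 2 + e * (norm h)\<^sup>2"
      unfolding eventually_nhds_metric
    proof (intro exI[of _ "min d (r - norm x)"] conjI allI impI)
      fix h :: 'a assume h: "dist h 0 < min d (r - norm x)"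
      have "x + h \<in> cball 0 r" using h norm_triangle_ineq[of x h] by simp
      then have "U (x + h) - (norm (x - \<xi>))\<^sup>2 / (2 * \<delta>) \<le> ?a (\<xi> + h)"
        using sup_conv_attained(2)[OF U, of "x + h" "\<xi> + h"] by simp
      then show "U (x + h) \<le> U x + p \<bullet> h + Q h / 2 + e * (norm h)\<^sup>2"
        using d(2)[of h] h x(2) by (simp add: abs_le_iff)
    qed (use d xr in auto)
  qed
qed

section \<open>The approximate theorem on sums\<close>

text \<open>Both functions are regularised, the quadratic coupling and a small \<eta>-multiple of
  the squared norm are subtracted, and \<open>jensen_alexandrov\<close> is applied on the product
  space. Expansions in \<open>(h, 0)\<close> and \<open>(0, h)\<close> give the two separate jets;
  maximality of the contact point in all directions gives the joint inequality.\<close>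

lemma theorem_on_sums_maps:
  fixes U V :: "'a::euclidean_space \<Rightarrow> real"
  assumes U: "continuous_on (cball 0 r) U" and V: "continuous_on (cball 0 r) V" and r: "r > 0"
    and U0: "U 0 = 0" and V0: "V 0 = 0"
    and B: "B \<ge> 0" and UV: "\<And>x y. x \<in> cball 0 r \<Longrightarrow> y \<in> cball 0 r \<Longrightarrow> U x + V y \<le> B / 2 * (norm (x - y))\<^sup>2"
    and \<tau>: "\<tau> > 0"
  shows "\<exists>x y p1 p2 Q1 Q2.
    norm x < \<tau> \<and> norm y < \<tau> \<and> norm p1 < \<tau> \<and> norm p2 < \<tau> \<and> bounded_linear Q1 \<and> bounded_linear Q2 \<and>
    (\<forall>e>0. \<forall>\<^sub>F h in nhds 0. U (x + h) \<le> U x + p1 \<bullet> h + (Q1 h \<bullet> h) / 2 + e * (norm h)\<^sup>2) \<and>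
    (\<forall>e>0. \<forall>\<^sub>F h in nhds 0. V (y + h) \<le> V y + p2 \<bullet> h + (Q2 h \<bullet> h) / 2 + e * (norm h)\<^sup>2) \<and>
    (\<forall>v w. Q1 v \<bullet> v + Q2 w \<bullet> w \<le> B * (norm (v - w))\<^sup>2 + \<tau> * ((norm v)\<^sup>2 + (norm w)\<^sup>2))"
proof -
  \<comment> \<open>The final inequality collects \<open>4 * \<eta>\<close>: one \<eta> from the
    subtracted square, one from the expansions, both doubled because second order terms carry the
    factor 1/2.\<close>
  define \<eta> where "\<eta> = \<tau> / 4"
  have \<eta>: "\<eta> > 0" using \<tau> by (simp add: \<eta>_def)
  \<comment> \<open>The first entry meets the smallness condition of \<open>sup_conv_sum_le\<close>,
    the second keeps the excess of that lemma below half of the penalty \<eta>. With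
    \<open>B + 1\<close> the quotients are defined for \<open>B = 0\<close>.\<close>
  define \<delta> where "\<delta> = min (1 / (4 * (B + 1))) (\<eta> / (8 * (B + 1)\<^sup>2))"
  have \<delta>: "\<delta> > 0" using B \<eta> by (simp add: \<delta>_def)
  have \<delta>1: "4 * \<delta> * B \<le> 1"
  proof -
    have "4 * \<delta> * B \<le> 4 * (1 / (4 * (B + 1))) * B" using B by (intro mult_right_mono mult_left_mono) (auto simp: \<delta>_def)
    also have "\<dots> \<le> 1" using B by (simp add: field_simps)
    finally show ?thesis .
  qed
  have \<delta>2: "4 * \<delta> * B\<^sup>2 \<le> \<eta> / 2"
  proof -
    have "4 * \<delta> * B\<^sup>2 \<le> 4 * (\<eta> / (8 * (B + 1)\<^sup>2)) * (B + 1)\<^sup>2"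
      using B \<delta> \<eta> by (intro mult_mono power_mono) (auto simp: \<delta>_def)
    also have "\<dots> = \<eta> / 2" using B by (simp add: field_simps)
    finally show ?thesis .
  qed
  define a where "a = sup_conv r \<delta> U"
  define b where "b = sup_conv r \<delta> V"
  define W where "W z = a (fst z) + b (snd z) - B / 2 * (norm (fst z - snd z))\<^sup>2 - \<eta> * (norm z)\<^sup>2" for z
  have ca: "continuous_on UNIV a" unfolding a_def by (rule continuous_on_sup_conv[OF U r \<delta>])
  have cb: "continuous_on UNIV b" unfolding b_def by (rule continuous_on_sup_conv[OF V r \<delta>])
  have cW: "continuous_on UNIV W"
  proof -
    have "continuous_on UNIV (\<lambda>z::'a \<times> 'a. a (fst z))" by (rule continuous_on_compose2[OF ca]) (auto intro!: continuous_intros)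
    moreover have "continuous_on UNIV (\<lambda>z::'a \<times> 'a. b (snd z))" by (rule continuous_on_compose2[OF cb]) (auto intro!: continuous_intros)
    ultimately show ?thesis unfolding W_def by (intro continuous_intros)
  qed
  have nz: "(norm z)\<^sup>2 = (norm (fst z))\<^sup>2 + (norm (snd z))\<^sup>2" for z :: "'a \<times> 'a"
    by (simp add: norm_prod_def)
  have Wp: "W (s, t) = a s + b t - B / 2 * (norm (s - t))\<^sup>2 - \<eta> * ((norm s)\<^sup>2 + (norm t)\<^sup>2)" for s t
    unfolding W_def nz by simp
  have above: "W z \<le> - (\<eta> / 2) * (norm z)\<^sup>2" for z
  proof -
    have "a (fst z) + b (snd z) \<le> (B / 2 + 2 * \<delta> * B\<^sup>2) * (norm (fst z - snd z))\<^sup>2"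
      unfolding a_def b_def by (rule sup_conv_sum_le[OF U V r B UV \<delta> \<delta>1])
    moreover have "2 * \<delta> * B\<^sup>2 * (norm (fst z - snd z))\<^sup>2 \<le> 2 * \<delta> * B\<^sup>2 * (2 * (norm z)\<^sup>2)"
      using norm_sq_add_le[of "fst z" "- snd z"] \<delta> nz[of z] by (intro mult_left_mono) auto
    moreover have "4 * \<delta> * B\<^sup>2 * (norm z)\<^sup>2 \<le> \<eta> / 2 * (norm z)\<^sup>2" using \<delta>2 by (rule mult_right_mono) simp
    ultimately show ?thesis unfolding W_def by (simp add: algebra_simps)
  qed
  have "a 0 \<ge> 0" "b 0 \<ge> 0"
    using sup_conv_attained(2)[OF U r \<delta>, of 0 0] sup_conv_attained(2)[OF V r \<delta>, of 0 0] r U0 V0 by (auto simp: a_def b_def)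
  then have W0: "W 0 = 0" using above[of 0] by (simp add: W_def)
  define C where "C = 1 / (2 * \<delta>) + B + \<eta>"
  have below: "\<exists>s. \<forall>z'. W z' \<ge> W z + s \<bullet> (z' - z) - C * (norm (z' - z))\<^sup>2" for z
  proof -
    obtain \<xi> \<zeta> where z: "z = (\<xi>, \<zeta>)" by (cases z)
    obtain x where x: "x \<in> cball 0 r" "a \<xi> = U x - (norm (x - \<xi>))\<^sup>2 / (2 * \<delta>)"
      using sup_conv_attained(1)[OF U r \<delta>] unfolding a_def by blast
    obtain y where y: "y \<in> cball 0 r" "b \<zeta> = V y - (norm (y - \<zeta>))\<^sup>2 / (2 * \<delta>)"
      using sup_conv_attained(1)[OF V r \<delta>] unfolding b_def by blast
    define s1 where "s1 = (x - \<xi>) /\<^sub>R \<delta>"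
    define s2 where "s2 = (y - \<zeta>) /\<^sub>R \<delta>"
    define s where "s = (s1 - B *\<^sub>R (\<xi> - \<zeta>) - (2 * \<eta>) *\<^sub>R \<xi>, s2 + B *\<^sub>R (\<xi> - \<zeta>) - (2 * \<eta>) *\<^sub>R \<zeta>)"
    have "W z' \<ge> W z + s \<bullet> (z' - z) - C * (norm (z' - z))\<^sup>2" for z'
    proof -
      obtain h l where hl: "z' = (\<xi> + h, \<zeta> + l)" by (metis add.commute diff_add_cancel surj_pair)
      have 1: "a (\<xi> + h) \<ge> a \<xi> + s1 \<bullet> h - (norm h)\<^sup>2 / (2 * \<delta>)"
        using sup_conv_subgradient[OF U r \<delta> x(1), of \<xi> "\<xi> + h"] x(2) by (simp add: a_def s1_def)
      have 2: "b (\<zeta> + l) \<ge> b \<zeta> + s2 \<bullet> l - (norm l)\<^sup>2 / (2 * \<delta>)"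
        using sup_conv_subgradient[OF V r \<delta> y(1), of \<zeta> "\<zeta> + l"] y(2) by (simp add: b_def s2_def)
      have e: "\<xi> + h - (\<zeta> + l) = (\<xi> - \<zeta>) + (h - l)" by simp
      have "B / 2 * (norm (h - l))\<^sup>2 \<le> B / 2 * (2 * ((norm h)\<^sup>2 + (norm l)\<^sup>2))"
        using norm_sq_add_le[of h "- l"] B by (intro mult_left_mono) auto
      then have 3: "B / 2 * (norm (\<xi> + h - (\<zeta> + l)))\<^sup>2 \<le> B / 2 * (norm (\<xi> - \<zeta>))\<^sup>2 + B * ((\<xi> - \<zeta>) \<bullet> (h - l)) + B * ((norm h)\<^sup>2 + (norm l)\<^sup>2)"
        unfolding e norm_sq_add[of "\<xi> - \<zeta>"] by (simp add: algebra_simps)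
      have 4: "(norm z')\<^sup>2 = (norm \<xi>)\<^sup>2 + (norm \<zeta>)\<^sup>2 + 2 * (\<xi> \<bullet> h) + 2 * (\<zeta> \<bullet> l) + ((norm h)\<^sup>2 + (norm l)\<^sup>2)"
        unfolding nz hl by (simp add: norm_sq_add)
      have 5: "(norm (z' - z))\<^sup>2 = (norm h)\<^sup>2 + (norm l)\<^sup>2" unfolding nz hl z by simp
      have 6: "s \<bullet> (z' - z) = s1 \<bullet> h + s2 \<bullet> l - B * ((\<xi> - \<zeta>) \<bullet> (h - l)) - 2 * \<eta> * (\<xi> \<bullet> h) - 2 * \<eta> * (\<zeta> \<bullet> l)"
        by (simp add: s_def hl z inner_Pair inner_diff_left inner_diff_right inner_add_left algebra_simps)
      have 7: "W z = a \<xi> + b \<zeta> - B / 2 * (norm (\<xi> - \<zeta>))\<^sup>2 - \<eta> * ((norm \<xi>)\<^sup>2 + (norm \<zeta>)\<^sup>2)"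
        unfolding W_def nz by (simp add: z)
      have 8: "W z' = a (\<xi> + h) + b (\<zeta> + l) - B / 2 * (norm (\<xi> + h - (\<zeta> + l)))\<^sup>2 - \<eta> * (norm z')\<^sup>2"
        by (simp add: W_def hl)
      have 9: "C * (norm (z' - z))\<^sup>2 = (norm h)\<^sup>2 / (2 * \<delta>) + (norm l)\<^sup>2 / (2 * \<delta>) + B * ((norm h)\<^sup>2 + (norm l)\<^sup>2) + \<eta> * ((norm h)\<^sup>2 + (norm l)\<^sup>2)"
        unfolding 5 C_def by (simp add: algebra_simps add_divide_distrib)
      show ?thesis unfolding 9 using 1 2 3 unfolding 6 7 8 4 by (simp add: algebra_simps)
    qed
    then show ?thesis by blast
  qed
  \<comment> \<open>All quantities are multiples of \<rho>: slopes at most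
    \<open>5 + 4 * B / \<eta>\<close> times \<rho> (1 from \<open>q\<close>,
    \<open>4 * B / \<eta>\<close> from the coupling, 4 from the square), centres at most
    \<open>2 / \<eta>\<close> times \<rho>, and contact points differ from the centres by \<delta>
    times a slope.\<close>
  define c where "c = 5 + 4 * B / \<eta> + 2 / \<eta> + \<delta> * (5 + 4 * B / \<eta>)"
  have c: "c > 0" "5 + 4 * B / \<eta> \<le> c" "2 / \<eta> + \<delta> * (5 + 4 * B / \<eta>) \<le> c"
    using B \<eta> \<delta> by (auto simp: c_def add_pos_nonneg)
  define \<rho> where "\<rho> = min \<tau> r / (2 * c)"
  have \<rho>: "\<rho> > 0" using \<tau> r c by (simp add: \<rho>_def)
  have c\<rho>: "c * \<rho> < min \<tau> r"
  proof -
    have "c * \<rho> = min \<tau> r / 2" using c by (simp add: \<rho>_def)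
    moreover have "min \<tau> r > 0" using \<tau> r by simp
    ultimately show ?thesis by linarith
  qed
  have "\<eta> / 2 > 0" using \<eta> by simp
  obtain z q D where J: "norm z \<le> \<rho> / (\<eta> / 2)" "norm q \<le> \<rho>" "\<And>z'. W z' \<le> W z + q \<bullet> (z' - z)" "bounded_linear D"
    "\<And>e. e > 0 \<Longrightarrow> \<exists>d>0. \<forall>h. norm h < d \<longrightarrow> \<bar>W (z + h) - W z - q \<bullet> h - D h \<bullet> h / 2\<bar> \<le> e * (norm h)\<^sup>2"
    using jensen_alexandrov[OF cW W0 above \<open>\<eta> / 2 > 0\<close> below \<rho>] by blast
  obtain \<xi> \<zeta> where z: "z = (\<xi>, \<zeta>)" by (cases z)
  obtain q1 q2 where q: "q = (q1, q2)" by (cases q)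
  interpret D: bounded_linear D by (rule J(4))
  have n\<xi>: "norm \<xi> \<le> 2 * \<rho> / \<eta>" "norm \<zeta> \<le> 2 * \<rho> / \<eta>"
    using J(1) norm_fst_le[of \<xi> \<zeta>] norm_snd_le[of \<zeta> \<xi>] z by (simp_all add: mult.commute)
  have nq: "norm q1 \<le> \<rho>" "norm q2 \<le> \<rho>"
    using J(2) norm_fst_le[of q1 q2] norm_snd_le[of q2 q1] q by simp_all
  \<comment> \<open>The slopes of the two regularised functions: those of \<open>W\<close> corrected
    by the gradients of the subtracted quadratics.\<close>
  define p1 where "p1 = q1 + B *\<^sub>R (\<xi> - \<zeta>) + (2 * \<eta>) *\<^sub>R \<xi>"
  define p2 where "p2 = q2 - B *\<^sub>R (\<xi> - \<zeta>) + (2 * \<eta>) *\<^sub>R \<zeta>"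
  have nd: "norm (B *\<^sub>R (\<xi> - \<zeta>)) \<le> B * (4 * \<rho> / \<eta>)"
  proof -
    have "norm (\<xi> - \<zeta>) \<le> 4 * \<rho> / \<eta>" using norm_triangle_ineq4[of \<xi> \<zeta>] n\<xi> by simp
    then show ?thesis using B by (simp add: mult_left_mono del: times_divide_eq_right)
  qed
  have n\<eta>: "norm ((2 * \<eta>) *\<^sub>R \<xi>) \<le> 4 * \<rho>" "norm ((2 * \<eta>) *\<^sub>R \<zeta>) \<le> 4 * \<rho>"
    using n\<xi> \<eta> by (simp_all add: field_simps)
  have np: "norm p1 \<le> (5 + 4 * B / \<eta>) * \<rho>" "norm p2 \<le> (5 + 4 * B / \<eta>) * \<rho>"
  proof -
    have "norm p1 \<le> norm q1 + norm (B *\<^sub>R (\<xi> - \<zeta>)) + norm ((2 * \<eta>) *\<^sub>R \<xi>)"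
      unfolding p1_def by (meson add_right_mono norm_triangle_ineq order_trans)
    also have "\<dots> \<le> \<rho> + B * (4 * \<rho> / \<eta>) + 4 * \<rho>" using nq nd n\<eta> by simp
    finally show "norm p1 \<le> (5 + 4 * B / \<eta>) * \<rho>" by (simp add: algebra_simps)
    have "norm p2 \<le> norm q2 + norm (B *\<^sub>R (\<xi> - \<zeta>)) + norm ((2 * \<eta>) *\<^sub>R \<zeta>)"
      unfolding p2_def by (meson add_right_mono norm_triangle_ineq norm_triangle_ineq4 order_trans)
    also have "\<dots> \<le> \<rho> + B * (4 * \<rho> / \<eta>) + 4 * \<rho>" using nq nd n\<eta> by simp
    finally show "norm p2 \<le> (5 + 4 * B / \<eta>) * \<rho>" by (simp add: algebra_simps)
  qed
  have sm: "norm \<xi> + \<delta> * norm p1 < min \<tau> r" "norm \<zeta> + \<delta> * norm p2 < min \<tau> r"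
  proof -
    have "norm \<xi> + \<delta> * norm p1 \<le> 2 * \<rho> / \<eta> + \<delta> * ((5 + 4 * B / \<eta>) * \<rho>)"
      using n\<xi> np \<delta> by (intro add_mono mult_left_mono) auto
    also have "\<dots> = (2 / \<eta> + \<delta> * (5 + 4 * B / \<eta>)) * \<rho>" by (simp add: algebra_simps)
    also have "\<dots> \<le> c * \<rho>" using c \<rho> by (intro mult_right_mono) auto
    finally show "norm \<xi> + \<delta> * norm p1 < min \<tau> r" using c\<rho> by simp
    have "norm \<zeta> + \<delta> * norm p2 \<le> 2 * \<rho> / \<eta> + \<delta> * ((5 + 4 * B / \<eta>) * \<rho>)"
      using n\<xi> np \<delta> by (intro add_mono mult_left_mono) auto
    also have "\<dots> = (2 / \<eta> + \<delta> * (5 + 4 * B / \<eta>)) * \<rho>" by (simp add: algebra_simps)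
    also have "\<dots> \<le> c * \<rho>" using c \<rho> by (intro mult_right_mono) auto
    finally show "norm \<zeta> + \<delta> * norm p2 < min \<tau> r" using c\<rho> by simp
  qed
  have np': "norm p1 < \<tau>" "norm p2 < \<tau>"
  proof -
    have "(5 + 4 * B / \<eta>) * \<rho> \<le> c * \<rho>" using c \<rho> by (intro mult_right_mono) auto
    then show "norm p1 < \<tau>" "norm p2 < \<tau>" using np c\<rho> by auto
  qed
  \<comment> \<open>The diagonal blocks of \<open>D\<close>, corrected by the Hessians of the
    coupling and of the square.\<close>
  define Q1 where "Q1 h = fst (D (h, 0)) + (B + 2 * \<eta>) *\<^sub>R h" for h
  define Q2 where "Q2 h = snd (D (0, h)) + (B + 2 * \<eta>) *\<^sub>R h" for h
  have blQ1: "bounded_linear Q1"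
  proof -
    have "bounded_linear (\<lambda>h::'a. (h, 0::'a))" by (intro bounded_linear_Pair bounded_linear_ident bounded_linear_zero)
    then have "bounded_linear (\<lambda>h. fst (D (h, 0)))"
      using bounded_linear_compose[OF bounded_linear_fst bounded_linear_compose[OF J(4)]] by blast
    then show ?thesis unfolding Q1_def by (intro bounded_linear_add bounded_linear_scaleR_right)
  qed
  have blQ2: "bounded_linear Q2"
  proof -
    have "bounded_linear (\<lambda>h::'a. (0::'a, h))" by (intro bounded_linear_Pair bounded_linear_ident bounded_linear_zero)
    then have "bounded_linear (\<lambda>h. snd (D (0, h)))"
      using bounded_linear_compose[OF bounded_linear_snd bounded_linear_compose[OF J(4)]] by blast
    then show ?thesis unfolding Q2_def by (intro bounded_linear_add bounded_linear_scaleR_right)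
  qed
  have exp1: "\<exists>d>0. \<forall>h. norm h < d \<longrightarrow> \<bar>a (\<xi> + h) - a \<xi> - p1 \<bullet> h - (Q1 h \<bullet> h) / 2\<bar> \<le> e * (norm h)\<^sup>2" if e: "e > 0" for e
  proof -
    obtain d where d: "d > 0" "\<And>h. norm h < d \<Longrightarrow> \<bar>W (z + h) - W z - q \<bullet> h - D h \<bullet> h / 2\<bar> \<le> e * (norm h)\<^sup>2"
      using J(5) e by blast
    have "\<bar>a (\<xi> + h) - a \<xi> - p1 \<bullet> h - (Q1 h \<bullet> h) / 2\<bar> \<le> e * (norm h)\<^sup>2" if h: "norm h < d" for h
    proof -
      have 1: "\<xi> + h - \<zeta> = (\<xi> - \<zeta>) + h" by simp
      have 2: "W (z + (h, 0)) = a (\<xi> + h) + b \<zeta> - B / 2 * ((norm (\<xi> - \<zeta>))\<^sup>2 + 2 * ((\<xi> - \<zeta>) \<bullet> h) + (norm h)\<^sup>2)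
          - \<eta> * ((norm \<xi>)\<^sup>2 + 2 * (\<xi> \<bullet> h) + (norm h)\<^sup>2 + (norm \<zeta>)\<^sup>2)"
        unfolding z add_Pair add_0_right Wp 1 norm_sq_add[of \<xi>] norm_sq_add[of "\<xi> - \<zeta>"] ..
      have 3: "q \<bullet> (h, 0) = q1 \<bullet> h" "D (h, 0) \<bullet> (h, 0) = fst (D (h, 0)) \<bullet> h" by (simp_all add: q inner_prod_def)
      have 4: "p1 \<bullet> h = q1 \<bullet> h + B * ((\<xi> - \<zeta>) \<bullet> h) + 2 * \<eta> * (\<xi> \<bullet> h)" "Q1 h \<bullet> h = fst (D (h, 0)) \<bullet> h + (B + 2 * \<eta>) * (norm h)\<^sup>2"
        by (simp_all add: p1_def Q1_def inner_add_left power2_norm_eq_inner)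
      have "a (\<xi> + h) - a \<xi> - p1 \<bullet> h - (Q1 h \<bullet> h) / 2 = W (z + (h, 0)) - W z - q \<bullet> (h, 0) - D (h, 0) \<bullet> (h, 0) / 2"
        unfolding 2 3 4 unfolding z Wp by (simp add: algebra_simps add_divide_distrib)
      then show ?thesis using d(2)[of "(h, 0)"] h by (simp add: norm_Pair)
    qed
    then show ?thesis using d(1) by blast
  qed
  have exp2: "\<exists>d>0. \<forall>h. norm h < d \<longrightarrow> \<bar>b (\<zeta> + h) - b \<zeta> - p2 \<bullet> h - (Q2 h \<bullet> h) / 2\<bar> \<le> e * (norm h)\<^sup>2" if e: "e > 0" for e
  proof -
    obtain d where d: "d > 0" "\<And>h. norm h < d \<Longrightarrow> \<bar>W (z + h) - W z - q \<bullet> h - D h \<bullet> h / 2\<bar> \<le> e * (norm h)\<^sup>2"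
      using J(5) e by blast
    have "\<bar>b (\<zeta> + h) - b \<zeta> - p2 \<bullet> h - (Q2 h \<bullet> h) / 2\<bar> \<le> e * (norm h)\<^sup>2" if h: "norm h < d" for h
    proof -
      have 1: "\<xi> - (\<zeta> + h) = (\<xi> - \<zeta>) - h" by simp
      have 2: "W (z + (0, h)) = a \<xi> + b (\<zeta> + h) - B / 2 * ((norm (\<xi> - \<zeta>))\<^sup>2 - 2 * ((\<xi> - \<zeta>) \<bullet> h) + (norm h)\<^sup>2)
          - \<eta> * ((norm \<xi>)\<^sup>2 + ((norm \<zeta>)\<^sup>2 + 2 * (\<zeta> \<bullet> h) + (norm h)\<^sup>2))"
        unfolding z add_Pair add_0_right Wp 1 norm_sq_add[of \<zeta>] norm_sq_diff[of "\<xi> - \<zeta>"] ..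
      have 3: "q \<bullet> (0, h) = q2 \<bullet> h" "D (0, h) \<bullet> (0, h) = snd (D (0, h)) \<bullet> h" by (simp_all add: q inner_prod_def)
      have 4: "p2 \<bullet> h = q2 \<bullet> h - B * ((\<xi> - \<zeta>) \<bullet> h) + 2 * \<eta> * (\<zeta> \<bullet> h)" "Q2 h \<bullet> h = snd (D (0, h)) \<bullet> h + (B + 2 * \<eta>) * (norm h)\<^sup>2"
        by (simp_all add: p2_def Q2_def inner_add_left inner_diff_left power2_norm_eq_inner)
      have "b (\<zeta> + h) - b \<zeta> - p2 \<bullet> h - (Q2 h \<bullet> h) / 2 = W (z + (0, h)) - W z - q \<bullet> (0, h) - D (0, h) \<bullet> (0, h) / 2"
        unfolding 2 3 4 unfolding z Wp by (simp add: algebra_simps add_divide_distrib)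
      then show ?thesis using d(2)[of "(0, h)"] h by (simp add: norm_Pair)
    qed
    then show ?thesis using d(1) by blast
  qed
  have Qbound: "\<exists>c. \<forall>h. Q h \<bullet> h \<le> c * (norm h)\<^sup>2" if "bounded_linear Q" for Q :: "'a \<Rightarrow> 'a"
  proof -
    have "Q h \<bullet> h \<le> onorm Q * (norm h)\<^sup>2" for h
    proof -
      have "Q h \<bullet> h \<le> norm (Q h) * norm h" by (rule norm_cauchy_schwarz)
      also have "\<dots> \<le> (onorm Q * norm h) * norm h" using onorm[OF that] by (intro mult_right_mono) auto
      finally show ?thesis by (simp add: power2_eq_square mult_ac)
    qed
    then show ?thesis by blast
  qed
  obtain c1 where c1: "\<And>h. Q1 h \<bullet> h \<le> c1 * (norm h)\<^sup>2" using Qbound[OF blQ1] by blast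
  obtain c2 where c2: "\<And>h. Q2 h \<bullet> h \<le> c2 * (norm h)\<^sup>2" using Qbound[OF blQ2] by blast
  obtain x where x: "norm (x - \<xi>) = \<delta> * norm p1"
    "\<And>e. e > 0 \<Longrightarrow> \<forall>\<^sub>F h in nhds 0. U (x + h) \<le> U x + p1 \<bullet> h + (Q1 h \<bullet> h) / 2 + e * (norm h)\<^sup>2"
  proof (rule sup_conv_upper_expansion[OF U r \<delta>, of \<xi> p1 "\<lambda>h. Q1 h \<bullet> h" c1])
  qed (use exp1 c1 sm(1) in \<open>auto simp: a_def\<close>)
  obtain y where y: "norm (y - \<zeta>) = \<delta> * norm p2"
    "\<And>e. e > 0 \<Longrightarrow> \<forall>\<^sub>F h in nhds 0. V (y + h) \<le> V y + p2 \<bullet> h + (Q2 h \<bullet> h) / 2 + e * (norm h)\<^sup>2"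
  proof (rule sup_conv_upper_expansion[OF V r \<delta>, of \<zeta> p2 "\<lambda>h. Q2 h \<bullet> h" c2])
  qed (use exp2 c2 sm(2) in \<open>auto simp: b_def\<close>)
  \<comment> \<open>Maximality of \<open>z\<close> is tested at
    \<open>z + t *\<^sub>R (v, w)\<close>. The definitions of \<open>p1\<close> and
    \<open>p2\<close> cancel all terms linear in \<open>t\<close>, and division by the square of
    \<open>t\<close> leaves the joint inequality.\<close>
  have ineq: "Q1 v \<bullet> v + Q2 w \<bullet> w \<le> B * (norm (v - w))\<^sup>2 + \<tau> * ((norm v)\<^sup>2 + (norm w)\<^sup>2)" for v w
  proof -
    obtain d1 where d1: "d1 > 0" "\<And>h. norm h < d1 \<Longrightarrow> \<bar>a (\<xi> + h) - a \<xi> - p1 \<bullet> h - (Q1 h \<bullet> h) / 2\<bar> \<le> \<eta> * (norm h)\<^sup>2"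
      using exp1[OF \<eta>] by blast
    obtain d2 where d2: "d2 > 0" "\<And>h. norm h < d2 \<Longrightarrow> \<bar>b (\<zeta> + h) - b \<zeta> - p2 \<bullet> h - (Q2 h \<bullet> h) / 2\<bar> \<le> \<eta> * (norm h)\<^sup>2"
      using exp2[OF \<eta>] by blast
    define t where "t = min d1 d2 / (norm v + norm w + 1)"
    have pos: "norm v + norm w + 1 > 0" by (simp add: add_nonneg_pos)
    have t: "t > 0" using d1 d2 pos by (simp add: t_def)
    have tm: "t * (norm v + norm w + 1) = min d1 d2" using pos by (simp add: t_def)
    have tv: "norm (t *\<^sub>R v) < d1" "norm (t *\<^sub>R w) < d2"
    proof -
      have "t * norm v < t * (norm v + norm w + 1)" using t by (intro mult_strict_left_mono) (auto simp: add_nonneg_pos)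
      then show "norm (t *\<^sub>R v) < d1" using t tm by simp
      have "t * norm w < t * (norm v + norm w + 1)" using t by (intro mult_strict_left_mono) (auto simp: add_nonneg_pos)
      then show "norm (t *\<^sub>R w) < d2" using t tm by simp
    qed
    interpret Q1: bounded_linear Q1 by (rule blQ1)
    interpret Q2: bounded_linear Q2 by (rule blQ2)
    have 1: "a \<xi> + t * (p1 \<bullet> v) + t\<^sup>2 * (Q1 v \<bullet> v) / 2 - \<eta> * (t\<^sup>2 * (norm v)\<^sup>2) \<le> a (\<xi> + t *\<^sub>R v)"
      using d1(2)[OF tv(1)] by (simp add: Q1.scaleR abs_le_iff power_mult_distrib power2_eq_square[of t] mult.assoc)
    have 2: "b \<zeta> + t * (p2 \<bullet> w) + t\<^sup>2 * (Q2 w \<bullet> w) / 2 - \<eta> * (t\<^sup>2 * (norm w)\<^sup>2) \<le> b (\<zeta> + t *\<^sub>R w)"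
      using d2(2)[OF tv(2)] by (simp add: Q2.scaleR abs_le_iff power_mult_distrib power2_eq_square[of t] mult.assoc)
    have e: "\<xi> + t *\<^sub>R v - (\<zeta> + t *\<^sub>R w) = (\<xi> - \<zeta>) + t *\<^sub>R (v - w)" by (simp add: algebra_simps)
    have 3: "W (z + t *\<^sub>R (v, w)) = a (\<xi> + t *\<^sub>R v) + b (\<zeta> + t *\<^sub>R w)
       - B / 2 * ((norm (\<xi> - \<zeta>))\<^sup>2 + 2 * (t * ((\<xi> - \<zeta>) \<bullet> (v - w))) + t\<^sup>2 * (norm (v - w))\<^sup>2)
       - \<eta> * ((norm \<xi>)\<^sup>2 + 2 * (t * (\<xi> \<bullet> v)) + t\<^sup>2 * (norm v)\<^sup>2 + ((norm \<zeta>)\<^sup>2 + 2 * (t * (\<zeta> \<bullet> w)) + t\<^sup>2 * (norm w)\<^sup>2))"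
      unfolding W_def nz z by (simp only: add_Pair scaleR_Pair fst_conv snd_conv e norm_sq_add inner_scaleR_right norm_scaleR power_mult_distrib power2_abs)
    have 4: "W z = a \<xi> + b \<zeta> - B / 2 * (norm (\<xi> - \<zeta>))\<^sup>2 - \<eta> * ((norm \<xi>)\<^sup>2 + (norm \<zeta>)\<^sup>2)"
      unfolding W_def nz z by simp
    have 5: "W (z + t *\<^sub>R (v, w)) \<le> W z + t * (q1 \<bullet> v) + t * (q2 \<bullet> w)"
      using J(3)[of "z + t *\<^sub>R (v, w)"] by (simp add: q distrib_left)
    have 6: "t * (p1 \<bullet> v) + t * (p2 \<bullet> w) = t * (q1 \<bullet> v) + t * (q2 \<bullet> w) + B * (t * ((\<xi> - \<zeta>) \<bullet> (v - w))) + 2 * (\<eta> * (t * (\<xi> \<bullet> v))) + 2 * (\<eta> * (t * (\<zeta> \<bullet> w)))"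
      unfolding p1_def p2_def by (simp add: inner_add_left inner_diff_left inner_diff_right algebra_simps)
    have "t\<^sup>2 * (Q1 v \<bullet> v) / 2 + t\<^sup>2 * (Q2 w \<bullet> w) / 2 \<le> B / 2 * (t\<^sup>2 * (norm (v - w))\<^sup>2) + 2 * (\<eta> * (t\<^sup>2 * (norm v)\<^sup>2)) + 2 * (\<eta> * (t\<^sup>2 * (norm w)\<^sup>2))"
      using 1 2 5 6 unfolding 3 4 distrib_left by linarith
    then have "t\<^sup>2 * (Q1 v \<bullet> v + Q2 w \<bullet> w) \<le> t\<^sup>2 * (B * (norm (v - w))\<^sup>2 + \<tau> * ((norm v)\<^sup>2 + (norm w)\<^sup>2))"
      by (simp add: \<eta>_def algebra_simps)
    then show ?thesis using t by simp
  qed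
  have "norm x \<le> norm (x - \<xi>) + norm \<xi>" "norm y \<le> norm (y - \<zeta>) + norm \<zeta>"
    using norm_triangle_ineq[of "x - \<xi>" \<xi>] norm_triangle_ineq[of "y - \<zeta>" \<zeta>] by simp_all
  then have "norm x < \<tau>" "norm y < \<tau>" using sm unfolding x(1) y(1) by linarith+
  then show ?thesis using np' blQ1 blQ2 x(2) y(2) ineq
    by (intro exI[of _ x] exI[of _ y] exI[of _ p1] exI[of _ p2] exI[of _ Q1] exI[of _ Q2]) simp
qed

text \<open>The second order superjet of viscosity theory; the remainder of smaller order than the
  squared norm is spelled out as an eventual bound for every \<open>e\<close>.\<close>

definition upper_jet :: "(real^'n \<Rightarrow> real) \<Rightarrow> real^'n \<Rightarrow> real^'n \<Rightarrow> real^'n^'n \<Rightarrow> bool" where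
  "upper_jet u x p X \<longleftrightarrow> transpose X = X \<and>
     (\<forall>e>0. \<forall>\<^sub>F h in nhds 0. u (x + h) \<le> u x + p \<bullet> h + (h \<bullet> (X *v h)) / 2 + e * (norm h)\<^sup>2)"

lemma symmetric_matrix_of_quadratic:
  fixes Q :: "real^'n \<Rightarrow> real^'n"
  assumes "bounded_linear Q"
  shows "\<exists>X :: real^'n^'n. transpose X = X \<and> (\<forall>h. h \<bullet> (X *v h) = Q h \<bullet> h)"
proof -
  define M where "M = matrix Q"
  have M: "M *v h = Q h" for h unfolding M_def using assms by (simp add: matrix_works bounded_linear.linear)
  let ?X = "(1/2) *\<^sub>R (M + transpose M)"
  have "transpose ?X = ?X" by (simp add: vec_eq_iff transpose_def)
  moreover have "h \<bullet> (?X *v h) = Q h \<bullet> h" for h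
  proof -
    have "h \<bullet> (transpose M *v h) = (M *v h) \<bullet> h"
      by (metis dot_lmul_matrix transpose_matrix_vector inner_commute)
    then show ?thesis
      by (simp add: scaleR_matrix_vector_assoc[symmetric] matrix_vector_mult_add_rdistrib inner_add_right M inner_commute)
  qed
  ultimately show ?thesis by blast
qed

text \<open>The normalisation puts both contact points at the origin with value 0 and slope 0; a
  general contact is brought to this form by subtracting tangents. The jets are those of
  \<open>theorem_on_sums_maps\<close> with the quadratic forms symmetrised.\<close>

theorem theorem_on_sums:
  fixes U V :: "real^'n \<Rightarrow> real"
  assumes "continuous_on (cball 0 r) U" "continuous_on (cball 0 r) V" "r > 0" "U 0 = 0" "V 0 = 0" "B \<ge> 0"
    "\<And>x y. x \<in> cball 0 r \<Longrightarrow> y \<in> cball 0 r \<Longrightarrow> U x + V y \<le> B / 2 * (norm (x - y))\<^sup>2"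
    and "\<tau> > 0"
  shows "\<exists>x y p1 p2 X Y. norm x < \<tau> \<and> norm y < \<tau> \<and> norm p1 < \<tau> \<and> norm p2 < \<tau> \<and> upper_jet U x p1 X \<and> upper_jet V y p2 Y \<and>
    (\<forall>v w. v \<bullet> (X *v v) + w \<bullet> (Y *v w) \<le> B * (norm (v - w))\<^sup>2 + \<tau> * ((norm v)\<^sup>2 + (norm w)\<^sup>2))"
proof -
  obtain x y p1 p2 Q1 Q2 where *: 
    "norm x < \<tau>" "norm y < \<tau>" "norm p1 < \<tau>" "norm p2 < \<tau>" "bounded_linear Q1" "bounded_linear Q2"
    "\<And>e. e > 0 \<Longrightarrow> \<forall>\<^sub>F h in nhds 0. U (x + h) \<le> U x + p1 \<bullet> h + (Q1 h \<bullet> h) / 2 + e * (norm h)\<^sup>2"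
    "\<And>e. e > 0 \<Longrightarrow> \<forall>\<^sub>F h in nhds 0. V (y + h) \<le> V y + p2 \<bullet> h + (Q2 h \<bullet> h) / 2 + e * (norm h)\<^sup>2"
    "\<And>v w. Q1 v \<bullet> v + Q2 w \<bullet> w \<le> B * (norm (v - w))\<^sup>2 + \<tau> * ((norm v)\<^sup>2 + (norm w)\<^sup>2)"
    using theorem_on_sums_maps[OF assms] by blast
  obtain X where X: "transpose X = X" "\<And>h. h \<bullet> (X *v h) = Q1 h \<bullet> h" using symmetric_matrix_of_quadratic[OF *(5)] by blast
  obtain Y where Y: "transpose Y = Y" "\<And>h. h \<bullet> (Y *v h) = Q2 h \<bullet> h" using symmetric_matrix_of_quadratic[OF *(6)] by blast
  have "upper_jet U x p1 X" unfolding upper_jet_def X(2) using X(1) *(7) by blast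
  moreover have "upper_jet V y p2 Y" unfolding upper_jet_def Y(2) using Y(1) *(8) by blast
  moreover have "\<forall>v w. v \<bullet> (X *v v) + w \<bullet> (Y *v w) \<le> B * (norm (v - w))\<^sup>2 + \<tau> * ((norm v)\<^sup>2 + (norm w)\<^sup>2)"
    unfolding X(2) Y(2) using *(9) by blast
  ultimately show ?thesis using *(1-4) by blast
qed

section \<open>Square roots of nonnegative matrices\<close>

lemma symmetric_matrix_inner:
  fixes D :: "real^'n^'n"
  assumes "transpose D = D"
  shows "x \<bullet> (D *v y) = (D *v x) \<bullet> y"
proof -
  have "x \<bullet> (D *v y) = (transpose D *v x) \<bullet> y"
    by (simp only: transpose_matrix_vector dot_lmul_matrix)
  then show ?thesis using assms by simp
qed

text \<open>A maximiser of the quadratic form on the unit sphere of \<open>S\<close> is an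
  eigenvector: otherwise moving it along the residual \<open>D *v v - \<mu> *\<^sub>R v\<close>,
  which stays in \<open>S\<close>, would increase the Rayleigh quotient to first order.\<close>

lemma rayleigh_on_subspace:
  fixes D :: "real^'n^'n"
  assumes sym: "transpose D = D" and S: "subspace S" "S \<noteq> {0}" and inv: "\<And>x. x \<in> S \<Longrightarrow> D *v x \<in> S"
  shows "\<exists>v\<in>S. \<exists>\<mu>. norm v = 1 \<and> D *v v = \<mu> *\<^sub>R v \<and> (\<forall>w\<in>S. w \<bullet> (D *v w) \<le> \<mu> * (norm w)\<^sup>2)"
proof -
  let ?K = "S \<inter> sphere 0 1"
  have Dsym: "x \<bullet> (D *v y) = (D *v x) \<bullet> y" for x y
    by (rule symmetric_matrix_inner[OF sym])
  obtain x0 where x0: "x0 \<in> S" "x0 \<noteq> 0" using S subspace_0 by blast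
  then have "x0 /\<^sub>R norm x0 \<in> ?K" using S(1) by (simp add: subspace_scale)
  then have ne: "?K \<noteq> {}" by blast
  have comp: "compact ?K" using S(1) closed_Int_compact closed_subspace compact_sphere by blast
  have lin: "bounded_linear ((*v) D)" by (rule matrix_vector_mul_bounded_linear)
  have "continuous_on ?K (\<lambda>w. w \<bullet> (D *v w))"
    by (intro continuous_intros linear_continuous_on lin)
  then obtain v where v: "v \<in> ?K" "\<And>w. w \<in> ?K \<Longrightarrow> w \<bullet> (D *v w) \<le> v \<bullet> (D *v v)"
    using continuous_attains_sup[OF comp ne] by blast
  define \<mu> where "\<mu> = v \<bullet> (D *v v)"
  have nv: "norm v = 1" "v \<in> S" using v by auto
  have bound: "w \<bullet> (D *v w) \<le> \<mu> * (norm w)\<^sup>2" if "w \<in> S" for w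
  proof (cases "w = 0")
    case False
    have "w /\<^sub>R norm w \<in> ?K" using that S(1) False by (simp add: subspace_scale)
    then have "(w /\<^sub>R norm w) \<bullet> (D *v (w /\<^sub>R norm w)) \<le> \<mu>" using v(2) \<mu>_def by blast
    then show ?thesis using False
      by (simp add: matrix_vector_mult_scaleR field_simps power2_eq_square)
  qed simp
  define w where "w = D *v v - \<mu> *\<^sub>R v"
  have wS: "w \<in> S" unfolding w_def using nv inv S(1) by (simp add: subspace_diff subspace_scale)
  define c where "c = \<bar>\<mu> * (norm w)\<^sup>2 - w \<bullet> (D *v w)\<bar>"
  have key: "2 * t * (norm w)\<^sup>2 \<le> t\<^sup>2 * c" for t
  proof -
    have "v + t *\<^sub>R w \<in> S" using nv wS S(1) by (simp add: subspace_add subspace_scale)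
    then have "(v + t *\<^sub>R w) \<bullet> (D *v (v + t *\<^sub>R w)) \<le> \<mu> * (norm (v + t *\<^sub>R w))\<^sup>2" by (rule bound)
    moreover have "(v + t *\<^sub>R w) \<bullet> (D *v (v + t *\<^sub>R w)) = \<mu> + 2 * t * (w \<bullet> (D *v v)) + t\<^sup>2 * (w \<bullet> (D *v w))"
      using Dsym[of v w] by (simp add: \<mu>_def matrix_vector_right_distrib matrix_vector_mult_scaleR inner_add_left inner_add_right inner_commute algebra_simps power2_eq_square)
    moreover have "(norm (v + t *\<^sub>R w))\<^sup>2 = 1 + 2 * t * (w \<bullet> v) + t\<^sup>2 * (norm w)\<^sup>2"
      using nv(1) unfolding power2_norm_eq_inner by (simp add: inner_add_left inner_add_right inner_commute algebra_simps power2_eq_square norm_eq_1)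
    moreover have "w \<bullet> (D *v v) - \<mu> * (w \<bullet> v) = (norm w)\<^sup>2"
      by (simp add: w_def power2_norm_eq_inner inner_diff_right)
    ultimately have "2 * t * (norm w)\<^sup>2 \<le> t\<^sup>2 * (\<mu> * (norm w)\<^sup>2 - w \<bullet> (D *v w))"
      by (simp add: algebra_simps)
    also have "\<dots> \<le> t\<^sup>2 * c" unfolding c_def by (intro mult_left_mono) auto
    finally show ?thesis .
  qed
  have "norm w = 0"
  proof (rule ccontr)
    assume nw: "norm w \<noteq> 0"
    define n where "n = (norm w)\<^sup>2"
    have n: "n > 0" using nw by (simp add: n_def)
    have "c \<ge> 0" by (simp add: c_def)
    \<comment> \<open>The value \<open>t = n / (c + 1)\<close> is so small that the quadratic term
      is at most half of the linear one, which contradicts \<open>key\<close>.\<close>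
    have "2 * (n / (c + 1)) * n \<le> (n / (c + 1))\<^sup>2 * c" using key n_def by blast
    also have "\<dots> \<le> (n / (c + 1))\<^sup>2 * (c + 1)" by (intro mult_left_mono) auto
    also have "\<dots> = (n / (c + 1)) * n" using \<open>c \<ge> 0\<close> by (simp add: power2_eq_square)
    finally have "(n / (c + 1)) * n \<le> 0" by simp
    moreover have "(n / (c + 1)) * n > 0" using n \<open>c \<ge> 0\<close> by simp
    ultimately show False by simp
  qed
  then have "D *v v = \<mu> *\<^sub>R v" by (simp add: w_def)
  then show ?thesis using nv bound by blast
qed

text \<open>Induction on the dimension: symmetry makes the orthogonal complement of an eigenvector
  in \<open>S\<close> invariant, and it has smaller dimension because it misses that
  eigenvector.\<close>

lemma orthonormal_eigenbasis_of_subspace: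
  fixes D :: "real^'n^'n"
  assumes sym: "transpose D = D"
  shows "subspace S \<Longrightarrow> (\<And>x. x \<in> S \<Longrightarrow> D *v x \<in> S) \<Longrightarrow>
    \<exists>E \<mu>. finite E \<and> E \<subseteq> S \<and> S \<subseteq> span E \<and> (\<forall>e\<in>E. norm e = 1 \<and> D *v e = \<mu> e *\<^sub>R e) \<and> (\<forall>e\<in>E. \<forall>f\<in>E. e \<noteq> f \<longrightarrow> e \<bullet> f = 0)"
proof (induction "dim S" arbitrary: S rule: less_induct)
  case less
  have Dsym: "x \<bullet> (D *v y) = (D *v x) \<bullet> y" for x y
    by (rule symmetric_matrix_inner[OF sym])
  show ?case
  proof (cases "S = {0}")
    case True
    then show ?thesis by (intro exI[of _ "{}"]) simp
  next
    case False
    obtain v \<mu>0 where v: "v \<in> S" "norm v = 1" "D *v v = \<mu>0 *\<^sub>R v"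
      using rayleigh_on_subspace[OF sym less.prems(1) False less.prems(2)] by blast
    define S' where "S' = S \<inter> {x. v \<bullet> x = 0}"
    have S': "subspace S'" unfolding S'_def using less.prems(1) subspace_hyperplane by (rule subspace_inter)
    have inv: "D *v x \<in> S'" if "x \<in> S'" for x
      using that less.prems(2) Dsym[of v x] v(3) by (simp add: S'_def)
    have "v \<notin> S'" using v by (simp add: S'_def norm_eq_1)
    moreover have "S' \<subseteq> S" by (simp add: S'_def)
    ultimately have "S' \<subset> S" using v(1) by blast
    moreover have sp: "span S' = S'" "span S = S" using S' less.prems(1) by (simp_all add: span_eq_iff)
    ultimately have "dim S' < dim S" using dim_psubset[of S' S, unfolded sp] by blast
    then obtain E \<mu> where E: "finite E" "E \<subseteq> S'" "S' \<subseteq> span E" "\<And>e. e \<in> E \<Longrightarrow> norm e = 1 \<and> D *v e = \<mu> e *\<^sub>R e"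
       "\<And>e f. e \<in> E \<Longrightarrow> f \<in> E \<Longrightarrow> e \<noteq> f \<Longrightarrow> e \<bullet> f = 0"
      using less.hyps[of S'] S' inv by blast
    have vE: "v \<bullet> e = 0" if "e \<in> E" for e using that E(2) by (auto simp: S'_def)
    have "S \<subseteq> span (insert v E)"
    proof
      fix x assume x: "x \<in> S"
      have "x - (v \<bullet> x) *\<^sub>R v \<in> S'"
        using x v less.prems(1) by (simp add: S'_def subspace_diff subspace_scale inner_diff_right norm_eq_1)
      then have "x - (v \<bullet> x) *\<^sub>R v \<in> span (insert v E)" using E(3) span_mono[of E "insert v E"] by blast
      moreover have "(v \<bullet> x) *\<^sub>R v \<in> span (insert v E)" by (simp add: span_base span_scale)
      ultimately show "x \<in> span (insert v E)" by (metis diff_add_cancel span_add)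
    qed
    moreover have "insert v E \<subseteq> S" using v E(2) by (auto simp: S'_def)
    moreover have "\<forall>e\<in>insert v E. norm e = 1 \<and> D *v e = (\<mu>(v := \<mu>0)) e *\<^sub>R e" using v E(4) by auto
    moreover have "\<forall>e\<in>insert v E. \<forall>f\<in>insert v E. e \<noteq> f \<longrightarrow> e \<bullet> f = 0" using vE E(5) by (auto simp: inner_commute)
    ultimately show ?thesis using E(1) by (intro exI[of _ "insert v E"] exI[of _ "\<mu>(v := \<mu>0)"]) blast
  qed
qed

text \<open>In an orthonormal eigenbasis every eigenvalue is replaced by its square root.\<close>

lemma sym_nonneg_sqrt_exists:
  fixes A :: "real^'n^'n"
  assumes A: "A \<in> sym_nonneg"
  shows "\<exists>B. B \<in> sym_nonneg \<and> B ** B = A"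
proof -
  have sym: "transpose A = A" and pos: "\<And>v. 0 \<le> v \<bullet> (A *v v)" using A by (auto simp: sym_nonneg_def)
  obtain E \<mu> where E: "finite E" "UNIV \<subseteq> span E" "\<And>e. e \<in> E \<Longrightarrow> norm e = 1" "\<And>e. e \<in> E \<Longrightarrow> A *v e = \<mu> e *\<^sub>R e"
    "\<And>e f. e \<in> E \<Longrightarrow> f \<in> E \<Longrightarrow> e \<noteq> f \<Longrightarrow> e \<bullet> f = 0"
    using orthonormal_eigenbasis_of_subspace[OF sym subspace_UNIV UNIV_I] by blast
  have \<mu>: "\<mu> e \<ge> 0" if "e \<in> E" for e using pos[of e] E(3,4)[OF that] by (simp add: norm_eq_1)
  define b where "b x = (\<Sum>e\<in>E. (sqrt (\<mu> e) * (e \<bullet> x)) *\<^sub>R e)" for x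
  have linb: "linear b"
    by (rule linearI) (simp_all add: b_def inner_add_right distrib_left scaleR_add_left sum.distrib scaleR_sum_right mult_ac)
  define B where "B = matrix b"
  have B: "B *v x = b x" for x unfolding B_def using linb by (simp add: matrix_works)
  have be: "b e = sqrt (\<mu> e) *\<^sub>R e" if "e \<in> E" for e
  proof -
    have "b e = (\<Sum>f\<in>E. if f = e then sqrt (\<mu> e) *\<^sub>R e else 0)"
      unfolding b_def using that E(3,5) by (intro sum.cong) (auto simp: norm_eq_1)
    then show ?thesis using that E(1) by simp
  qed
  have symB: "x \<bullet> b y = b x \<bullet> y" for x y
    unfolding b_def inner_sum_left inner_sum_right by (intro sum.cong) (auto simp: inner_commute)
  have "transpose B = B"
  proof -
    have "transpose B *v y = B *v y" for y
    proof -
      have "x \<bullet> (transpose B *v y) = x \<bullet> (B *v y)" for x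
        using symB[of x y] dot_lmul_matrix[of y B x] by (simp add: B transpose_matrix_vector inner_commute)
      then show ?thesis by (metis inner_commute vector_eq_ldot)
    qed
    then show ?thesis by (metis matrix_eq)
  qed
  moreover have "0 \<le> x \<bullet> (B *v x)" for x
    unfolding B b_def inner_sum_right by (intro sum_nonneg) (use \<mu> in \<open>simp add: inner_commute mult.assoc\<close>)
  moreover have "B ** B = A"
  proof -
    have lin2: "linear (\<lambda>x. b (b x))" using linear_compose[OF linb linb] by (simp add: o_def)
    have "b (b x) = A *v x" for x
    proof (rule linear_eq_on_span[OF lin2 matrix_vector_mul_linear, of E])
      show "b (b e) = A *v e" if "e \<in> E" for e
        using be[OF that] E(4)[OF that] \<mu>[OF that] linear_scale[OF linb] by simp
      show "x \<in> span E" using E(2) by blast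
    qed
    then show ?thesis by (metis B matrix_eq matrix_vector_mul_assoc)
  qed
  ultimately show ?thesis by (auto simp: sym_nonneg_def)
qed

text \<open>If \<open>v\<close> is a unit eigenvector of \<open>B - C\<close> for \<open>\<mu>\<close>, then \<open>v \<bullet> (B\<^sup>2 - C\<^sup>2) v = \<mu> (v \<bullet> B v + v \<bullet> C v)\<close>,
  and \<open>|\<mu>| \<le> v \<bullet> B v + v \<bullet> C v\<close>.  Uniqueness and continuity of the square root both follow.\<close>

lemma sqrt_difference_bound:
  fixes B C :: "real^'n^'n"
  assumes B: "B \<in> sym_nonneg" and C: "C \<in> sym_nonneg"
    and K: "\<And>v. \<bar>v \<bullet> ((B ** B - C ** C) *v v)\<bar> \<le> K * (norm v)\<^sup>2"
  shows "w \<bullet> ((B - C) *v w) \<le> sqrt K * (norm w)\<^sup>2"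
proof -
  have sym: "transpose (B - C) = B - C" using B C by (auto simp: sym_nonneg_def transpose_def vec_eq_iff)
  have "(UNIV :: (real^'n) set) \<noteq> {0}"
  proof
    assume *: "(UNIV :: (real^'n) set) = {0}"
    obtain b :: "real^'n" where "norm b = 1" using vector_choose_size[of 1] by auto
    then show False using * by auto
  qed
  \<comment> \<open>This is the largest eigenvalue of \<open>B - C\<close>, so that a bound on \<mu>
    controls the whole quadratic form.\<close>
  then obtain v \<mu> where v: "norm v = 1" "(B - C) *v v = \<mu> *\<^sub>R v" "\<And>w. w \<bullet> ((B - C) *v w) \<le> \<mu> * (norm w)\<^sup>2"
    using rayleigh_on_subspace[OF sym subspace_UNIV] by blast
  define s where "s = v \<bullet> (B *v v) + v \<bullet> (C *v v)"
  have pos: "0 \<le> v \<bullet> (B *v v)" "0 \<le> v \<bullet> (C *v v)" using B C by (auto simp: sym_nonneg_def)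
  have \<mu>: "\<mu> = v \<bullet> (B *v v) - v \<bullet> (C *v v)"
  proof -
    have "v \<bullet> ((B - C) *v v) = \<mu>" using v(1,2) by (simp add: norm_eq_1)
    then show ?thesis by (simp add: matrix_vector_mult_diff_rdistrib inner_diff_right)
  qed
  have Csym: "x \<bullet> (C *v y) = (C *v x) \<bullet> y" for x y
    using C by (intro symmetric_matrix_inner) (simp add: sym_nonneg_def)
  have Bsym: "x \<bullet> (B *v y) = (B *v x) \<bullet> y" for x y
    using B by (intro symmetric_matrix_inner) (simp add: sym_nonneg_def)
  have Bv: "B *v v = C *v v + \<mu> *\<^sub>R v" using v(2) by (simp add: matrix_vector_mult_diff_rdistrib algebra_simps)
  have "v \<bullet> ((B ** B - C ** C) *v v) = (B *v v) \<bullet> (B *v v) - (C *v v) \<bullet> (C *v v)"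
    by (simp add: matrix_vector_mult_diff_rdistrib inner_diff_right matrix_vector_mul_assoc[symmetric] Bsym[of v] Csym[of v])
  also have "\<dots> = \<mu> * (v \<bullet> (B *v v)) + \<mu> * (v \<bullet> (C *v v))"
    using v(1) unfolding Bv by (simp add: inner_add_left inner_add_right inner_commute norm_eq_1 algebra_simps)
  also have "\<dots> = \<mu> * s" by (simp add: s_def distrib_left)
  finally have "\<bar>\<mu> * s\<bar> \<le> K" using K[of v] v(1) by simp
  moreover have "\<bar>\<mu>\<bar> \<le> s" using pos \<mu> by (simp add: s_def abs_le_iff)
  then have "\<bar>\<mu>\<bar> * \<bar>\<mu>\<bar> \<le> \<bar>\<mu>\<bar> * s" by (rule mult_left_mono) simp
  moreover have "s \<ge> 0" using pos by (simp add: s_def)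
  ultimately have "\<mu>\<^sup>2 \<le> K" by (simp add: abs_mult power2_eq_square)
  then have "\<mu> \<le> sqrt K" by (rule real_le_rsqrt)
  then have "\<mu> * (norm w)\<^sup>2 \<le> sqrt K * (norm w)\<^sup>2" by (rule mult_right_mono) simp
  then show ?thesis using v(3)[of w] by simp
qed

text \<open>The one-sided bound applied to (B, C) and (C, B) controls the absolute value of the
  quadratic form; polarisation with sums of two coordinate vectors, of squared norm at most 4,
  passes from the form to the entries.\<close>

lemma sqrt_difference_entry_bound:
  fixes B C :: "real^'n^'n"
  assumes B: "B \<in> sym_nonneg" and C: "C \<in> sym_nonneg"
    and K: "\<And>v. \<bar>v \<bullet> ((B ** B - C ** C) *v v)\<bar> \<le> K * (norm v)\<^sup>2"
  shows "\<bar>(B - C) $ i $ j\<bar> \<le> 4 * sqrt K"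
proof -
  define D where "D = B - C"
  have sym: "transpose D = D" using B C by (auto simp: D_def sym_nonneg_def transpose_def vec_eq_iff)
  have Dsym: "x \<bullet> (D *v y) = y \<bullet> (D *v x)" for x y
    using symmetric_matrix_inner[OF sym, of x y] by (simp add: inner_commute)
  obtain b :: "real^'n" where "norm b = 1" using vector_choose_size[of 1] by auto
  then have "K \<ge> 0" using K[of b] by simp
  have quad: "\<bar>w \<bullet> (D *v w)\<bar> \<le> sqrt K * (norm w)\<^sup>2" for w
  proof -
    have "\<bar>v \<bullet> ((C ** C - B ** B) *v v)\<bar> \<le> K * (norm v)\<^sup>2" for v
      using K[of v] by (simp add: matrix_vector_mult_diff_rdistrib inner_diff_right abs_minus_commute)
    then have "w \<bullet> ((C - B) *v w) \<le> sqrt K * (norm w)\<^sup>2" by (rule sqrt_difference_bound[OF C B])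
    moreover have "w \<bullet> ((C - B) *v w) = - (w \<bullet> (D *v w))"
      by (simp add: D_def matrix_vector_mult_diff_rdistrib inner_diff_right)
    ultimately show ?thesis using sqrt_difference_bound[OF B C K, of w] unfolding D_def[symmetric] by linarith
  qed
  let ?e = "axis i (1::real)" and ?f = "axis j (1::real)"
  have n: "norm ?e = 1" "norm ?f = 1" by simp_all
  have "(norm (?e + ?f))\<^sup>2 \<le> 4"
  proof -
    have "norm (?e + ?f) \<le> 2" using norm_triangle_ineq[of ?e ?f] n by simp
    then have "(norm (?e + ?f))\<^sup>2 \<le> 2\<^sup>2" by (rule power_mono) simp
    then show ?thesis by simp
  qed
  then have "sqrt K * (norm (?e + ?f))\<^sup>2 \<le> sqrt K * 4" using \<open>K \<ge> 0\<close> by (intro mult_left_mono) auto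
  then have 1: "\<bar>(?e + ?f) \<bullet> (D *v (?e + ?f))\<bar> \<le> sqrt K * 4" using quad[of "?e + ?f"] by linarith
  have 2: "(?e + ?f) \<bullet> (D *v (?e + ?f)) = ?e \<bullet> (D *v ?e) + ?f \<bullet> (D *v ?f) + 2 * (?e \<bullet> (D *v ?f))"
    using Dsym[of ?f ?e] by (simp add: matrix_vector_right_distrib inner_add_left inner_add_right)
  have 3: "\<bar>?e \<bullet> (D *v ?e)\<bar> \<le> sqrt K" "\<bar>?f \<bullet> (D *v ?f)\<bar> \<le> sqrt K" using quad[of ?e] quad[of ?f] n by simp_all
  have "?e \<bullet> (D *v ?f) = D $ i $ j" by (simp add: inner_axis' matrix_vector_mul_component inner_axis)
  moreover have "sqrt K \<ge> 0" using \<open>K \<ge> 0\<close> by simp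
  ultimately show ?thesis using 1 2 3 unfolding D_def[symmetric] by linarith
qed

text \<open>Uniqueness is the case \<open>K = 0\<close> of the entry bound; it is what gives the
  definite description its meaning.\<close>

lemma mat_sqrt:
  fixes A :: "real^'n^'n"
  assumes "A \<in> sym_nonneg"
  shows "mat_sqrt A \<in> sym_nonneg" "mat_sqrt A ** mat_sqrt A = A"
proof -
  have uniq: "B = C" if "B \<in> sym_nonneg" "C \<in> sym_nonneg" "B ** B = A" "C ** C = A" for B C
  proof -
    have "\<bar>(B - C) $ i $ j\<bar> \<le> 4 * sqrt 0" for i j
      by (rule sqrt_difference_entry_bound[OF that(1,2)]) (simp add: that)
    then show ?thesis by (simp add: vec_eq_iff)
  qed
  obtain B where B: "B \<in> sym_nonneg" "B ** B = A" using sym_nonneg_sqrt_exists[OF assms] by blast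
  have eq: "mat_sqrt A = B" unfolding mat_sqrt_def
  proof (rule the_equality)
    show "B \<in> sym_nonneg \<and> B ** B = A" using B by simp
    show "C = B" if "C \<in> sym_nonneg \<and> C ** C = A" for C using uniq[of C B] that B by blast
  qed
  show "mat_sqrt A \<in> sym_nonneg" "mat_sqrt A ** mat_sqrt A = A" unfolding eq by (rule B)+
qed

section \<open>Frobenius norm and traces\<close>

text \<open>The norm of the type \<open>real^'n^'n\<close> is the Frobenius norm; the estimate is
  Cauchy-Schwarz in each row.\<close>

lemma norm_matrix_vector_le:
  fixes M :: "real^'n^'n"
  shows "norm (M *v v) \<le> norm M * norm v"
proof -
  have "norm (M *v v) = L2_set (\<lambda>i. norm ((M *v v) $ i)) UNIV" by (simp add: norm_vec_def)
  also have "\<dots> \<le> L2_set (\<lambda>i. norm v * norm (M $ i)) UNIV"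
  proof (rule L2_set_mono)
    show "norm ((M *v v) $ i) \<le> norm v * norm (M $ i)" for i
      using Cauchy_Schwarz_ineq2[of "M $ i" v] by (simp add: matrix_vector_mul_component mult.commute)
  qed simp
  also have "\<dots> = norm v * L2_set (\<lambda>i. norm (M $ i)) UNIV" by (simp add: L2_set_right_distrib)
  finally show ?thesis by (simp add: norm_vec_def mult.commute)
qed

lemma quadratic_form_le_norm:
  fixes M :: "real^'n^'n"
  shows "\<bar>v \<bullet> (M *v v)\<bar> \<le> norm M * (norm v)\<^sup>2"
proof -
  have "norm v * norm (M *v v) \<le> norm v * (norm M * norm v)" by (rule mult_left_mono[OF norm_matrix_vector_le]) simp
  then show ?thesis using Cauchy_Schwarz_ineq2[of v "M *v v"] by (simp add: power2_eq_square mult_ac)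
qed

text \<open>The entry bound with \<open>K = norm (A y - A x)\<close> shows that the square root is
  Hoelder continuous of exponent 1/2.\<close>

lemma continuous_on_mat_sqrt:
  fixes A :: "'a::topological_space \<Rightarrow> real^'n^'n"
  assumes cont: "continuous_on S A" and A: "\<And>x. x \<in> S \<Longrightarrow> A x \<in> sym_nonneg"
  shows "continuous_on S (\<lambda>x. mat_sqrt (A x))"
  unfolding continuous_on_def
proof (intro ballI vec_tendstoI)
  fix x i j assume x: "x \<in> S"
  have bnd: "\<bar>(mat_sqrt (A y) - mat_sqrt (A x)) $ i $ j\<bar> \<le> 4 * sqrt (norm (A y - A x))" if "y \<in> S" for y
    by (rule sqrt_difference_entry_bound) (use mat_sqrt[OF A] that x quadratic_form_le_norm[of _ "A y - A x"] in auto)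
  have "((\<lambda>y. 4 * sqrt (norm (A y - A x))) \<longlongrightarrow> 4 * sqrt (norm (A x - A x))) (at x within S)"
    using cont x by (intro tendsto_intros) (auto simp: continuous_on_def)
  then have lim: "((\<lambda>y. 4 * sqrt (norm (A y - A x))) \<longlongrightarrow> 0) (at x within S)" by simp
  have "((\<lambda>y. mat_sqrt (A y) $ i $ j - mat_sqrt (A x) $ i $ j) \<longlongrightarrow> 0) (at x within S)"
  proof (rule Lim_null_comparison[OF _ lim])
    show "\<forall>\<^sub>F y in at x within S. norm (mat_sqrt (A y) $ i $ j - mat_sqrt (A x) $ i $ j) \<le> 4 * sqrt (norm (A y - A x))"
      unfolding eventually_at_filter using bnd by (intro always_eventually allI impI) auto
  qed
  then show "((\<lambda>y. mat_sqrt (A y) $ i $ j) \<longlongrightarrow> mat_sqrt (A x) $ i $ j) (at x within S)" by (rule Lim_null[THEN iffD2])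
qed

text \<open>Writing the trace as a sum of values of the quadratic form of \<open>X\<close> at the
  rows of \<sigma> makes it accessible to the inequality of the theorem on sums.\<close>

lemma trace_square_mult:
  fixes \<sigma> X :: "real^'n^'n"
  assumes "transpose \<sigma> = \<sigma>"
  shows "trace (\<sigma> ** \<sigma> ** X) = (\<Sum>l\<in>UNIV. \<sigma> $ l \<bullet> (X *v \<sigma> $ l))"
proof -
  have s: "\<sigma> $ i $ l = \<sigma> $ l $ i" for i l
  proof -
    have "\<sigma> $ i $ l = transpose \<sigma> $ l $ i" by (simp add: transpose_def)
    then show ?thesis by (simp only: assms)
  qed
  have "trace (\<sigma> ** \<sigma> ** X) = trace (\<sigma> ** (X ** \<sigma>))"
    by (metis matrix_mul_assoc trace_mul_sym)
  also have "\<dots> = (\<Sum>l\<in>UNIV. \<sigma> $ l \<bullet> (X *v \<sigma> $ l))"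
    unfolding trace_def
  proof (rule sum.cong)
    fix l :: 'n
    have "(\<sigma> ** (X ** \<sigma>)) $ l $ l = (\<Sum>j\<in>UNIV. \<sigma> $ l $ j * (\<Sum>i\<in>UNIV. X $ j $ i * \<sigma> $ l $ i))"
      by (simp add: matrix_matrix_mult_def s[of _ l])
    also have "\<dots> = \<sigma> $ l \<bullet> (X *v \<sigma> $ l)"
      by (simp add: inner_vec_def matrix_vector_mult_def)
    finally show "(\<sigma> ** (X ** \<sigma>)) $ l $ l = \<sigma> $ l \<bullet> (X *v \<sigma> $ l)" .
  qed simp
  finally show ?thesis .
qed

lemma norm_matrix_sq: "(norm (M :: real^'n^'m))\<^sup>2 = (\<Sum>l\<in>UNIV. (norm (M $ l))\<^sup>2)"
  by (simp add: norm_vec_def L2_set_def sum_nonneg)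

text \<open>The joint inequality is applied to the corresponding rows of the two square roots. The
  squared row differences add up to the squared distance of the square roots, which is why (C1) is a
  condition on square roots.\<close>

lemma trace_sum_le:
  fixes A A' X Y :: "real^'n^'n"
  assumes "A \<in> sym_nonneg" "A' \<in> sym_nonneg"
    and XY: "\<And>v w. v \<bullet> (X *v v) + w \<bullet> (Y *v w) \<le> B * (norm (v - w))\<^sup>2 + \<tau> * ((norm v)\<^sup>2 + (norm w)\<^sup>2)"
  shows "trace (A ** X) + trace (A' ** Y) \<le> B * (norm (mat_sqrt A - mat_sqrt A'))\<^sup>2 + \<tau> * ((norm (mat_sqrt A))\<^sup>2 + (norm (mat_sqrt A'))\<^sup>2)"
proof -
  define \<sigma> \<sigma>' where "\<sigma> = mat_sqrt A" "\<sigma>' = mat_sqrt A'"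
  note s = mat_sqrt[OF assms(1)] mat_sqrt[OF assms(2)]
  have "trace (A ** X) + trace (A' ** Y) = (\<Sum>l\<in>UNIV. \<sigma> $ l \<bullet> (X *v \<sigma> $ l) + \<sigma>' $ l \<bullet> (Y *v \<sigma>' $ l))"
    using trace_square_mult[of \<sigma> X] trace_square_mult[of \<sigma>' Y] s unfolding \<sigma>_\<sigma>'_def sym_nonneg_def by (simp add: sum.distrib)
  also have "\<dots> \<le> (\<Sum>l\<in>UNIV. B * (norm (\<sigma> $ l - \<sigma>' $ l))\<^sup>2 + \<tau> * ((norm (\<sigma> $ l))\<^sup>2 + (norm (\<sigma>' $ l))\<^sup>2))"
    by (intro sum_mono XY)
  also have "\<dots> = B * (norm (\<sigma> - \<sigma>'))\<^sup>2 + \<tau> * ((norm \<sigma>)\<^sup>2 + (norm \<sigma>')\<^sup>2)"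
    unfolding norm_matrix_sq by (simp add: sum.distrib distrib_left sum_distrib_left)
  finally show ?thesis by (simp add: \<sigma>_\<sigma>'_def)
qed

text \<open>Transfers (C1) from the given norm to the Frobenius norm: \<open>N\<close> is Lipschitz,
  hence has a positive minimum on the compact unit sphere.\<close>

lemma is_norm_dominates_norm:
  fixes N :: "real^'n^'n \<Rightarrow> real"
  assumes N: "is_norm N"
  shows "\<exists>c>0. \<forall>M. norm M \<le> c * N M"
proof -
  have N0: "0 \<le> N M" "N M = 0 \<longleftrightarrow> M = 0" "N (c *\<^sub>R M) = \<bar>c\<bar> * N M" "N (M + M') \<le> N M + N M'" for M M' c
    using N by (auto simp: is_norm_def)
  define C where "C = (\<Sum>b\<in>Basis. N b)"
  have sumN: "N (sum f F) \<le> (\<Sum>b\<in>F. N (f b))" if "finite F" for f :: "real^'n^'n \<Rightarrow> real^'n^'n" and F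
    using that
  proof (induction F)
    case empty then show ?case using N0(2)[of 0] by simp
  next
    case (insert b F) then show ?case using N0(4)[of "f b" "sum f F"] by simp
  qed
  have up: "N M \<le> C * norm M" for M
  proof -
    have "N M = N (\<Sum>b\<in>Basis. (M \<bullet> b) *\<^sub>R b)" by (simp add: euclidean_representation)
    also have "\<dots> \<le> (\<Sum>b\<in>Basis. N ((M \<bullet> b) *\<^sub>R b))" by (rule sumN) simp
    also have "\<dots> \<le> (\<Sum>b\<in>Basis. norm M * N b)"
      unfolding N0(3) by (intro sum_mono mult_right_mono Basis_le_norm N0(1))
    finally show ?thesis by (simp add: C_def sum_distrib_left mult.commute)
  qed
  have "C \<ge> 0" by (simp add: C_def sum_nonneg N0(1))
  have "C-lipschitz_on UNIV N"
  proof (rule lipschitz_onI)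
    fix M M'
    have "N M \<le> N M' + N (M - M')" "N M' \<le> N M + N (M' - M)" using N0(4)[of M' "M - M'"] N0(4)[of M "M' - M"] by simp_all
    then show "dist (N M) (N M') \<le> C * dist M M'"
      using up[of "M - M'"] up[of "M' - M"] by (simp add: dist_real_def dist_norm norm_minus_commute abs_le_iff)
  qed (rule \<open>C \<ge> 0\<close>)
  then have "continuous_on (sphere 0 1) N" using lipschitz_on_continuous_on continuous_on_subset subset_UNIV by blast
  moreover obtain b :: "real^'n^'n" where "norm b = 1" using vector_choose_size[of 1] by auto
  then have "sphere (0 :: real^'n^'n) 1 \<noteq> {}" by force
  ultimately obtain M0 where M0: "M0 \<in> sphere 0 1" "\<And>M. M \<in> sphere 0 1 \<Longrightarrow> N M0 \<le> N M"
    using continuous_attains_inf[OF compact_sphere] by blast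
  have "M0 \<noteq> 0" using M0(1) by auto
  then have pos: "N M0 > 0" using N0(1,2)[of M0] by (simp add: less_le)
  have "norm M \<le> (1 / N M0) * N M" for M
  proof (cases "M = 0")
    case False
    have "N M0 \<le> N (M /\<^sub>R norm M)" using False by (intro M0(2)) simp
    then show ?thesis using False pos by (simp add: N0(3) field_simps)
  qed (use N0(2)[of M] in simp)
  then show ?thesis using pos by (intro exI[of _ "1 / N M0"]) simp
qed

section \<open>Testing with second order jets\<close>

text \<open>The gradient only has to be differentiable at the one point \<open>x\<close>. Along the
  segment, the function minus its expected quadratic part has as derivative the first order
  remainder of the gradient, and the mean value theorem carries the bound over.\<close>

lemma taylor_second_order:
  fixes f :: "'a::real_inner \<Rightarrow> real"
  assumes S: "open S" "x \<in> S" and f: "\<And>y. y \<in> S \<Longrightarrow> (f has_derivative (\<lambda>h. g y \<bullet> h)) (at y)"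
    and g: "(g has_derivative D) (at x)" and "e > 0"
  shows "\<forall>\<^sub>F h in nhds 0. \<bar>f (x + h) - f x - g x \<bullet> h - (D h \<bullet> h) / 2\<bar> \<le> e * (norm h)\<^sup>2"
proof -
  interpret D: bounded_linear D using g by (rule has_derivative_bounded_linear)
  obtain d where d: "d > 0" "\<And>y. norm (y - x) < d \<Longrightarrow> norm (g y - g x - D (y - x)) \<le> e * norm (y - x)"
    using g \<open>e > 0\<close> unfolding has_derivative_at_alt by blast
  obtain r where r: "r > 0" "ball x r \<subseteq> S" using S open_contains_ball by blast
  have "\<bar>f (x + h) - f x - g x \<bullet> h - (D h \<bullet> h) / 2\<bar> \<le> e * (norm h)\<^sup>2" if h: "norm h < min d r" for h
  proof -
    define \<phi> where "\<phi> t = f (x + t *\<^sub>R h) - t * (g x \<bullet> h) - t\<^sup>2 * (D h \<bullet> h) / 2" for t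
    have small: "norm (t *\<^sub>R h) \<le> norm h" if "0 \<le> t" "t \<le> 1" for t
      using that by (simp add: mult_left_le_one_le)
    have der: "(\<phi> has_real_derivative (g (x + t *\<^sub>R h) \<bullet> h - g x \<bullet> h - t * (D h \<bullet> h))) (at t)" if t: "0 \<le> t" "t \<le> 1" for t
    proof -
      have mem: "x + t *\<^sub>R h \<in> S" using small[OF t] h r(2) by (auto simp: dist_norm)
      have hd: "((\<lambda>t. x + t *\<^sub>R h) has_derivative (\<lambda>s. s *\<^sub>R h)) (at t)"
        by (auto intro!: derivative_eq_intros)
      have "((\<lambda>t. f (x + t *\<^sub>R h)) has_derivative (\<lambda>s. g (x + t *\<^sub>R h) \<bullet> (s *\<^sub>R h))) (at t)"
        by (rule has_derivative_compose[OF hd f[OF mem]])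
      then have "((\<lambda>t. f (x + t *\<^sub>R h)) has_real_derivative (g (x + t *\<^sub>R h) \<bullet> h)) (at t)"
        by (simp add: has_field_derivative_def mult_commute_abs)
      then show ?thesis unfolding \<phi>_def by (auto intro!: derivative_eq_intros)
    qed
    obtain t where t: "0 < t" "t < 1" "\<phi> 1 - \<phi> 0 = (1 - 0) * (g (x + t *\<^sub>R h) \<bullet> h - g x \<bullet> h - t * (D h \<bullet> h))"
      using MVT2[of 0 1 \<phi> "\<lambda>t. g (x + t *\<^sub>R h) \<bullet> h - g x \<bullet> h - t * (D h \<bullet> h)"] der by auto
    have "\<phi> 1 - \<phi> 0 = f (x + h) - f x - g x \<bullet> h - (D h \<bullet> h) / 2" by (simp add: \<phi>_def)
    moreover have "g (x + t *\<^sub>R h) \<bullet> h - g x \<bullet> h - t * (D h \<bullet> h) = (g (x + t *\<^sub>R h) - g x - D (t *\<^sub>R h)) \<bullet> h"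
      by (simp add: inner_diff_left D.scaleR)
    moreover have "\<bar>(g (x + t *\<^sub>R h) - g x - D (t *\<^sub>R h)) \<bullet> h\<bar> \<le> (e * norm h) * norm h"
    proof -
      have "norm (g (x + t *\<^sub>R h) - g x - D (t *\<^sub>R h)) \<le> e * norm (t *\<^sub>R h)"
        using d(2)[of "x + t *\<^sub>R h"] small[of t] t h by simp
      also have "\<dots> \<le> e * norm h" using small[of t] t \<open>e > 0\<close> by (intro mult_left_mono) auto
      finally have "norm (g (x + t *\<^sub>R h) - g x - D (t *\<^sub>R h)) * norm h \<le> (e * norm h) * norm h" by (rule mult_right_mono) simp
      then show ?thesis using Cauchy_Schwarz_ineq2 order_trans by blast
    qed
    ultimately show ?thesis using t(3) by (simp add: power2_eq_square mult.assoc)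
  qed
  then show ?thesis unfolding eventually_nhds_metric using d r by (intro exI[of _ "min d r"]) auto
qed

lemma eventually_nhds_translate:
  fixes x :: "'a::real_normed_vector"
  assumes "\<forall>\<^sub>F h in nhds 0. P (x + h)"
  shows "\<forall>\<^sub>F y in nhds x. P y"
proof -
  obtain d where d: "d > 0" "\<And>h. dist h 0 < d \<Longrightarrow> P (x + h)"
    using assms unfolding eventually_nhds_metric by blast
  have "P y" if "dist y x < d" for y
    using d(2)[of "y - x"] that by (simp add: dist_norm)
  then show ?thesis unfolding eventually_nhds_metric using d(1) by blast
qed

lemma grad_eqI:
  assumes "(f has_derivative (\<lambda>h. g \<bullet> h)) (at x)"
  shows "grad f x = g"
  unfolding grad_def frechet_derivative_at[OF assms, symmetric] by (simp add: inner_axis vec_eq_iff)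

lemma grad_hess_eqI:
  fixes f :: "real^'n \<Rightarrow> real"
  assumes S: "open S" "x \<in> S" and f: "\<And>y. y \<in> S \<Longrightarrow> (f has_derivative (\<lambda>h. g y \<bullet> h)) (at y)"
    and g: "(g has_derivative (\<lambda>h. M *v h)) (at x)"
  shows "grad f x = g x" "hess f x = M" "(grad f has_derivative (\<lambda>h. M *v h)) (at x)"
proof -
  have gr: "grad f y = g y" if "y \<in> S" for y using f[OF that] by (rule grad_eqI)
  then show "grad f x = g x" using S by simp
  show der: "(grad f has_derivative (\<lambda>h. M *v h)) (at x)"
    by (rule has_derivative_transform_within_open[OF g S]) (simp add: gr)
  show "hess f x = M"
    unfolding hess_def jacobian_def frechet_derivative_at[OF der, symmetric] by simp
qed

lemma C2_onI:
  fixes f :: "real^'n \<Rightarrow> real"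
  assumes S: "open S" and f: "\<And>y. y \<in> S \<Longrightarrow> (f has_derivative (\<lambda>h. g y \<bullet> h)) (at y)"
    and g: "\<And>y. y \<in> S \<Longrightarrow> (g has_derivative (\<lambda>h. M y *v h)) (at y)" and M: "continuous_on S M" and "T \<subseteq> S"
  shows "C2_on T f"
  unfolding C2_on_def
proof (intro conjI ballI)
  fix x assume "x \<in> T"
  then have x: "x \<in> S" using \<open>T \<subseteq> S\<close> by auto
  show "f differentiable (at x)" using f[OF x] by (auto simp: differentiable_def)
  show "grad f differentiable (at x)" using grad_hess_eqI(3)[OF S x f g[OF x]] by (auto simp: differentiable_def)
next
  have "continuous_on T M" using M \<open>T \<subseteq> S\<close> by (rule continuous_on_subset)
  then show "continuous_on T (hess f)"
    by (rule continuous_on_eq) (use grad_hess_eqI(2)[OF S _ f g] \<open>T \<subseteq> S\<close> in auto)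
qed

lemma has_derivative_vec:
  fixes f :: "'a::real_normed_vector \<Rightarrow> real^'n"
  assumes "\<And>i. ((\<lambda>x. f x $ i) has_derivative (\<lambda>h. f' h $ i)) (at x)"
  shows "(f has_derivative f') (at x)"
proof (subst has_derivative_componentwise_within, intro ballI)
  fix b :: "real^'n" assume "b \<in> Basis"
  then obtain i where "b = axis i 1" by (auto simp: Basis_vec_def)
  then show "((\<lambda>x. f x \<bullet> b) has_derivative (\<lambda>x. f' x \<bullet> b)) (at x)"
    using assms[of i] by (simp add: inner_axis)
qed

text \<open>A \<open>C\<^sup>2\<close> function with a prescribed jet \<open>(p, M)\<close>, \<open>p \<noteq> 0\<close>, at a point and without any critical
  point: the quadratic part is replaced by a bounded one in \<open>r sin(h\<^sub>i / r)\<close>, whose gradient is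
  of order \<open>r\<close>.  Such a function is admissible for every class \<open>\<F>\<close>.\<close>

lemma noncritical_function_with_jet:
  fixes M :: "real^'n^'n" and p x :: "real^'n"
  assumes sym: "transpose M = M" and "p \<noteq> 0"
  shows "\<exists>\<psi> g Hs. (\<forall>y. (\<psi> has_derivative (\<lambda>h. g y \<bullet> h)) (at y)) \<and> (\<forall>y. (g has_derivative (\<lambda>h. Hs y *v h)) (at y)) \<and>
    continuous_on UNIV Hs \<and> (\<forall>y. g y \<noteq> 0) \<and> g x = p \<and> Hs x = M"
proof -
  define n where "n = real CARD('n)"
  define K where "K = norm M + 1"
  \<comment> \<open>With this scale \<open>norm M * norm (s y)\<close> is at most half of
    \<open>norm p\<close>, so the gradient cannot vanish; the \<open>+ 1\<close> in \<open>K\<close>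
    covers \<open>M = 0\<close>.\<close>
  define r where "r = norm p / (2 * n * K)"
  have n: "n > 0" by (simp add: n_def)
  have nM: "K > 0" by (simp add: K_def add_nonneg_pos)
  have r: "r > 0" using \<open>p \<noteq> 0\<close> n nM by (simp add: r_def)
  define s where "s y = (\<chi> i. r * sin ((y $ i - x $ i) / r))" for y :: "real^'n"
  define c where "c y i = cos ((y $ i - x $ i) / r)" for y :: "real^'n" and i
  define \<psi> where "\<psi> y = p \<bullet> y + (s y \<bullet> (M *v s y)) / 2" for y
  define g where "g y = (\<chi> i. p $ i + (M *v s y) $ i * c y i)" for y
  \<comment> \<open>The diagonal correction comes from differentiating the cosines; it vanishes at
    \<open>x\<close> because \<open>s x = 0\<close>, which leaves exactly \<open>M\<close>
    there.\<close>
  define Hs where "Hs y = (\<chi> i j. M $ i $ j * c y j * c y i - (if i = j then (M *v s y) $ i * (s y $ i / r\<^sup>2) else 0))" for y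
  have nth: "((\<lambda>y. y $ i) has_derivative (\<lambda>h. h $ i)) (at y)" for y :: "real^'n" and i
    by (rule bounded_linear.has_derivative[OF bounded_linear_vec_nth has_derivative_ident])
  have ds: "(s has_derivative (\<lambda>h. \<chi> i. c y i * h $ i)) (at y)" for y
    by (rule has_derivative_vec) (use r in \<open>auto simp: s_def c_def intro!: derivative_eq_intros nth\<close>)
  have dc: "((\<lambda>y. c y i) has_derivative (\<lambda>h. - (s y $ i / r\<^sup>2) * h $ i)) (at y)" for y i
    unfolding c_def using r by (auto simp: s_def power2_eq_square intro!: derivative_eq_intros nth)
  have dMs: "((\<lambda>y. M *v s y) has_derivative (\<lambda>h. M *v (\<chi> i. c y i * h $ i))) (at y)" for y
    by (rule bounded_linear.has_derivative[OF matrix_vector_mul_bounded_linear ds])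
  have Msym: "v \<bullet> (M *v w) = w \<bullet> (M *v v)" for v w
    using symmetric_matrix_inner[OF sym, of v w] by (simp add: inner_commute)
  have "(\<psi> has_derivative (\<lambda>h. g y \<bullet> h)) (at y)" for y
  proof -
    have "(\<psi> has_derivative (\<lambda>h. p \<bullet> h + (s y \<bullet> (M *v (\<chi> i. c y i * h $ i)) + (\<chi> i. c y i * h $ i) \<bullet> (M *v s y)) / 2)) (at y)"
      unfolding \<psi>_def by (auto intro!: derivative_eq_intros ds dMs)
    moreover have "p \<bullet> h + (s y \<bullet> (M *v (\<chi> i. c y i * h $ i)) + (\<chi> i. c y i * h $ i) \<bullet> (M *v s y)) / 2 = g y \<bullet> h" for h
    proof -
      have "g y \<bullet> h = p \<bullet> h + (\<chi> i. c y i * h $ i) \<bullet> (M *v s y)"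
        by (simp add: g_def inner_vec_def sum.distrib distrib_left mult_ac)
      then show ?thesis using Msym[of "s y"] by simp
    qed
    ultimately show ?thesis by simp
  qed
  moreover have "(g has_derivative (\<lambda>h. Hs y *v h)) (at y)" for y
  proof (rule has_derivative_vec)
    fix i
    have dMsi: "((\<lambda>y. (M *v s y) $ i) has_derivative (\<lambda>h. (M *v (\<chi> i. c y i * h $ i)) $ i)) (at y)"
      by (rule bounded_linear.has_derivative[OF bounded_linear_vec_nth dMs])
    have "((\<lambda>y. g y $ i) has_derivative (\<lambda>h. (M *v s y) $ i * (- (s y $ i / r\<^sup>2) * h $ i) + (M *v (\<chi> i. c y i * h $ i)) $ i * c y i)) (at y)"
      unfolding g_def by (auto intro!: derivative_eq_intros dMsi dc)
    moreover have "(M *v s y) $ i * (- (s y $ i / r\<^sup>2) * h $ i) + (M *v (\<chi> i. c y i * h $ i)) $ i * c y i = (Hs y *v h) $ i" for h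
    proof -
      have "(Hs y *v h) $ i = (\<Sum>j\<in>UNIV. M $ i $ j * c y j * c y i * h $ j) - (\<Sum>j\<in>UNIV. if i = j then (M *v s y) $ i * (s y $ i / r\<^sup>2) * h $ i else 0)"
        unfolding sum_subtractf[symmetric] by (simp add: Hs_def matrix_vector_mult_def) (intro sum.cong, auto simp: algebra_simps)
      also have "(\<Sum>j\<in>UNIV. if i = j then (M *v s y) $ i * (s y $ i / r\<^sup>2) * h $ i else 0) = (M *v s y) $ i * (s y $ i / r\<^sup>2) * h $ i"
        by simp
      also have "(\<Sum>j\<in>UNIV. M $ i $ j * c y j * c y i * h $ j) = (M *v (\<chi> i. c y i * h $ i)) $ i * c y i"
        by (simp add: matrix_vector_mult_def sum_distrib_left sum_distrib_right mult_ac)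
      finally show ?thesis by simp
    qed
    ultimately show "((\<lambda>y. g y $ i) has_derivative (\<lambda>h. (Hs y *v h) $ i)) (at y)" by simp
  qed
  moreover have "continuous_on UNIV Hs"
  proof -
    have "continuous_on UNIV s"
      using ds has_derivative_continuous by (intro continuous_at_imp_continuous_on) blast
    moreover have "continuous_on UNIV (\<lambda>y. c y i)" for i
      using dc has_derivative_continuous by (intro continuous_at_imp_continuous_on) blast
    moreover have "continuous_on UNIV (\<lambda>y. M *v s y)"
      using dMs has_derivative_continuous by (intro continuous_at_imp_continuous_on) blast
    ultimately have "continuous_on UNIV (\<lambda>y. M $ i $ j * c y j * c y i - (if i = j then (M *v s y) $ i * (s y $ i / r\<^sup>2) else 0))" for i j
      using r by (cases "i = j") (auto intro!: continuous_intros)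
    then show ?thesis unfolding Hs_def by (intro continuous_on_vec_lambda)
  qed
  moreover have "g y \<noteq> 0" for y
  proof
    assume "g y = 0"
    define w where "w = (\<chi> i. (M *v s y) $ i * c y i)"
    have "g y = p + w" by (simp add: g_def w_def vec_eq_iff)
    then have "norm p = norm w" using \<open>g y = 0\<close> by (metis add_eq_0_iff norm_minus_cancel)
    also have "norm w \<le> norm (M *v s y)"
      by (rule norm_le_componentwise_cart) (simp add: w_def c_def abs_mult mult_left_le)
    also have "\<dots> \<le> norm M * norm (s y)" by (rule norm_matrix_vector_le)
    also have "\<dots> \<le> norm M * (n * r)"
    proof (rule mult_left_mono)
      have "norm (s y) \<le> (\<Sum>i\<in>UNIV. \<bar>s y $ i\<bar>)" by (rule norm_le_l1_cart)
      also have "\<dots> \<le> (\<Sum>i\<in>(UNIV::'n set). r)"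
        using r by (intro sum_mono) (simp add: s_def abs_mult mult_left_le)
      finally show "norm (s y) \<le> n * r" by (simp add: n_def)
    qed simp
    also have "\<dots> \<le> K * (n * r)" using n r by (intro mult_right_mono) (auto simp: K_def)
    also have "\<dots> = norm p / 2" using n nM by (simp add: r_def)
    finally show False using \<open>p \<noteq> 0\<close> by simp
  qed
  moreover have "s x = 0" by (simp add: s_def vec_eq_iff)
  then have "M *v s x = 0" by simp
  then have "g x = p" "Hs x = M" unfolding g_def Hs_def by (simp_all add: c_def vec_eq_iff)
  ultimately show ?thesis by blast
qed

text \<open>A jet with nonzero slope may be used directly in the equation. Enlarging
  \<open>X\<close> by a small multiple of the identity absorbs the remainders of the jet and of the
  test function, and the contact function without critical points is admissible for every
  \<F>.\<close>

lemma F_subsolution_upper_jet: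
  fixes u :: "real^'n \<Rightarrow> real"
  assumes sub: "F_subsolution \<F> \<Omega> A H u" and x: "x \<in> \<Omega>" and p: "p \<noteq> 0" and jet: "upper_jet u x p X"
  shows "H x (u x) p \<le> trace (A p ** X)"
proof (rule field_le_epsilon)
  fix e :: real assume e: "e > 0"
  \<comment> \<open>The enlargement of \<open>X\<close> changes the trace by
    \<open>2 * \<eta> * trace (A p)\<close>, which \<eta> keeps below \<open>e\<close>.\<close>
  define K where "K = \<bar>trace (A p)\<bar> + 1"
  have K: "K > 0" by (simp add: K_def add_nonneg_pos)
  define \<eta> where "\<eta> = e / (2 * K)"
  have \<eta>: "\<eta> > 0" using e K by (simp add: \<eta>_def)
  define M where "M = X + (2 * \<eta>) *\<^sub>R mat 1"
  have X: "transpose X = X" using jet by (simp add: upper_jet_def)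
  have "transpose M = transpose X + (2 * \<eta>) *\<^sub>R transpose (mat 1)" by (simp add: M_def transpose_def vec_eq_iff)
  then have sym: "transpose M = M" using X by (simp add: M_def transpose_mat)
  obtain \<psi> g Hs where \<psi>: "\<And>y. (\<psi> has_derivative (\<lambda>h. g y \<bullet> h)) (at y)" "\<And>y. (g has_derivative (\<lambda>h. Hs y *v h)) (at y)"
    "continuous_on UNIV Hs" "\<And>y. g y \<noteq> 0" "g x = p" "Hs x = M"
    using noncritical_function_with_jet[OF sym p, of x] by blast
  have gr: "grad \<psi> y = g y" for y using \<psi>(1) by (rule grad_eqI)
  have hs: "hess \<psi> x = M" using grad_hess_eqI(2)[of UNIV x \<psi> g M] \<psi> by (metis UNIV_I open_UNIV)
  have "C2_on \<Omega> \<psi>" by (rule C2_onI[of UNIV \<psi> g Hs]) (use \<psi> in auto)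
  then have mem: "\<psi> \<in> C2_A \<F> \<Omega>" unfolding C2_A_def using gr \<psi>(4) by simp
  have "\<forall>\<^sub>F h in nhds 0. \<bar>\<psi> (x + h) - \<psi> x - g x \<bullet> h - ((Hs x *v h) \<bullet> h) / 2\<bar> \<le> \<eta> / 2 * (norm h)\<^sup>2"
    by (rule taylor_second_order[of UNIV]) (use \<psi> \<eta> in auto)
  moreover have "\<forall>\<^sub>F h in nhds 0. u (x + h) \<le> u x + p \<bullet> h + (h \<bullet> (X *v h)) / 2 + (\<eta> / 2) * (norm h)\<^sup>2"
  proof -
    have "\<eta> / 2 > 0" using \<eta> by simp
    then show ?thesis using jet unfolding upper_jet_def by blast
  qed
  ultimately have "\<forall>\<^sub>F h in nhds 0. u (x + h) - \<psi> (x + h) \<le> u x - \<psi> x"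
  proof eventually_elim
    case (elim h)
    have "(Hs x *v h) \<bullet> h = h \<bullet> (X *v h) + 2 * \<eta> * (norm h)\<^sup>2"
      unfolding \<psi>(6) M_def matrix_vector_mult_add_rdistrib scaleR_matrix_vector_assoc[symmetric]
      by (simp add: inner_add_left inner_add_right power2_norm_eq_inner inner_commute)
    then show ?case using elim unfolding \<psi>(5) by (simp only: abs_le_iff) argo
  qed
  then have "\<forall>\<^sub>F y in nhds x. u y - \<psi> y \<le> u x - \<psi> x"
    by (rule eventually_nhds_translate)
  then have "- trace (A (grad \<psi> x) ** hess \<psi> x) + H x (u x) (grad \<psi> x) \<le> 0"
  proof -
    have "grad \<psi> x \<noteq> 0" using gr \<psi>(4) by simp
    then show ?thesis using sub mem x \<open>\<forall>\<^sub>F y in nhds x. u y - \<psi> y \<le> u x - \<psi> x\<close> unfolding F_subsolution_def by blast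
  qed
  then have "H x (u x) p \<le> trace (A p ** M)" by (simp add: gr hs \<psi>(5))
  also have "A p ** M = A p ** X + (2 * \<eta>) *\<^sub>R A p"
  proof -
    have "A p ** ((2 * \<eta>) *\<^sub>R mat 1) = (2 * \<eta>) *\<^sub>R A p"
      by (simp add: matrix_matrix_mult_def mat_def vec_eq_iff if_distrib sum.delta' cong: if_cong)
    then show ?thesis unfolding M_def matrix_add_ldistrib by simp
  qed
  also have "trace (A p ** X + (2 * \<eta>) *\<^sub>R A p) = trace (A p ** X) + 2 * \<eta> * trace (A p)"
    by (simp add: trace_def sum.distrib sum_distrib_left)
  also have "2 * \<eta> * trace (A p) \<le> 2 * \<eta> * K" using \<eta> by (intro mult_left_mono) (auto simp: K_def)
  also have "\<dots> = e" using K by (simp add: \<eta>_def)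
  finally show "H x (u x) p \<le> trace (A p ** X) + e" by simp
qed

section \<open>Degenerate contact\<close>

lemma has_derivative_norm_powr:
  fixes y :: "'a::real_inner"
  assumes "y \<noteq> 0"
  shows "((\<lambda>y. norm y powr a) has_derivative (\<lambda>h. a * norm y powr (a - 2) * (y \<bullet> h))) (at y)"
proof -
  have n: "norm y > 0" using assms by simp
  have "((\<lambda>t. t powr a) has_derivative (\<lambda>t. (a * norm y powr (a - 1)) * t)) (at (norm y))"
    using has_real_derivative_powr[OF n, of a] by (simp add: has_field_derivative_def)
  from has_derivative_compose[OF has_derivative_norm[OF assms] this]
  have "((\<lambda>y. norm y powr a) has_derivative (\<lambda>h. (a * norm y powr (a - 1)) * (h \<bullet> sgn y))) (at y)" .
  moreover have "(a * norm y powr (a - 1)) * (h \<bullet> sgn y) = a * norm y powr (a - 2) * (y \<bullet> h)" for h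
  proof -
    have "norm y powr (a - 1) / norm y = norm y powr (a - 2)"
      using n powr_diff[of "norm y" "a - 1" 1] by simp
    then show ?thesis by (simp add: sgn_div_norm inner_commute divide_inverse)
  qed
  ultimately show ?thesis by simp
qed

definition pow_grad :: "real \<Rightarrow> real^'n \<Rightarrow> real^'n" where
  "pow_grad k y = (k * norm y powr (k - 2)) *\<^sub>R y"

text \<open>At \<open>y = 0\<close> both terms vanish since \<open>0 powr a = 0\<close> for every
  exponent, including the possibly negative \<open>k - 4\<close>; for \<open>k > 2\<close> this is
  the right value.\<close>

definition pow_hess :: "real \<Rightarrow> real^'n \<Rightarrow> real^'n^'n" where
  "pow_hess k y = (k * norm y powr (k - 2)) *\<^sub>R mat 1 + (k * (k - 2) * norm y powr (k - 4)) *\<^sub>R (\<chi> i j. y $ i * y $ j)"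

lemma pow_hess_mult:
  "pow_hess k y *v h = (k * norm y powr (k - 2)) *\<^sub>R h + (k * (k - 2) * norm y powr (k - 4) * (y \<bullet> h)) *\<^sub>R y"
proof -
  have "(\<chi> i j. y $ i * y $ j) *v h = (y \<bullet> h) *\<^sub>R y"
    by (simp add: vec_eq_iff matrix_vector_mult_def inner_vec_def sum_distrib_left mult_ac)
  then show ?thesis
    by (simp add: pow_hess_def matrix_vector_mult_add_rdistrib scaleR_matrix_vector_assoc[symmetric])
qed

lemma transpose_pow_hess: "transpose (pow_hess k y) = pow_hess k y"
  by (simp add: pow_hess_def transpose_def vec_eq_iff mat_def mult.commute)

lemma pow_derivatives:
  assumes "y \<noteq> 0"
  shows "((\<lambda>y. c * norm y powr k) has_derivative (\<lambda>h. (c *\<^sub>R pow_grad k y) \<bullet> h)) (at y)"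
    and "((\<lambda>y. c *\<^sub>R pow_grad k y) has_derivative (\<lambda>h. (c *\<^sub>R pow_hess k y) *v h)) (at y)"
proof -
  show "((\<lambda>y. c * norm y powr k) has_derivative (\<lambda>h. (c *\<^sub>R pow_grad k y) \<bullet> h)) (at y)"
    using has_derivative_mult_right[OF has_derivative_norm_powr[OF assms, of k], of c] by (simp add: pow_grad_def mult.assoc)
  have e: "k - 2 - 2 = k - 4" by simp
  have "((\<lambda>y. c *\<^sub>R ((k * norm y powr (k - 2)) *\<^sub>R y)) has_derivative
     (\<lambda>h. c *\<^sub>R ((k * norm y powr (k - 2)) *\<^sub>R h + (k * ((k - 2) * norm y powr (k - 2 - 2) * (y \<bullet> h))) *\<^sub>R y))) (at y)"
    by (rule has_derivative_scaleR_right[OF has_derivative_scaleR[OF has_derivative_mult_right[OF has_derivative_norm_powr[OF assms]] has_derivative_ident]])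
  then show "((\<lambda>y. c *\<^sub>R pow_grad k y) has_derivative (\<lambda>h. (c *\<^sub>R pow_hess k y) *v h)) (at y)"
    unfolding pow_grad_def scaleR_matrix_vector_assoc[symmetric] pow_hess_mult e by (simp add: mult.assoc)
qed

lemma grad_hess_norm_powr:
  assumes "y \<noteq> 0"
  shows "grad (\<lambda>y::real^'n. norm y powr k) y = pow_grad k y" "hess (\<lambda>y. norm y powr k) y = pow_hess k y"
  using grad_hess_eqI[of "- {0}" y "\<lambda>y. norm y powr k" "pow_grad k" "pow_hess k y"]
    pow_derivatives[of _ 1 k] assms by auto

lemma norm_pow_grad:
  assumes "k > 0"
  shows "norm (pow_grad k y) = k * norm y powr (k - 1)"
proof (cases "y = 0")
  case False
  have "norm y powr (k - 2) * norm y = norm y powr (k - 1)"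
    using False powr_add[of "norm y" "k - 2" 1] by simp
  then show ?thesis using assms by (simp add: pow_grad_def mult.assoc)
qed (simp add: pow_grad_def)

text \<open>(A1) speaks of the power with coefficient 1. By homogeneity a coefficient
  \<open>s powr (k - 1)\<close> can be moved into the argument of the gradient, leaving a single
  factor \<open>s\<close> in front of the Hessian, so the condition extends to all positive
  multiples.\<close>

lemma pow_scale:
  assumes "s > 0"
  shows "(s powr (k - 1)) *\<^sub>R pow_grad k d = pow_grad k (s *\<^sub>R d)" "(s powr (k - 1)) *\<^sub>R pow_hess k d = s *\<^sub>R pow_hess k (s *\<^sub>R d)"
proof -
  have 1: "s powr (k - 1) = s powr (k - 2) * s" using assms powr_add[of s "k - 2" 1] by simp
  have 2: "s powr (k - 2) = s powr (k - 4) * s\<^sup>2" using assms powr_add[of s "k - 4" 2] by (simp add: powr_numeral)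
  have n: "norm (s *\<^sub>R d) powr a = s powr a * norm d powr a" for a using assms by (simp add: powr_mult)
  show "(s powr (k - 1)) *\<^sub>R pow_grad k d = pow_grad k (s *\<^sub>R d)"
    unfolding pow_grad_def n 1 by (simp add: mult_ac)
  show "(s powr (k - 1)) *\<^sub>R pow_hess k d = s *\<^sub>R pow_hess k (s *\<^sub>R d)"
    unfolding pow_hess_def n 1 unfolding 2 by (simp add: vec_eq_iff algebra_simps power2_eq_square)
qed

lemma upper_jetI:
  fixes f :: "real^'n \<Rightarrow> real"
  assumes S: "open S" "x \<in> S" and f: "\<And>y. y \<in> S \<Longrightarrow> (f has_derivative (\<lambda>h. g y \<bullet> h)) (at y)"
    and g: "(g has_derivative (\<lambda>h. M *v h)) (at x)" and sym: "transpose M = M"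
    and max: "\<forall>\<^sub>F h in nhds 0. u (z + h) - f (x + h) \<le> u z - f x"
  shows "upper_jet u z (g x) M"
  unfolding upper_jet_def
proof (intro conjI allI impI sym)
  fix e :: real assume "e > 0"
  have "\<forall>\<^sub>F h in nhds 0. \<bar>f (x + h) - f x - g x \<bullet> h - ((M *v h) \<bullet> h) / 2\<bar> \<le> e * (norm h)\<^sup>2"
    by (rule taylor_second_order[OF S _ g \<open>e > 0\<close>]) (rule f)
  from this max
  show "\<forall>\<^sub>F h in nhds 0. u (z + h) \<le> u z + g x \<bullet> h + h \<bullet> (M *v h) / 2 + e * (norm h)\<^sup>2"
    by eventually_elim (simp add: abs_le_iff inner_commute)
qed

text \<open>The mean value theorem is used twice, going from the second derivative down to
  \<open>f\<close>. Nonnegativity makes constants admissible test functions.\<close>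

lemma F_class_nonneg:
  assumes "f \<in> F_class" "r \<ge> 0"
  shows "f r \<ge> 0"
proof -
  obtain f1 f2 where f: "\<And>r. r \<ge> 0 \<Longrightarrow> (f has_real_derivative f1 r) (at r within {0..})"
     "\<And>r. r \<ge> 0 \<Longrightarrow> (f1 has_real_derivative f2 r) (at r within {0..})" "f 0 = 0" "f1 0 = 0" "\<And>r. r > 0 \<Longrightarrow> f2 r > 0"
    using assms(1) unfolding F_class_def by blast
  have mvt: "\<exists>t\<in>{0<..<b}. g b - g 0 = g' t * b" if "b > 0" "\<And>r. r \<ge> 0 \<Longrightarrow> (g has_real_derivative g' r) (at r within {0..})" for g g' :: "real \<Rightarrow> real" and b
  proof -
    have "\<exists>t\<in>{0<..<b}. g b - g 0 = (\<lambda>h. g' t * h) (b - 0)"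
    proof (rule mvt_simple)
      show "(g has_derivative (\<lambda>h. g' x * h)) (at x within {0..b})" if "0 \<le> x" "x \<le> b" for x
        using DERIV_subset[OF \<open>\<And>r. r \<ge> 0 \<Longrightarrow> (g has_real_derivative g' r) (at r within {0..})\<close>, of x "{0..b}"] that
        by (auto simp: has_field_derivative_def)
    qed fact
    then show ?thesis by simp
  qed
  have f1: "f1 t \<ge> 0" if t: "t \<ge> 0" for t
  proof (cases "t = 0")
    case False
    then obtain s where "s \<in> {0<..<t}" "f1 t - f1 0 = f2 s * t" using mvt[of t f1 f2] f(2) t by auto
    then show ?thesis using f(4,5) t by (auto simp: less_imp_le)
  qed (use f in simp)
  show ?thesis
  proof (cases "r = 0")
    case False
    then obtain s where "s \<in> {0<..<r}" "f r - f 0 = f1 s * r" using mvt[of r f f1] f(1) assms(2) by auto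
    then show ?thesis using f(3) f1[of s] assms(2) by auto
  qed (use f in simp)
qed

lemma constant_test_function:
  fixes \<Omega> :: "(real^'n) set"
  assumes "\<F> \<noteq> {}" "\<F> \<subseteq> F_class"
  shows "(\<lambda>_. 0) \<in> C2_A \<F> \<Omega>" "grad (\<lambda>_::real^'n. 0) x = 0"
proof -
  have "((\<lambda>_. 0) has_derivative (\<lambda>h. 0 \<bullet> h)) (at y)" for y :: "real^'n" by simp
  then show "grad (\<lambda>_::real^'n. 0) x = 0" by (rule grad_eqI)
  have "C2_on \<Omega> (\<lambda>_. 0)" by (rule C2_onI[of UNIV _ "\<lambda>_. 0" "\<lambda>_. 0"]) auto
  moreover have "\<exists>f\<in>\<F>. \<forall>\<^sub>F x in nhds x0. \<bar>(0::real) - 0\<bar> \<le> f (norm (x - x0))" for x0 :: "real^'n"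
  proof -
    obtain f where f: "f \<in> \<F>" using assms by blast
    then have "\<bar>(0::real) - 0\<bar> \<le> f (norm (x - x0))" for x :: "real^'n"
      using F_class_nonneg[of f "norm (x - x0)"] assms by auto
    then show ?thesis using f by (intro bexI[of _ f] always_eventually allI)
  qed
  ultimately show "(\<lambda>_. 0) \<in> C2_A \<F> \<Omega>" unfolding C2_A_def by blast
qed

text \<open>The bound holds in both orders of the points and its exponent exceeds 1, so the
  derivative is zero throughout the ball.\<close>

lemma constant_of_superlinear_bound:
  fixes u :: "'a::real_normed_vector \<Rightarrow> real"
  assumes bound: "\<And>x y. x \<in> ball z \<sigma> \<Longrightarrow> y \<in> ball z \<sigma> \<Longrightarrow> u x - u y \<le> c * norm (x - y) powr k"
    and "k > 2" "c > 0" and x: "x \<in> ball z \<sigma>"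
  shows "u x = u z"
proof -
  have "\<exists>C. \<forall>x\<in>ball z \<sigma>. u x = C"
  proof (rule has_derivative_zero_constant)
    fix x assume x: "x \<in> ball z \<sigma>"
    show "(u has_derivative (\<lambda>h. 0)) (at x within ball z \<sigma>)"
      unfolding has_derivative_within_alt
    proof (intro conjI allI impI bounded_linear_zero)
      fix e :: real assume "e > 0"
      show "\<exists>d>0. \<forall>y\<in>ball z \<sigma>. norm (y - x) < d \<longrightarrow> norm (u y - u x - 0) \<le> e * norm (y - x)"
      proof (intro exI[of _ "min 1 (e / c)"] conjI ballI impI)
        fix y assume y: "y \<in> ball z \<sigma>" "norm (y - x) < min 1 (e / c)"
        have "\<bar>u y - u x\<bar> \<le> c * norm (y - x) powr k"
          using bound[OF y(1) x] bound[OF x y(1)] by (simp add: norm_minus_commute abs_le_iff)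
        also have "\<dots> \<le> c * norm (y - x) powr 2"
          using y(2) \<open>c > 0\<close> \<open>k > 2\<close> by (intro mult_left_mono powr_mono') auto
        also have "\<dots> = (c * norm (y - x)) * norm (y - x)" by (simp add: powr_numeral power2_eq_square)
        also have "\<dots> \<le> e * norm (y - x)"
          using y(2) \<open>c > 0\<close> by (intro mult_right_mono) (auto simp: field_simps)
        finally show "norm (u y - u x - 0) \<le> e * norm (y - x)" by simp
      qed (use \<open>e > 0\<close> \<open>c > 0\<close> in simp)
    qed
  qed simp
  moreover have "z \<in> ball z \<sigma>" using x by (auto intro: le_less_trans[OF zero_le_dist])
  ultimately show ?thesis using x by metis
qed

lemma tendsto_hamiltonian:
  assumes "continuous_on (\<Omega> \<times> UNIV \<times> UNIV) (\<lambda>(x, r, p). H x r p)" "x0 \<in> \<Omega>" "\<And>m. x m \<in> \<Omega>"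
    and lim: "x \<longlonglongrightarrow> x0" "r \<longlonglongrightarrow> r0" "p \<longlonglongrightarrow> p0"
  shows "(\<lambda>m. H (x m) (r m) (p m)) \<longlonglongrightarrow> H x0 r0 p0"
proof -
  have "(\<lambda>m. (x m, r m, p m)) \<longlonglongrightarrow> (x0, r0, p0)" by (intro tendsto_Pair lim)
  from continuous_on_tendsto_compose[OF assms(1) this] assms(2,3) show ?thesis by simp
qed

text \<open>The condition at a degenerate contact point does not depend on \<open>\<F>\<close>.  Move the centre of the
  power \<open>|x - x0|\<^sup>k\<close> slightly: either contact points with nonzero gradient converge to \<open>x0\<close>, and the
  second order term vanishes in the limit, or the contact point always is the centre, in which
  case \<open>u\<close> is locally constant and can be tested with a constant.\<close>

lemma F_subsolution_degenerate_contact: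
  fixes u :: "real^'n \<Rightarrow> real"
  assumes sub: "F_subsolution \<F> \<Omega> A H u" and F: "\<F> \<noteq> {}" "\<F> \<subseteq> F_class" and \<Omega>: "open \<Omega>" and x0: "x0 \<in> \<Omega>"
    and contu: "continuous_on \<Omega> u" and contH: "continuous_on (\<Omega> \<times> UNIV \<times> UNIV) (\<lambda>(x, r, p). H x r p)"
    and k: "k > 2" and A1: "((\<lambda>x. trace (A (pow_grad k x) ** pow_hess k x)) \<longlongrightarrow> 0) (at 0)"
    and K: "K \<ge> 0" and loc: "\<forall>\<^sub>F x in nhds x0. u x \<le> u x0 + K * norm (x - x0) powr k"
  shows "H x0 (u x0) 0 \<le> 0"
proof -
  \<comment> \<open>Strictly larger than \<open>K\<close>: the surplus pushes maxima of the
    penalised function into the interior of the ball.\<close>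
  define c where "c = K + 1"
  have c: "c > 0" using K by (simp add: c_def)
  obtain R where R: "R > 0" "cball x0 R \<subseteq> \<Omega>" "\<And>x. x \<in> cball x0 R \<Longrightarrow> u x \<le> u x0 + K * norm (x - x0) powr k"
  proof -
    obtain R1 where R1: "R1 > 0" "cball x0 R1 \<subseteq> \<Omega>" using \<Omega> x0 open_contains_cball by blast
    obtain R2 where R2: "R2 > 0" "\<And>x. dist x x0 < R2 \<Longrightarrow> u x \<le> u x0 + K * norm (x - x0) powr k"
      using loc unfolding eventually_nhds_metric by blast
    show thesis
    proof (rule that[of "min R1 (R2 / 2)"])
      show "cball x0 (min R1 (R2 / 2)) \<subseteq> \<Omega>" using R1(2) by auto
      show "u x \<le> u x0 + K * norm (x - x0) powr k" if "x \<in> cball x0 (min R1 (R2 / 2))" for x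
        using R2(2)[of x] R2(1) that by (simp add: dist_commute)
    qed (use R1 R2 in auto)
  qed
  define f where "f y x = u x - c * norm (x - y) powr k" for y x
  have contf: "continuous_on (cball x0 \<rho>) (f y)" if "\<rho> \<le> R" for \<rho> y
  proof -
    have "continuous_on (cball x0 \<rho>) u" using contu R(2) that by (meson continuous_on_subset order_trans subset_cball)
    moreover have "continuous_on (cball x0 \<rho>) (\<lambda>x. norm (x - y) powr k)"
      by (rule continuous_on_powr') (use k in \<open>auto intro!: continuous_intros\<close>)
    ultimately show ?thesis unfolding f_def by (intro continuous_on_diff continuous_on_mult_left)
  qed
  \<comment> \<open>As \<sigma> tends to 0 the expression tends to
    \<open>(K - c) * \<rho> powr k = - \<rho> powr k\<close>, which is negative.\<close>
  have sig: "\<exists>\<sigma>. 0 < \<sigma> \<and> \<sigma> < \<rho> \<and> K * \<rho> powr k - c * (\<rho> - \<sigma>) powr k + c * \<sigma> powr k < 0" if \<rho>: "\<rho> > 0" for \<rho>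
  proof -
    have lim0: "((\<lambda>\<sigma>::real. \<sigma>) \<longlongrightarrow> 0) (at_right 0)" by (rule tendsto_ident_at)
    have l1: "((\<lambda>\<sigma>. \<sigma> powr k) \<longlongrightarrow> 0) (at_right 0)"
      by (rule tendsto_zero_powrI[OF lim0 tendsto_const]) (use k in \<open>auto simp: eventually_at_filter\<close>)
    have l2: "((\<lambda>\<sigma>. (\<rho> - \<sigma>) powr k) \<longlongrightarrow> (\<rho> - 0) powr k) (at_right 0)"
      using \<rho> by (intro tendsto_intros lim0) auto
    have "((\<lambda>\<sigma>. K * \<rho> powr k - c * (\<rho> - \<sigma>) powr k + c * \<sigma> powr k) \<longlongrightarrow> K * \<rho> powr k - c * (\<rho> - 0) powr k + c * 0) (at_right 0)"
      by (rule tendsto_add[OF tendsto_diff[OF tendsto_const tendsto_mult[OF tendsto_const l2]] tendsto_mult[OF tendsto_const l1]])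
    moreover have "K * \<rho> powr k - c * (\<rho> - 0) powr k + c * 0 < 0" using \<rho> by (simp add: c_def algebra_simps)
    ultimately have "\<forall>\<^sub>F \<sigma> in at_right 0. K * \<rho> powr k - c * (\<rho> - \<sigma>) powr k + c * \<sigma> powr k < 0"
      by (rule order_tendstoD(2))
    moreover have "\<forall>\<^sub>F \<sigma> in at_right 0. \<sigma> < \<rho>" using lim0 \<rho> by (rule order_tendstoD(2))
    moreover have "\<forall>\<^sub>F \<sigma> in at_right (0::real). 0 < \<sigma>" by (simp add: eventually_at_filter)
    ultimately have "\<forall>\<^sub>F \<sigma> in at_right 0. 0 < \<sigma> \<and> \<sigma> < \<rho> \<and> K * \<rho> powr k - c * (\<rho> - \<sigma>) powr k + c * \<sigma> powr k < 0"
      by eventually_elim simp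
    then show ?thesis using eventually_happens'[OF trivial_limit_at_right_real[of "0::real"]] by blast
  qed
  \<comment> \<open>On the sphere of radius \<rho> the penalised function stays below its value at
    \<open>x0\<close> as long as the centre \<open>y\<close> is within \<sigma> of
    \<open>x0\<close>; this is the inequality chosen in \<open>sig\<close>.\<close>
  have interior: "x \<in> ball x0 \<rho>"
    if \<rho>: "0 < \<rho>" "\<rho> \<le> R" and \<sigma>: "0 < \<sigma>" "\<sigma> < \<rho>" "K * \<rho> powr k - c * (\<rho> - \<sigma>) powr k + c * \<sigma> powr k < 0"
      and y: "y \<in> ball x0 \<sigma>" and x: "x \<in> cball x0 \<rho>" "\<And>x'. x' \<in> cball x0 \<rho> \<Longrightarrow> f y x' \<le> f y x" for \<rho> \<sigma> x y
  proof (rule ccontr)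
    assume "x \<notin> ball x0 \<rho>"
    then have nx: "norm (x - x0) = \<rho>" using x(1) by (simp add: dist_norm norm_minus_commute)
    have ny: "norm (x0 - y) \<le> \<sigma>" using y by (simp add: dist_norm)
    have "u x0 - c * norm (x0 - y) powr k \<le> u x - c * norm (x - y) powr k"
      using x(2)[of x0] \<rho> by (simp add: f_def)
    moreover have "c * norm (x0 - y) powr k \<le> c * \<sigma> powr k" using ny k c by (intro mult_left_mono powr_mono2) auto
    moreover have "c * (\<rho> - \<sigma>) powr k \<le> c * norm (x - y) powr k"
    proof -
      have "\<rho> - \<sigma> \<le> norm (x - y)" using norm_triangle_ineq2[of "x - x0" "y - x0"] nx ny by (simp add: norm_minus_commute)
      then show ?thesis using \<sigma> k c by (intro mult_left_mono powr_mono2) auto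
    qed
    moreover have "u x \<le> u x0 + K * \<rho> powr k" using R(3)[of x] x(1) \<rho> nx by auto
    ultimately show False using \<sigma>(3) by linarith
  qed
  show ?thesis
  proof (cases "\<exists>\<rho> \<sigma>. 0 < \<rho> \<and> \<rho> \<le> R \<and> 0 < \<sigma> \<and> \<sigma> < \<rho> \<and> (\<forall>y\<in>ball x0 \<sigma>. \<forall>x\<in>cball x0 \<rho>. f y x \<le> f y y)")
    case True
    then obtain \<rho> \<sigma> where \<rho>: "0 < \<rho>" "\<rho> \<le> R" "0 < \<sigma>" "\<sigma> < \<rho>" and *: "\<And>x y. y \<in> ball x0 \<sigma> \<Longrightarrow> x \<in> cball x0 \<rho> \<Longrightarrow> f y x \<le> f y y" by blast
    have b: "u x - u y \<le> c * norm (x - y) powr k" if "x \<in> ball x0 \<sigma>" "y \<in> ball x0 \<sigma>" for x y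
      using *[OF that(2), of x] that \<rho> by (simp add: f_def)
    have "u x - 0 \<le> u x0 - 0" if "x \<in> ball x0 \<sigma>" for x
      using constant_of_superlinear_bound[OF b k c that] by simp
    moreover have "\<forall>\<^sub>F x in nhds x0. x \<in> ball x0 \<sigma>" using \<rho>(3) by (intro eventually_nhds_in_open) auto
    ultimately have "\<forall>\<^sub>F x in nhds x0. u x - 0 \<le> u x0 - 0" by (rule eventually_mono[rotated])
    moreover have tests: "\<forall>\<psi>\<in>C2_A \<F> \<Omega>. \<forall>x0\<in>\<Omega>. (\<forall>\<^sub>F x in nhds x0. u x - \<psi> x \<le> u x0 - \<psi> x0) \<longrightarrow>
        (grad \<psi> x0 = 0 \<longrightarrow> H x0 (u x0) (grad \<psi> x0) \<le> 0)"
      using sub unfolding F_subsolution_def by blast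
    ultimately show ?thesis
      using bspec[OF bspec[OF tests constant_test_function(1)[OF F]] x0] by (simp add: constant_test_function(2)[OF F])
  next
    case False
    \<comment> \<open>At every scale there is a centre that is not its own maximum point. The
      maximum is then attained elsewhere, where the power is smooth with nonzero gradient.\<close>
    have ex: "\<exists>x y. dist x x0 < \<rho> \<and> dist y x0 < \<rho> \<and> x \<noteq> y \<and> (\<forall>\<^sub>F x' in nhds x. f y x' \<le> f y x)" if \<rho>: "0 < \<rho>" "\<rho> \<le> R" for \<rho>
    proof -
      obtain \<sigma> where \<sigma>: "0 < \<sigma>" "\<sigma> < \<rho>" "K * \<rho> powr k - c * (\<rho> - \<sigma>) powr k + c * \<sigma> powr k < 0" using sig[OF \<rho>(1)] by blast
      obtain y x' where y: "y \<in> ball x0 \<sigma>" "x' \<in> cball x0 \<rho>" "f y x' > f y y"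
        using False \<rho> \<sigma> by (meson not_le)
      have "cball x0 \<rho> \<noteq> {}" using \<rho> by simp
      then obtain x where x: "x \<in> cball x0 \<rho>" "\<And>x'. x' \<in> cball x0 \<rho> \<Longrightarrow> f y x' \<le> f y x"
        using continuous_attains_sup[OF compact_cball _ contf[OF \<rho>(2)]] by blast
      have xb: "x \<in> ball x0 \<rho>" by (rule interior[OF \<rho> \<sigma> y(1) x])
      have "\<forall>\<^sub>F x' in nhds x. x' \<in> ball x0 \<rho>" using xb by (intro eventually_nhds_in_open) auto
      then have "\<forall>\<^sub>F x' in nhds x. f y x' \<le> f y x" by eventually_elim (use x(2) in auto)
      moreover have "x \<noteq> y" using x(2)[OF y(2)] y(3) by auto
      ultimately show ?thesis using xb y(1) \<sigma> by (intro exI[of _ x] exI[of _ y]) (auto simp: dist_commute)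
    qed
    define \<rho> where "\<rho> m = R * inverse (real (Suc m))" for m
    have \<rho>: "0 < \<rho> m" "\<rho> m \<le> R" for m using R(1) by (auto simp: \<rho>_def field_simps)
    have \<rho>0: "\<rho> \<longlonglongrightarrow> 0" unfolding \<rho>_def using tendsto_mult[OF tendsto_const LIMSEQ_inverse_real_of_nat, of R] by simp
    have "\<forall>m. \<exists>xy. dist (fst xy) x0 < \<rho> m \<and> dist (snd xy) x0 < \<rho> m \<and> fst xy \<noteq> snd xy \<and> (\<forall>\<^sub>F x' in nhds (fst xy). f (snd xy) x' \<le> f (snd xy) (fst xy))"
      using ex[OF \<rho>] by simp
    then obtain xy where xy: "\<And>m. dist (fst (xy m)) x0 < \<rho> m" "\<And>m. dist (snd (xy m)) x0 < \<rho> m" "\<And>m. fst (xy m) \<noteq> snd (xy m)"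
       "\<And>m. \<forall>\<^sub>F x' in nhds (fst (xy m)). f (snd (xy m)) x' \<le> f (snd (xy m)) (fst (xy m))" by metis
    define x y where "x m = fst (xy m)" and "y m = snd (xy m)" for m
    have limx: "x \<longlonglongrightarrow> x0" and limy: "y \<longlonglongrightarrow> x0"
    proof -
      have "\<bar>\<rho> m\<bar> = \<rho> m" for m using \<rho>(1)[of m] by simp
      then have "dist (x m) x0 \<le> dist (\<rho> m) 0" "dist (y m) x0 \<le> dist (\<rho> m) 0" for m
        using xy(1,2)[of m] by (simp_all add: x_def y_def less_imp_le)
      then show "x \<longlonglongrightarrow> x0" "y \<longlonglongrightarrow> x0"
        by (auto intro!: metric_tendsto_imp_tendsto[OF \<rho>0] always_eventually)
    qed
    define d where "d m = x m - y m" for m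
    have d0: "d m \<noteq> 0" for m using xy(3) by (simp add: d_def x_def y_def)
    have limd: "d \<longlonglongrightarrow> 0" unfolding d_def using tendsto_diff[OF limx limy] by simp
    have x\<Omega>: "x m \<in> \<Omega>" for m using xy(1)[of m] \<rho>(2)[of m] R(2) by (auto simp: x_def dist_commute subset_eq)
    \<comment> \<open>Chosen so that \<open>s powr (k - 1) = c\<close>; \<open>pow_scale\<close>
      then reduces the test function to the power with coefficient 1.\<close>
    define s where "s = c powr (1 / (k - 1))"
    have s: "s > 0" using c by (simp add: s_def)
    have cs: "s powr (k - 1) = c" using c k by (simp add: s_def powr_powr)
    have ineq: "H (x m) (u (x m)) (c *\<^sub>R pow_grad k (d m)) \<le> s * trace (A (pow_grad k (s *\<^sub>R d m)) ** pow_hess k (s *\<^sub>R d m))" for m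
    proof -
      have "upper_jet u (x m) (c *\<^sub>R pow_grad k (d m)) (c *\<^sub>R pow_hess k (d m))"
      proof (rule upper_jetI[of "- {0}" "d m" "\<lambda>y. c * norm y powr k" "\<lambda>y. c *\<^sub>R pow_grad k y"])
        show "transpose (c *\<^sub>R pow_hess k (d m)) = c *\<^sub>R pow_hess k (d m)"
          using transpose_pow_hess[of k "d m"] by (simp add: transpose_def vec_eq_iff)
        have "filterlim (\<lambda>h. x m + h) (nhds (x m)) (nhds 0)"
          using tendsto_add[OF tendsto_const[of "x m"] filterlim_ident[of "nhds 0"]] by simp
        from eventually_compose_filterlim[OF xy(4)[of m, folded x_def y_def] this]
        show "\<forall>\<^sub>F h in nhds 0. u (x m + h) - c * norm (d m + h) powr k \<le> u (x m) - c * norm (d m) powr k"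
          by (simp add: f_def d_def algebra_simps)
        show "((\<lambda>y. c *\<^sub>R pow_grad k y) has_derivative (\<lambda>h. (c *\<^sub>R pow_hess k (d m)) *v h)) (at (d m))"
          by (rule pow_derivatives(2)[OF d0])
        show "((\<lambda>y. c * norm y powr k) has_derivative (\<lambda>h. (c *\<^sub>R pow_grad k y) \<bullet> h)) (at y)" if "y \<in> - {0}" for y
          by (rule pow_derivatives(1)) (use that in auto)
      qed (use d0 in auto)
      moreover have "c *\<^sub>R pow_grad k (d m) \<noteq> 0" using c k d0[of m] by (simp add: pow_grad_def)
      ultimately have "H (x m) (u (x m)) (c *\<^sub>R pow_grad k (d m)) \<le> trace (A (c *\<^sub>R pow_grad k (d m)) ** (c *\<^sub>R pow_hess k (d m)))"
        by (intro F_subsolution_upper_jet[OF sub x\<Omega>])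
      also have "\<dots> = trace (s *\<^sub>R (A (pow_grad k (s *\<^sub>R d m)) ** pow_hess k (s *\<^sub>R d m)))"
        unfolding pow_scale[OF s, of k "d m", unfolded cs]
        by (simp add: matrix_matrix_mult_def vec_eq_iff trace_def sum_distrib_left mult_ac)
      also have "\<dots> = s * trace (A (pow_grad k (s *\<^sub>R d m)) ** pow_hess k (s *\<^sub>R d m))"
        by (simp add: trace_def sum_distrib_left)
      finally show ?thesis .
    qed
    \<comment> \<open>The points \<open>s *\<^sub>R d m\<close> tend to 0 without being 0, as the
      punctured limit in (A1) requires.\<close>
    have limr: "(\<lambda>m. s * trace (A (pow_grad k (s *\<^sub>R d m)) ** pow_hess k (s *\<^sub>R d m))) \<longlonglongrightarrow> s * 0"
    proof (intro tendsto_mult tendsto_const)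
      have "filterlim (\<lambda>m. s *\<^sub>R d m) (at 0) sequentially"
        unfolding filterlim_at using s d0 tendsto_scaleR[OF tendsto_const limd, of s] by auto
      then show "(\<lambda>m. trace (A (pow_grad k (s *\<^sub>R d m)) ** pow_hess k (s *\<^sub>R d m))) \<longlonglongrightarrow> 0"
        by (rule filterlim_compose[OF A1])
    qed
    have limp: "(\<lambda>m. c *\<^sub>R pow_grad k (d m)) \<longlonglongrightarrow> 0"
    proof (rule tendsto_norm_zero_cancel)
      have "(\<lambda>m. norm (d m) powr (k - 1)) \<longlonglongrightarrow> 0"
        by (rule tendsto_zero_powrI[OF tendsto_norm_zero[OF limd] tendsto_const]) (use k in auto)
      from tendsto_mult[OF tendsto_const this, of "c * k"]
      show "(\<lambda>m. norm (c *\<^sub>R pow_grad k (d m))) \<longlonglongrightarrow> 0"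
        using c k by (simp add: norm_pow_grad mult.assoc)
    qed
    have limu: "(\<lambda>m. u (x m)) \<longlonglongrightarrow> u x0"
      using contu x0 x\<Omega> limx unfolding continuous_on_sequentially by (auto simp: comp_def)
    have "(\<lambda>m. H (x m) (u (x m)) (c *\<^sub>R pow_grad k (d m))) \<longlonglongrightarrow> H x0 (u x0) 0"
      by (rule tendsto_hamiltonian[OF contH x0 x\<Omega> limx limu limp])
    then show ?thesis using LIMSEQ_le[OF _ limr] ineq by auto
  qed
qed

section \<open>Nondegenerate contact\<close>

lemma C2_on_derivatives:
  fixes f :: "real^'n \<Rightarrow> real"
  assumes "C2_on \<Omega> f" "x \<in> \<Omega>"
  shows "(f has_derivative (\<lambda>h. grad f x \<bullet> h)) (at x)" "(grad f has_derivative (\<lambda>h. hess f x *v h)) (at x)"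
proof -
  let ?D = "frechet_derivative f (at x)"
  have D: "(f has_derivative ?D) (at x)" using assms by (simp add: C2_on_def frechet_derivative_works)
  have lin: "linear ?D" using D by (rule has_derivative_linear)
  have "?D = (\<lambda>h. grad f x \<bullet> h)"
  proof
    fix h :: "real^'n"
    have "h = (\<Sum>i\<in>UNIV. h $ i *\<^sub>R axis i 1)" using basis_expansion[of h] by (simp add: scalar_mult_eq_scaleR)
    then have "?D h = ?D (\<Sum>i\<in>UNIV. h $ i *\<^sub>R axis i 1)" by (rule arg_cong)
    also have "\<dots> = (\<Sum>i\<in>UNIV. h $ i *\<^sub>R ?D (axis i 1))" by (simp only: linear_sum[OF lin] linear_scale[OF lin])
    finally show "?D h = grad f x \<bullet> h" by (simp add: grad_def inner_vec_def mult.commute)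
  qed
  then show "(f has_derivative (\<lambda>h. grad f x \<bullet> h)) (at x)" using D by simp
  let ?G = "frechet_derivative (grad f) (at x)"
  have G: "(grad f has_derivative ?G) (at x)" using assms by (simp add: C2_on_def frechet_derivative_works)
  have "hess f x *v h = ?G h" for h
    using has_derivative_linear[OF G] by (simp add: hess_def jacobian_def matrix_works)
  then show "(grad f has_derivative (\<lambda>h. hess f x *v h)) (at x)" using G by simp
qed

text \<open>Negation turns supersolutions into subsolutions of the equation with reflected
  arguments, since the test class is invariant under sign change. The contact results are therefore
  formulated for subsolutions.\<close>

lemma F_supersolution_uminus:
  fixes v :: "real^'n \<Rightarrow> real"
  assumes \<Omega>: "open \<Omega>" and super: "F_supersolution \<F> \<Omega> A H v"
  shows "F_subsolution \<F> \<Omega> (\<lambda>p. A (- p)) (\<lambda>x r p. - H x (- r) (- p)) (\<lambda>x. - v x)"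
proof -
  note super = super[unfolded F_supersolution_def]
  note lb = conjunct1[OF super] and lsc = conjunct1[OF conjunct2[OF super]] and tests = conjunct2[OF conjunct2[OF super]]
  have usc: "usc_on \<Omega> (\<lambda>x. - v x)"
    unfolding usc_on_def
  proof (intro ballI allI impI)
    fix x c assume "x \<in> \<Omega>" "- v x < c"
    then have "\<forall>\<^sub>F y in at x within \<Omega>. - c < v y" using lsc unfolding lsc_on_def by (meson minus_less_iff)
    then show "\<forall>\<^sub>F y in at x within \<Omega>. - v y < c" by eventually_elim simp
  qed
  have lb': "locally_bounded_on \<Omega> (\<lambda>x. - v x)"
  proof -
    have "bounded ((\<lambda>x. - v x) ` S)" if "bounded (v ` S)" for S
    proof -
      have "(\<lambda>x. - v x) ` S = uminus ` v ` S" by (simp add: image_image)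
      then show ?thesis using that by (simp add: bounded_uminus)
    qed
    then show ?thesis using lb unfolding locally_bounded_on_def by blast
  qed
  have T: "(grad \<psi> x0 \<noteq> 0 \<longrightarrow> - trace (A (- grad \<psi> x0) ** hess \<psi> x0) + - H x0 (- (- v x0)) (- grad \<psi> x0) \<le> 0) \<and>
        (grad \<psi> x0 = 0 \<longrightarrow> - H x0 (- (- v x0)) (- grad \<psi> x0) \<le> 0)"
    if \<psi>: "\<psi> \<in> C2_A \<F> \<Omega>" and x0: "x0 \<in> \<Omega>" and max: "\<forall>\<^sub>F x in nhds x0. - v x - \<psi> x \<le> - v x0 - \<psi> x0" for \<psi> x0
  proof -
    let ?\<phi> = "\<lambda>x. - \<psi> x"
    have C2: "C2_on \<Omega> \<psi>" using \<psi> by (simp add: C2_A_def)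
    have d1: "(?\<phi> has_derivative (\<lambda>h. (- grad \<psi> x) \<bullet> h)) (at x)" if "x \<in> \<Omega>" for x
      using has_derivative_minus[OF C2_on_derivatives(1)[OF C2 that]] by simp
    have neg: "(- M) *v h = - (M *v h)" for M :: "real^'n^'n" and h
      by (simp add: vec_eq_iff matrix_vector_mult_def sum_negf)
    have d2: "((\<lambda>x. - grad \<psi> x) has_derivative (\<lambda>h. (- hess \<psi> x) *v h)) (at x)" if "x \<in> \<Omega>" for x
      using has_derivative_minus[OF C2_on_derivatives(2)[OF C2 that]] by (simp add: neg)
    have gr: "grad ?\<phi> x = - grad \<psi> x" if "x \<in> \<Omega>" for x using d1[OF that] by (rule grad_eqI)
    have hs: "hess ?\<phi> x = - hess \<psi> x" if "x \<in> \<Omega>" for x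
      by (rule grad_hess_eqI(2)[OF \<Omega> that _ d2[OF that]]) (rule d1)
    have "continuous_on \<Omega> (\<lambda>x. - hess \<psi> x)" using C2 unfolding C2_on_def by (intro continuous_intros) auto
    then have "C2_on \<Omega> ?\<phi>" using C2_onI[OF \<Omega>, of ?\<phi> "\<lambda>x. - grad \<psi> x" "\<lambda>x. - hess \<psi> x" \<Omega>] d1 d2 by blast
    moreover have "\<exists>f\<in>\<F>. \<forall>\<^sub>F y in nhds x. \<bar>?\<phi> y - ?\<phi> x\<bar> \<le> f (norm (y - x))" if x: "x \<in> \<Omega>" "grad ?\<phi> x = 0" for x
    proof -
      have "grad \<psi> x = 0" using gr x by simp
      then obtain f where "f \<in> \<F>" "\<forall>\<^sub>F y in nhds x. \<bar>\<psi> y - \<psi> x\<bar> \<le> f (norm (y - x))"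
        using \<psi> x(1) unfolding C2_A_def by blast
      then show ?thesis by (intro bexI[of _ f]) (simp_all add: abs_minus_commute)
    qed
    ultimately have mem: "?\<phi> \<in> C2_A \<F> \<Omega>" unfolding C2_A_def by blast
    have ev: "\<forall>\<^sub>F x in nhds x0. v x0 - ?\<phi> x0 \<le> v x - ?\<phi> x" using max by eventually_elim simp
    have "trace (A q ** (- M)) = - trace (A q ** M)" for q M
      by (simp add: trace_def matrix_matrix_mult_def sum_negf)
    then have "(grad \<psi> x0 \<noteq> 0 \<longrightarrow> 0 \<le> trace (A (- grad \<psi> x0) ** hess \<psi> x0) + H x0 (v x0) (- grad \<psi> x0)) \<and>
        (grad \<psi> x0 = 0 \<longrightarrow> 0 \<le> H x0 (v x0) 0)"
      using bspec[OF bspec[OF tests mem] x0, THEN mp, OF ev] gr[OF x0] hs[OF x0] by simp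
    then show ?thesis by (cases "grad \<psi> x0 = 0") simp_all
  qed
  show ?thesis
    unfolding F_subsolution_def
  proof (intro conjI)
    show "locally_bounded_on \<Omega> (\<lambda>x. - v x)" by (rule lb')
    show "usc_on \<Omega> (\<lambda>x. - v x)" by (rule usc)
    show "\<forall>\<psi>\<in>C2_A \<F> \<Omega>. \<forall>x0\<in>\<Omega>. (\<forall>\<^sub>F x in nhds x0. - v x - \<psi> x \<le> - v x0 - \<psi> x0) \<longrightarrow>
        (grad \<psi> x0 \<noteq> 0 \<longrightarrow> - trace (A (- grad \<psi> x0) ** hess \<psi> x0) + - H x0 (- (- v x0)) (- grad \<psi> x0) \<le> 0) \<and>
        (grad \<psi> x0 = 0 \<longrightarrow> - H x0 (- (- v x0)) (- grad \<psi> x0) \<le> 0)"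
    proof (rule ballI, rule ballI, rule impI)
      fix \<psi> x0
      assume "\<psi> \<in> C2_A \<F> \<Omega>" "x0 \<in> \<Omega>" "\<forall>\<^sub>F x in nhds x0. - v x - \<psi> x \<le> - v x0 - \<psi> x0"
      then show "(grad \<psi> x0 \<noteq> 0 \<longrightarrow> - trace (A (- grad \<psi> x0) ** hess \<psi> x0) + - H x0 (- (- v x0)) (- grad \<psi> x0) \<le> 0) \<and>
        (grad \<psi> x0 = 0 \<longrightarrow> - H x0 (- (- v x0)) (- grad \<psi> x0) \<le> 0)" by (rule T)
    qed
  qed
qed

text \<open>The constant is the largest eigenvalue of the Hessian, belonging to the radial direction
  when \<open>d\<close> is nonzero; Cauchy-Schwarz compares the radial part with the full
  norm.\<close>

lemma pow_hess_quadratic_le: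
  assumes "k > 2"
  shows "(pow_hess k d *v h) \<bullet> h \<le> k * (k - 1) * norm d powr (k - 2) * (norm h)\<^sup>2"
proof (cases "d = 0")
  case False
  have "(d \<bullet> h)\<^sup>2 \<le> (norm d)\<^sup>2 * (norm h)\<^sup>2"
    using Cauchy_Schwarz_ineq[of d h] by (simp add: power2_norm_eq_inner)
  then have "norm d powr (k - 4) * (d \<bullet> h)\<^sup>2 \<le> norm d powr (k - 4) * ((norm d)\<^sup>2 * (norm h)\<^sup>2)" by (rule mult_left_mono) simp
  also have "\<dots> = norm d powr (k - 2) * (norm h)\<^sup>2"
    using False powr_add[of "norm d" "k - 4" 2] by (simp add: powr_numeral)
  finally have "k * (k - 2) * (norm d powr (k - 4) * (d \<bullet> h)\<^sup>2) \<le> k * (k - 2) * (norm d powr (k - 2) * (norm h)\<^sup>2)"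
    using assms by (intro mult_left_mono) auto
  then show ?thesis
    unfolding pow_hess_mult inner_add_left inner_scaleR_left power2_norm_eq_inner[of h, symmetric]
    by (simp add: power2_eq_square algebra_simps)
qed (use assms in \<open>simp add: pow_hess_mult\<close>)

lemma upper_jet_shift:
  assumes "upper_jet (\<lambda>h. u (a + h) - c - p \<bullet> h) x q X"
  shows "upper_jet u (a + x) (p + q) X"
  unfolding upper_jet_def
proof (intro conjI allI impI)
  show "transpose X = X" using assms by (simp add: upper_jet_def)
  fix e :: real assume "e > 0"
  then have "\<forall>\<^sub>F h in nhds 0. u (a + (x + h)) - c - p \<bullet> (x + h) \<le> u (a + x) - c - p \<bullet> x + q \<bullet> h + (h \<bullet> (X *v h)) / 2 + e * (norm h)\<^sup>2"
    using assms unfolding upper_jet_def by blast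
  then show "\<forall>\<^sub>F h in nhds 0. u (a + x + h) \<le> u (a + x) + (p + q) \<bullet> h + (h \<bullet> (X *v h)) / 2 + e * (norm h)\<^sup>2"
    by eventually_elim (simp add: inner_add_left inner_add_right add.assoc)
qed

text \<open>The penalty depends on \<open>x - y\<close> only, so its slopes at the two points are
  \<open>p\<close> and \<open>- p\<close>. After subtracting these tangents, maximality and Taylor's
  formula leave the quadratic bound required by the theorem on sums, with \<open>B + \<tau>\<close>
  in place of \<open>B\<close>.\<close>

lemma nondegenerate_contact_approx:
  fixes u w :: "real^'n \<Rightarrow> real"
  assumes \<Omega>: "open \<Omega>" and a: "a \<in> \<Omega>" and b: "b \<in> \<Omega>" and ab: "a \<noteq> b"
    and sub1: "F_subsolution \<F>1 \<Omega> A1 H1 u" and sub2: "F_subsolution \<F>2 \<Omega> A2 H2 w"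
    and contu: "continuous_on \<Omega> u" and contw: "continuous_on \<Omega> w"
    and A1: "\<And>\<xi>. \<xi> \<noteq> 0 \<Longrightarrow> A1 \<xi> \<in> sym_nonneg" and A2: "\<And>\<xi>. \<xi> \<noteq> 0 \<Longrightarrow> A2 \<xi> \<in> sym_nonneg"
    and k: "k > 2" and K: "K > 0"
    and max: "\<And>x y. x \<in> \<Omega> \<Longrightarrow> y \<in> \<Omega> \<Longrightarrow> u x + w y - K * norm (x - y) powr k \<le> u a + w b - K * norm (a - b) powr k"
    and p: "p = K *\<^sub>R pow_grad k (a - b)" and B: "B = K * (k * (k - 1) * norm (a - b) powr (k - 2))"
    and \<tau>: "0 < \<tau>" "\<tau> < norm p"
  shows "\<exists>x y q1 q2. x \<in> \<Omega> \<and> y \<in> \<Omega> \<and> dist x a < \<tau> \<and> dist y b < \<tau> \<and> dist q1 p < \<tau> \<and> dist q2 (- p) < \<tau> \<and>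
    q1 \<noteq> 0 \<and> q2 \<noteq> 0 \<and>
    H1 x (u x) q1 + H2 y (w y) q2 \<le> (B + \<tau>) * (norm (mat_sqrt (A1 q1) - mat_sqrt (A2 q2)))\<^sup>2
      + \<tau> * ((norm (mat_sqrt (A1 q1)))\<^sup>2 + (norm (mat_sqrt (A2 q2)))\<^sup>2)"
proof -
  define d where "d = a - b"
  have d: "d \<noteq> 0" using ab by (simp add: d_def)
  have B0: "B \<ge> 0" unfolding B using k K by simp
  have "\<forall>\<^sub>F h in nhds 0. \<bar>K * norm (d + h) powr k - K * norm d powr k - (K *\<^sub>R pow_grad k d) \<bullet> h - (((K *\<^sub>R pow_hess k d) *v h) \<bullet> h) / 2\<bar> \<le> \<tau> / 2 * (norm h)\<^sup>2"
  proof (rule taylor_second_order[of "- {0}"])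
    show "((\<lambda>y. K *\<^sub>R pow_grad k y) has_derivative (\<lambda>h. (K *\<^sub>R pow_hess k d) *v h)) (at d)" by (rule pow_derivatives(2)[OF d])
    show "((\<lambda>y. K * norm y powr k) has_derivative (\<lambda>h. (K *\<^sub>R pow_grad k y) \<bullet> h)) (at y)" if "y \<in> - {0}" for y
      by (rule pow_derivatives(1)) (use that in auto)
  qed (use d \<tau> in auto)
  then obtain \<delta> where \<delta>: "\<delta> > 0" "\<And>h. norm h < \<delta> \<Longrightarrow>
     \<bar>K * norm (d + h) powr k - K * norm d powr k - (K *\<^sub>R pow_grad k d) \<bullet> h - (((K *\<^sub>R pow_hess k d) *v h) \<bullet> h) / 2\<bar> \<le> \<tau> / 2 * (norm h)\<^sup>2"
    unfolding eventually_nhds_metric by auto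
  have taylor: "K * norm (d + h) powr k \<le> K * norm d powr k + p \<bullet> h + (B + \<tau>) / 2 * (norm h)\<^sup>2" if "norm h < \<delta>" for h
  proof -
    have "((K *\<^sub>R pow_hess k d) *v h) \<bullet> h = K * ((pow_hess k d *v h) \<bullet> h)"
      by (simp flip: scaleR_matrix_vector_assoc)
    also have "\<dots> \<le> K * (k * (k - 1) * norm d powr (k - 2) * (norm h)\<^sup>2)"
      using pow_hess_quadratic_le[OF k, of d h] K by (intro mult_left_mono) auto
    also have "\<dots> = B * (norm h)\<^sup>2" by (simp add: B d_def)
    finally have "((K *\<^sub>R pow_hess k d) *v h) \<bullet> h \<le> B * (norm h)\<^sup>2" .
    moreover have "(B + \<tau>) / 2 * (norm h)\<^sup>2 = B * (norm h)\<^sup>2 / 2 + \<tau> / 2 * (norm h)\<^sup>2" by (simp add: algebra_simps add_divide_distrib)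
    ultimately show ?thesis using \<delta>(2)[OF that] unfolding p d_def[symmetric] by (simp only: abs_le_iff) linarith
  qed
  obtain r1 where r1: "r1 > 0" "cball a r1 \<subseteq> \<Omega>" using \<Omega> a open_contains_cball by blast
  obtain r2 where r2: "r2 > 0" "cball b r2 \<subseteq> \<Omega>" using \<Omega> b open_contains_cball by blast
  \<comment> \<open>Radius \<open>\<delta> / 3\<close> keeps \<open>x - y\<close> within the range
    of the Taylor bound for any two points of the ball.\<close>
  define r where "r = min (min r1 r2) (\<delta> / 3)"
  have r: "r > 0" using r1 r2 \<delta> by (simp add: r_def)
  have ra: "a + h \<in> \<Omega>" if "h \<in> cball 0 r" for h using that r1(2) by (auto simp: r_def dist_norm subset_eq)
  have rb: "b + h \<in> \<Omega>" if "h \<in> cball 0 r" for h using that r2(2) by (auto simp: r_def dist_norm subset_eq)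
  define U where "U h = u (a + h) - u a - p \<bullet> h" for h
  define V where "V h = w (b + h) - w b - (- p) \<bullet> h" for h
  have "continuous_on (cball 0 r) (\<lambda>h. u (a + h))"
    by (rule continuous_on_compose2[OF contu]) (use ra in \<open>auto intro!: continuous_intros simp del: image_add_cball\<close>)
  then have cU: "continuous_on (cball 0 r) U" unfolding U_def by (intro continuous_intros)
  have "continuous_on (cball 0 r) (\<lambda>h. w (b + h))"
    by (rule continuous_on_compose2[OF contw]) (use rb in \<open>auto intro!: continuous_intros simp del: image_add_cball\<close>)
  then have cV: "continuous_on (cball 0 r) V" unfolding V_def by (intro continuous_intros)
  have UV: "U x + V y \<le> (B + \<tau>) / 2 * (norm (x - y))\<^sup>2" if x: "x \<in> cball 0 r" and y: "y \<in> cball 0 r" for x y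
  proof -
    have "norm (x - y) \<le> norm x + norm y" by (rule norm_triangle_ineq4)
    also have "\<dots> < \<delta>" using x y \<delta>(1) by (simp add: r_def)
    finally have t: "K * norm (d + (x - y)) powr k \<le> K * norm d powr k + p \<bullet> (x - y) + (B + \<tau>) / 2 * (norm (x - y))\<^sup>2" by (rule taylor)
    have e: "a + x - (b + y) = d + (x - y)" by (simp add: d_def)
    show ?thesis using max[OF ra[OF x] rb[OF y]] t unfolding e U_def V_def d_def[symmetric]
      by (simp add: inner_diff_right)
  qed
  define \<tau>' where "\<tau>' = min \<tau> r"
  have \<tau>': "\<tau>' > 0" "\<tau>' \<le> \<tau>" "\<tau>' \<le> r" using \<tau> r by (auto simp: \<tau>'_def)
  have "U 0 = 0" "V 0 = 0" by (simp_all add: U_def V_def)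
  then obtain x y p1 p2 X Y where s: "norm x < \<tau>'" "norm y < \<tau>'" "norm p1 < \<tau>'" "norm p2 < \<tau>'" "upper_jet U x p1 X" "upper_jet V y p2 Y"
    "\<And>v w. v \<bullet> (X *v v) + w \<bullet> (Y *v w) \<le> (B + \<tau>) * (norm (v - w))\<^sup>2 + \<tau>' * ((norm v)\<^sup>2 + (norm w)\<^sup>2)"
    using theorem_on_sums[OF cU cV r _ _ _ UV \<tau>'(1)] B0 \<tau>(1) by (metis add_nonneg_nonneg less_imp_le)
  have j1: "upper_jet u (a + x) (p + p1) X" using s(5) unfolding U_def by (rule upper_jet_shift)
  have j2: "upper_jet w (b + y) (- p + p2) Y" using s(6) unfolding V_def by (rule upper_jet_shift)
  have x\<Omega>: "a + x \<in> \<Omega>" "b + y \<in> \<Omega>" using ra[of x] rb[of y] s \<tau>' by auto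
  \<comment> \<open>The slopes are perturbed by less than \<open>norm p\<close>, so they stay
    nonzero and the jets may be inserted into the equations.\<close>
  have nz: "p + p1 \<noteq> 0" "- p + p2 \<noteq> 0"
  proof -
    show "p + p1 \<noteq> 0"
    proof
      assume "p + p1 = 0"
      then have "norm p1 = norm p" by (metis add_eq_0_iff norm_minus_cancel)
      then show False using s(3) \<tau>' \<tau> by simp
    qed
    show "- p + p2 \<noteq> 0"
    proof
      assume "- p + p2 = 0"
      then have "p2 = p" by simp
      then show False using s(4) \<tau>' \<tau> by simp
    qed
  qed
  have XY: "v \<bullet> (X *v v) + w \<bullet> (Y *v w) \<le> (B + \<tau>) * (norm (v - w))\<^sup>2 + \<tau> * ((norm v)\<^sup>2 + (norm w)\<^sup>2)" for v w
  proof -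
    have "\<tau>' * ((norm v)\<^sup>2 + (norm w)\<^sup>2) \<le> \<tau> * ((norm v)\<^sup>2 + (norm w)\<^sup>2)" using \<tau>' by (intro mult_right_mono) auto
    then show ?thesis using s(7)[of v w] by linarith
  qed
  have "H1 (a + x) (u (a + x)) (p + p1) + H2 (b + y) (w (b + y)) (- p + p2) \<le> trace (A1 (p + p1) ** X) + trace (A2 (- p + p2) ** Y)"
    by (intro add_mono F_subsolution_upper_jet[OF sub1 x\<Omega>(1) nz(1) j1] F_subsolution_upper_jet[OF sub2 x\<Omega>(2) nz(2) j2])
  also have "\<dots> \<le> (B + \<tau>) * (norm (mat_sqrt (A1 (p + p1)) - mat_sqrt (A2 (- p + p2))))\<^sup>2
      + \<tau> * ((norm (mat_sqrt (A1 (p + p1))))\<^sup>2 + (norm (mat_sqrt (A2 (- p + p2))))\<^sup>2)"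
    by (rule trace_sum_le[OF A1[OF nz(1)] A2[OF nz(2)] XY])
  finally have fin: "H1 (a + x) (u (a + x)) (p + p1) + H2 (b + y) (w (b + y)) (- p + p2) \<le> \<dots>" .
  have D: "dist (a + x) a < \<tau>" "dist (b + y) b < \<tau>" "dist (p + p1) p < \<tau>" "dist (- p + p2) (- p) < \<tau>"
    using s(1-4) \<tau>'(2) by (simp_all add: dist_norm)
  show ?thesis
    by (rule exI[of _ "a + x"], rule exI[of _ "b + y"], rule exI[of _ "p + p1"], rule exI[of _ "- p + p2"], intro conjI) (rule fin x\<Omega> nz D)+
qed

text \<open>The Hessians have already disappeared into the distance of the square roots, so the
  passage to the limit uses only continuity of the functions, of the Hamiltonians and of the square
  roots away from the origin.\<close>

lemma nondegenerate_contact: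
  fixes u w :: "real^'n \<Rightarrow> real"
  assumes \<Omega>: "open \<Omega>" and a: "a \<in> \<Omega>" and b: "b \<in> \<Omega>" and ab: "a \<noteq> b"
    and sub1: "F_subsolution \<F>1 \<Omega> A1 H1 u" and sub2: "F_subsolution \<F>2 \<Omega> A2 H2 w"
    and contu: "continuous_on \<Omega> u" and contw: "continuous_on \<Omega> w"
    and A1: "\<And>\<xi>. \<xi> \<noteq> 0 \<Longrightarrow> A1 \<xi> \<in> sym_nonneg" and A2: "\<And>\<xi>. \<xi> \<noteq> 0 \<Longrightarrow> A2 \<xi> \<in> sym_nonneg"
    and contA1: "continuous_on (- {0}) A1" and contA2: "continuous_on (- {0}) A2"
    and contH1: "continuous_on (\<Omega> \<times> UNIV \<times> UNIV) (\<lambda>(x, r, p). H1 x r p)"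
    and contH2: "continuous_on (\<Omega> \<times> UNIV \<times> UNIV) (\<lambda>(x, r, p). H2 x r p)"
    and k: "k > 2" and K: "K > 0"
    and max: "\<And>x y. x \<in> \<Omega> \<Longrightarrow> y \<in> \<Omega> \<Longrightarrow> u x + w y - K * norm (x - y) powr k \<le> u a + w b - K * norm (a - b) powr k"
    and p: "p = K *\<^sub>R pow_grad k (a - b)" and B: "B = K * (k * (k - 1) * norm (a - b) powr (k - 2))"
  shows "H1 a (u a) p + H2 b (w b) (- p) \<le> B * (norm (mat_sqrt (A1 p) - mat_sqrt (A2 (- p))))\<^sup>2"
proof -
  have np: "norm p > 0" using ab k K by (simp add: p norm_pow_grad)
  define \<tau> where "\<tau> m = min (inverse (real (Suc m))) (norm p / 2)" for m
  have \<tau>: "0 < \<tau> m" "\<tau> m < norm p" for m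
  proof -
    show "0 < \<tau> m" using np by (simp add: \<tau>_def)
    have "\<tau> m \<le> norm p / 2" unfolding \<tau>_def by (rule min.cobounded2)
    then show "\<tau> m < norm p" using np by linarith
  qed
  have lim\<tau>: "\<tau> \<longlonglongrightarrow> 0"
  proof (rule tendsto_sandwich[OF _ _ tendsto_const LIMSEQ_inverse_real_of_nat])
    show "\<forall>\<^sub>F m in sequentially. 0 \<le> \<tau> m" using \<tau>(1) by (intro always_eventually) (simp add: less_imp_le)
    show "\<forall>\<^sub>F m in sequentially. \<tau> m \<le> inverse (real (Suc m))" by (intro always_eventually) (simp add: \<tau>_def)
  qed
  define P where "P m x y q1 q2 \<longleftrightarrow> x \<in> \<Omega> \<and> y \<in> \<Omega> \<and> dist x a < \<tau> m \<and> dist y b < \<tau> m \<and> dist q1 p < \<tau> m \<and> dist q2 (- p) < \<tau> m \<and>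
    q1 \<noteq> 0 \<and> q2 \<noteq> 0 \<and>
    H1 x (u x) q1 + H2 y (w y) q2 \<le> (B + \<tau> m) * (norm (mat_sqrt (A1 q1) - mat_sqrt (A2 q2)))\<^sup>2
      + \<tau> m * ((norm (mat_sqrt (A1 q1)))\<^sup>2 + (norm (mat_sqrt (A2 q2)))\<^sup>2)" for m x y q1 q2
  have "\<exists>x y q1 q2. P m x y q1 q2" for m
    unfolding P_def
    by (rule nondegenerate_contact_approx[OF \<Omega> a b ab sub1 sub2 contu contw A1 A2 k K max p B \<tau>])
  then obtain x y q1 q2 where P: "\<And>m. P m (x m) (y m) (q1 m) (q2 m)" by metis
  have lim: "f \<longlonglongrightarrow> l" if "\<And>m. dist (f m) l < \<tau> m" for f :: "nat \<Rightarrow> real^'n" and l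
  proof (rule metric_tendsto_imp_tendsto[OF lim\<tau>], intro always_eventually allI)
    show "dist (f m) l \<le> dist (\<tau> m) 0" for m using that[of m] \<tau>(1)[of m] by simp
  qed
  have limx: "x \<longlonglongrightarrow> a" and limy: "y \<longlonglongrightarrow> b" and lq1: "q1 \<longlonglongrightarrow> p" and lq2: "q2 \<longlonglongrightarrow> - p"
    using P unfolding P_def by (auto intro: lim)
  have x\<Omega>: "x m \<in> \<Omega>" and y\<Omega>: "y m \<in> \<Omega>" for m using P unfolding P_def by auto
  have limu: "(\<lambda>m. u (x m)) \<longlonglongrightarrow> u a" using contu a x\<Omega> limx unfolding continuous_on_sequentially by (auto simp: comp_def)
  have limw: "(\<lambda>m. w (y m)) \<longlonglongrightarrow> w b" using contw b y\<Omega> limy unfolding continuous_on_sequentially by (auto simp: comp_def)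
  have lims: "(\<lambda>m. mat_sqrt (A (q m))) \<longlonglongrightarrow> mat_sqrt (A l)"
    if "continuous_on (- {0}) A" "\<And>\<xi>. \<xi> \<noteq> 0 \<Longrightarrow> A \<xi> \<in> sym_nonneg" "q \<longlonglongrightarrow> l" "l \<noteq> 0" "\<And>m. q m \<noteq> 0"
    for A :: "real^'n \<Rightarrow> real^'n^'n" and q l
  proof -
    have "continuous_on (- {0}) (\<lambda>\<xi>. mat_sqrt (A \<xi>))" using that(1,2) by (intro continuous_on_mat_sqrt) auto
    then show ?thesis using that(3-5) unfolding continuous_on_sequentially by (auto simp: comp_def)
  qed
  have p0: "p \<noteq> 0" using np by auto
  have s1: "(\<lambda>m. mat_sqrt (A1 (q1 m))) \<longlonglongrightarrow> mat_sqrt (A1 p)" using P p0 unfolding P_def by (intro lims contA1 A1 lq1) auto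
  have s2: "(\<lambda>m. mat_sqrt (A2 (q2 m))) \<longlonglongrightarrow> mat_sqrt (A2 (- p))" using P p0 unfolding P_def by (intro lims contA2 A2 lq2) auto
  have l: "(\<lambda>m. H1 (x m) (u (x m)) (q1 m) + H2 (y m) (w (y m)) (q2 m)) \<longlonglongrightarrow> H1 a (u a) p + H2 b (w b) (- p)"
    by (intro tendsto_add tendsto_hamiltonian[OF contH1 a x\<Omega> limx limu lq1] tendsto_hamiltonian[OF contH2 b y\<Omega> limy limw lq2])
  have l2: "(\<lambda>m. (B + \<tau> m) * (norm (mat_sqrt (A1 (q1 m)) - mat_sqrt (A2 (q2 m))))\<^sup>2
      + \<tau> m * ((norm (mat_sqrt (A1 (q1 m))))\<^sup>2 + (norm (mat_sqrt (A2 (q2 m))))\<^sup>2)) \<longlonglongrightarrow>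
      (B + 0) * (norm (mat_sqrt (A1 p) - mat_sqrt (A2 (- p))))\<^sup>2 + 0 * ((norm (mat_sqrt (A1 p)))\<^sup>2 + (norm (mat_sqrt (A2 (- p))))\<^sup>2)"
    by (intro tendsto_intros lim\<tau> s1 s2)
  have ineq: "H1 (x m) (u (x m)) (q1 m) + H2 (y m) (w (y m)) (q2 m) \<le> (B + \<tau> m) * (norm (mat_sqrt (A1 (q1 m)) - mat_sqrt (A2 (q2 m))))\<^sup>2
      + \<tau> m * ((norm (mat_sqrt (A1 (q1 m))))\<^sup>2 + (norm (mat_sqrt (A2 (q2 m))))\<^sup>2)" for m
    using P[of m] unfolding P_def by (elim conjE)
  have "H1 a (u a) p + H2 b (w b) (- p) \<le> (B + 0) * (norm (mat_sqrt (A1 p) - mat_sqrt (A2 (- p))))\<^sup>2 + 0 * ((norm (mat_sqrt (A1 p)))\<^sup>2 + (norm (mat_sqrt (A2 (- p))))\<^sup>2)"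
    by (rule lim_mono[where N = 0, OF _ l l2]) (rule ineq)
  then show ?thesis by simp
qed

section \<open>The rate of convergence\<close>

text \<open>After expanding the square of the sum, both terms are increasing in \<open>d\<close> up
  to constants: the first because \<open>k > 2\<close>, the second because of the lower bound on
  \<beta>, which also admits some negative \<beta>. It remains to insert
  \<open>d = e\<close>.\<close>

lemma penalization_balance:
  fixes d e L k \<beta> \<theta> :: real
  assumes d: "0 < d" "d \<le> e" and e: "e \<le> 1" and \<theta>: "\<theta> \<le> 1" and k: "k > 2" and L: "L > 0"
    and \<beta>: "\<beta> > (2 - k) / (2 * (k - 1))"
  defines "K \<equiv> L * e powr (\<theta> - k)"
  shows "K * d powr (k - 2) * (e powr (1 + (1 - \<theta>) * max \<beta> 0))\<^sup>2 * (1 + (K * (k * d powr (k - 1))) powr \<beta>)\<^sup>2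
    \<le> L * (2 + 2 * (k * L) powr (2 * \<beta>)) * e powr \<theta>"
proof -
  have e0: "e > 0" using d by simp
  have K: "K > 0" using L e0 by (simp add: K_def)
  define P where "P = K * (k * d powr (k - 1))"
  have P: "P > 0" using K k d by (simp add: P_def)
  define E where "E = (e powr (1 + (1 - \<theta>) * max \<beta> 0))\<^sup>2"
  have E: "E = e powr (2 + 2 * (1 - \<theta>) * max \<beta> 0)"
    using e0 by (simp add: E_def powr_add[symmetric] power2_eq_square algebra_simps)
  have E0: "E \<ge> 0" by (simp add: E_def)
  have small: "e powr a \<le> e powr \<theta>" if "\<theta> \<le> a" for a using that e e0 by (intro powr_mono') auto
  have KE: "K * e powr (k - 2) * E = L * e powr (\<theta> + 2 * (1 - \<theta>) * max \<beta> 0)"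
    using e0 by (simp add: K_def E powr_add[symmetric] mult.assoc)
  have T1: "K * d powr (k - 2) * E \<le> L * e powr \<theta>"
  proof -
    have "K * d powr (k - 2) * E \<le> K * e powr (k - 2) * E"
      using d k K E0 by (intro mult_right_mono mult_left_mono powr_mono2) auto
    also have "\<dots> \<le> L * e powr \<theta>"
      unfolding KE using L \<theta> by (intro mult_left_mono small) auto
    finally show ?thesis .
  qed
  have T2: "K * d powr (k - 2) * P powr (2 * \<beta>) * E \<le> L * (k * L) powr (2 * \<beta>) * e powr \<theta>"
  proof -
    \<comment> \<open>The total exponent of \<open>d\<close> in the second term; the condition on
      \<beta> is what makes it nonnegative.\<close>
    define c where "c = k - 2 + 2 * \<beta> * (k - 1)"
    have "2 - k < \<beta> * (2 * (k - 1))" using \<beta> k by (simp add: field_simps)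
    then have c: "c \<ge> 0" by (simp add: c_def algebra_simps)
    have Pp: "t powr (k - 2) * (K * (k * t powr (k - 1))) powr (2 * \<beta>) = (k * K) powr (2 * \<beta>) * t powr c" if "t > 0" for t
    proof -
      have "(K * (k * t powr (k - 1))) powr (2 * \<beta>) = (k * K) powr (2 * \<beta>) * t powr ((k - 1) * (2 * \<beta>))"
        using that K k by (simp add: powr_mult powr_powr mult_ac)
      then show ?thesis using that by (simp add: c_def powr_add[symmetric] mult_ac algebra_simps)
    qed
    have "d powr (k - 2) * P powr (2 * \<beta>) \<le> e powr (k - 2) * (K * (k * e powr (k - 1))) powr (2 * \<beta>)"
      unfolding P_def Pp[OF d(1)] Pp[OF e0] using d c by (intro mult_left_mono powr_mono2) auto
    then have "K * (d powr (k - 2) * P powr (2 * \<beta>)) * E \<le> K * (e powr (k - 2) * (K * (k * e powr (k - 1))) powr (2 * \<beta>)) * E"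
      using K E0 by (intro mult_right_mono mult_left_mono) auto
    also have "\<dots> = (K * e powr (k - 2) * E) * (K * (k * e powr (k - 1))) powr (2 * \<beta>)" by (simp add: mult_ac)
    \<comment> \<open>The slope of the penalty at distance \<open>e\<close>; its negative power of
      \<open>e\<close> is compensated by the extra exponent
      \<open>(1 - \<theta>) * max \<beta> 0\<close>.\<close>
    also have "K * (k * e powr (k - 1)) = (k * L) * e powr (\<theta> - 1)"
      using e0 by (simp add: K_def powr_add[symmetric] mult_ac)
    also have "((k * L) * e powr (\<theta> - 1)) powr (2 * \<beta>) = (k * L) powr (2 * \<beta>) * e powr ((\<theta> - 1) * (2 * \<beta>))"
      using e0 k L by (simp add: powr_mult powr_powr)
    also have "(K * e powr (k - 2) * E) * ((k * L) powr (2 * \<beta>) * e powr ((\<theta> - 1) * (2 * \<beta>)))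
       = L * (k * L) powr (2 * \<beta>) * e powr (\<theta> + 2 * (1 - \<theta>) * max \<beta> 0 + (\<theta> - 1) * (2 * \<beta>))"
      unfolding KE using e0 by (simp add: powr_add mult_ac)
    also have "\<dots> \<le> L * (k * L) powr (2 * \<beta>) * e powr \<theta>"
    proof (intro mult_left_mono small)
      have "(1 - \<theta>) * (max \<beta> 0 - \<beta>) \<ge> 0" using \<theta> by (intro mult_nonneg_nonneg) auto
      then show "\<theta> \<le> \<theta> + 2 * (1 - \<theta>) * max \<beta> 0 + (\<theta> - 1) * (2 * \<beta>)" by (simp add: algebra_simps)
    qed (use L in simp)
    finally show ?thesis by (simp add: mult_ac)
  qed
  have "(1 + P powr \<beta>)\<^sup>2 \<le> 2 + 2 * P powr (2 * \<beta>)"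
  proof -
    have "P powr (2 * \<beta>) = (P powr \<beta>)\<^sup>2" using P by (simp add: power2_eq_square powr_add[symmetric])
    moreover have "0 \<le> (1 - P powr \<beta>)\<^sup>2" by simp
    ultimately show ?thesis by (simp add: power2_sum power2_diff)
  qed
  then have "K * d powr (k - 2) * E * (1 + P powr \<beta>)\<^sup>2 \<le> K * d powr (k - 2) * E * (2 + 2 * P powr (2 * \<beta>))"
    using K E0 by (intro mult_left_mono) auto
  also have "\<dots> = 2 * (K * d powr (k - 2) * E) + 2 * (K * d powr (k - 2) * P powr (2 * \<beta>) * E)" by (simp add: algebra_simps)
  also have "\<dots> \<le> 2 * (L * e powr \<theta>) + 2 * (L * (k * L) powr (2 * \<beta>) * e powr \<theta>)" using T1 T2 by linarith
  also have "\<dots> = L * (2 + 2 * (k * L) powr (2 * \<beta>)) * e powr \<theta>" by (simp add: algebra_simps)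
  finally show ?thesis unfolding P_def E_def .
qed

text \<open>Stated for two abstract equations so that it serves for the difference in both orders.
  The parameters \<open>s\<close> and \<open>h\<close> carry the errors of square roots and
  Hamiltonians; \<open>HH\<close> concerns ordered values because (A3) compares only those. In the
  constant, \<open>lam * L\<close> comes from the boundary, the middle part from the
  \<open>x\<close>-dependence of the Hamiltonian and the last part from the trace term.\<close>

lemma one_sided_estimate:
  fixes u v :: "real^'n \<Rightarrow> real"
  assumes \<Omega>: "open \<Omega>" "bounded \<Omega>" "\<Omega> \<noteq> {}"
    and subu: "F_subsolution \<F>1 \<Omega> A1 H1 u" and superv: "F_supersolution \<F>2 \<Omega> A2 H2 v"
    and F1: "\<F>1 \<noteq> {}" "\<F>1 \<subseteq> F_class" and F2: "\<F>2 \<noteq> {}" "\<F>2 \<subseteq> F_class"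
    and contu: "continuous_on (closure \<Omega>) u" and contv: "continuous_on (closure \<Omega>) v"
    and A1: "\<And>\<xi>. \<xi> \<noteq> 0 \<Longrightarrow> A1 \<xi> \<in> sym_nonneg" and A2: "\<And>\<xi>. \<xi> \<noteq> 0 \<Longrightarrow> A2 \<xi> \<in> sym_nonneg"
    and contA1: "continuous_on (- {0}) A1" and contA2: "continuous_on (- {0}) A2"
    and contH1: "continuous_on (\<Omega> \<times> UNIV \<times> UNIV) (\<lambda>(x, r, p). H1 x r p)"
    and contH2: "continuous_on (\<Omega> \<times> UNIV \<times> UNIV) (\<lambda>(x, r, p). H2 x r p)"
    and k: "k > 2" and L: "L > 0" and \<beta>: "\<beta> > (2 - k) / (2 * (k - 1))" and \<theta>: "0 < \<theta>" "\<theta> \<le> 1"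
    and L\<^sub>H: "L\<^sub>H > 0" and lam: "lam > 0"
    and lim1: "((\<lambda>x. trace (A1 (grad (\<lambda>y. norm y powr k) x) ** hess (\<lambda>y. norm y powr k) x)) \<longlongrightarrow> 0) (at 0)"
    and lim2: "((\<lambda>x. trace (A2 (grad (\<lambda>y. norm y powr k) x) ** hess (\<lambda>y. norm y powr k) x)) \<longlongrightarrow> 0) (at 0)"
    and holu: "\<And>x y. x \<in> closure \<Omega> \<Longrightarrow> y \<in> closure \<Omega> \<Longrightarrow> \<bar>u x - u y\<bar> \<le> L * norm (x - y) powr \<theta>"
    and holv: "\<And>x y. x \<in> closure \<Omega> \<Longrightarrow> y \<in> closure \<Omega> \<Longrightarrow> \<bar>v x - v y\<bar> \<le> L * norm (x - y) powr \<theta>"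
    and bdry: "\<And>x. x \<in> frontier \<Omega> \<Longrightarrow> u x - v x \<le> G" and G: "G \<ge> 0"
    and e: "0 < e" "e \<le> 1" and s: "s \<ge> 0"
    and sq: "\<And>\<xi>. \<xi> \<noteq> 0 \<Longrightarrow> norm (mat_sqrt (A1 \<xi>) - mat_sqrt (A2 \<xi>)) \<le> s * e powr (1 + (1 - \<theta>) * max \<beta> 0) * (1 + norm \<xi> powr \<beta>)"
    and h: "h \<ge> 0" and HH: "\<And>x y \<xi>. x \<in> \<Omega> \<Longrightarrow> y \<in> \<Omega> \<Longrightarrow> v y \<le> u x \<Longrightarrow>
        H1 x (u x) \<xi> - H2 y (v y) \<xi> \<ge> lam * (u x - v y) - L\<^sub>H * (1 + norm \<xi>) * norm (x - y) - h"
    and z: "z \<in> closure \<Omega>"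
  shows "u z - v z \<le> G + 1 / lam * ((lam * L + L\<^sub>H * (1 + k * L) + k * (k - 1) * s\<^sup>2 * (L * (2 + 2 * (k * L) powr (2 * \<beta>)))) * e powr \<theta> + h)"
proof -
  define K where "K = L * e powr (\<theta> - k)"
  have K: "K > 0" using L e by (simp add: K_def)
  define M where "M = L * (2 + 2 * (k * L) powr (2 * \<beta>))"
  have M: "M \<ge> 0" using L by (simp add: M_def)
  define C where "C = lam * L + L\<^sub>H * (1 + k * L) + k * (k - 1) * s\<^sup>2 * M"
  have terms: "lam * L > 0" "L\<^sub>H * (1 + k * L) > 0" "k * (k - 1) * s\<^sup>2 * M \<ge> 0"
    using L lam L\<^sub>H k M by (auto intro!: mult_pos_pos mult_nonneg_nonneg add_pos_pos)
  have et: "e powr \<theta> \<ge> 0" by simp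
  have goal: ?thesis if "lam * (u z - v z - G) \<le> C * e powr \<theta> + h"
  proof -
    have "u z - v z - G \<le> (C * e powr \<theta> + h) / lam" using that lam by (simp add: field_simps)
    then show ?thesis unfolding C_def M_def by simp
  qed
  define \<Phi> where "\<Phi> q = u (fst q) - v (snd q) - K * norm (fst q - snd q) powr k" for q
  have comp: "compact (closure \<Omega> \<times> closure \<Omega>)" using \<Omega>(2) by (intro compact_Times) (simp_all add: compact_closure)
  have "continuous_on (closure \<Omega> \<times> closure \<Omega>) \<Phi>"
  proof -
    have 1: "continuous_on (closure \<Omega> \<times> closure \<Omega>) (\<lambda>q. u (fst q))"
      by (rule continuous_on_compose2[OF contu]) (auto intro!: continuous_intros)
    have 2: "continuous_on (closure \<Omega> \<times> closure \<Omega>) (\<lambda>q. v (snd q))"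
      by (rule continuous_on_compose2[OF contv]) (auto intro!: continuous_intros)
    have 3: "continuous_on (closure \<Omega> \<times> closure \<Omega>) (\<lambda>q. norm (fst q - snd q) powr k)"
      by (rule continuous_on_powr') (use k in \<open>auto intro!: continuous_intros\<close>)
    show ?thesis unfolding \<Phi>_def by (intro continuous_on_diff continuous_on_mult_left 1 2 3)
  qed
  then obtain q where q: "q \<in> closure \<Omega> \<times> closure \<Omega>" "\<And>q'. q' \<in> closure \<Omega> \<times> closure \<Omega> \<Longrightarrow> \<Phi> q' \<le> \<Phi> q"
    using continuous_attains_sup[OF comp] z by blast
  obtain a b where ab: "q = (a, b)" by (cases q)
  have a: "a \<in> closure \<Omega>" and b: "b \<in> closure \<Omega>" using q(1) ab by auto
  have max: "u x - v y - K * norm (x - y) powr k \<le> u a - v b - K * norm (a - b) powr k" if "x \<in> closure \<Omega>" "y \<in> closure \<Omega>" for x y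
    using q(2)[of "(x, y)"] that by (simp add: \<Phi>_def ab)
  define d where "d = norm (a - b)"
  have d0: "d \<ge> 0" by (simp add: d_def)
  have zle: "u z - v z \<le> u a - v b - K * d powr k" using max[OF z z] by (simp add: d_def)
  \<comment> \<open>The maximum at \<open>(a, b)\<close> is compared with the value at
    \<open>(a, a)\<close>, where only \<open>v\<close> changes.\<close>
  have Kdk: "K * d powr k \<le> L * d powr \<theta>"
    using max[OF a a] holv[OF a b] by (simp add: d_def abs_le_iff norm_minus_commute)
  \<comment> \<open>Cancelling \<open>L\<close> and powers in \<open>Kdk\<close> gives
    \<open>d powr (k - \<theta>) \<le> e powr (k - \<theta>)\<close>; this is the reason for the
    exponent in \<open>K\<close>.\<close>
  have de: "d \<le> e"
  proof (cases "d = 0")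
    case False
    then have d: "d > 0" using d0 by simp
    have "d powr (k - \<theta>) \<le> e powr (k - \<theta>)"
    proof -
      have "(e powr (\<theta> - k) * d powr k) * (e powr (k - \<theta>) * d powr (- \<theta>)) \<le> d powr \<theta> * (e powr (k - \<theta>) * d powr (- \<theta>))"
        using Kdk L by (intro mult_right_mono) (auto simp: K_def mult.assoc)
      moreover have "(e powr (\<theta> - k) * d powr k) * (e powr (k - \<theta>) * d powr (- \<theta>)) = (e powr (\<theta> - k) * e powr (k - \<theta>)) * (d powr k * d powr (- \<theta>))"
        by (simp only: mult_ac)
      moreover have "e powr (\<theta> - k) * e powr (k - \<theta>) = 1" "d powr k * d powr (- \<theta>) = d powr (k - \<theta>)" "d powr \<theta> * d powr (- \<theta>) = 1"
        using e d by (simp_all add: powr_add[symmetric])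
      moreover have "d powr \<theta> * (e powr (k - \<theta>) * d powr (- \<theta>)) = (d powr \<theta> * d powr (- \<theta>)) * e powr (k - \<theta>)"
        by (simp only: mult_ac)
      ultimately show ?thesis by simp
    qed
    moreover have "e powr (k - \<theta>) < d powr (k - \<theta>)" if "e < d"
      using that e k \<theta> by (intro powr_less_mono2) auto
    ultimately show ?thesis by (meson not_le)
  qed (use e in simp)
  have dte: "d powr \<theta> \<le> e powr \<theta>" using de d0 \<theta> by (intro powr_mono2) auto
  have Kd: "K * d powr k \<ge> 0" using K by simp
  have cl: "x \<in> frontier \<Omega>" if "x \<in> closure \<Omega>" "x \<notin> \<Omega>" for x
    using that \<Omega>(1) by (simp add: frontier_def interior_open)
  \<comment> \<open>If one of the points lies on the frontier, the Hoelder bound of the other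
    function moves its argument there and the boundary estimate applies. In the interior case the
    ordering needed for \<open>HH\<close> is available.\<close>
  consider "u a - v b \<le> 0" | "a \<notin> \<Omega>" | "b \<notin> \<Omega>" | "a \<in> \<Omega>" "b \<in> \<Omega>" "v b \<le> u a" by linarith
  then show ?thesis
  proof cases
    case 1
    have "lam * (u z - v z - G) \<le> 0" using zle Kd 1 G lam by (intro mult_nonneg_nonpos) auto
    moreover have "C * e powr \<theta> \<ge> 0" using terms by (simp add: C_def)
    ultimately show ?thesis using h by (intro goal) linarith
  next
    case 2
    have "u a - v b \<le> G + L * d powr \<theta>" using bdry[OF cl[OF a 2]] holv[OF a b] by (simp add: d_def abs_le_iff)
    then have "u z - v z - G \<le> L * e powr \<theta>" using zle Kd mult_left_mono[OF dte, of L] L by linarith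
    then have "lam * (u z - v z - G) \<le> lam * (L * e powr \<theta>)" using lam by (intro mult_left_mono) auto
    also have "\<dots> \<le> C * e powr \<theta>" using terms mult_right_mono[of "lam * L" C "e powr \<theta>"] by (simp add: C_def mult.assoc)
    finally show ?thesis using h by (intro goal) linarith
  next
    case 3
    have "u a - v b \<le> G + L * d powr \<theta>" using bdry[OF cl[OF b 3]] holu[OF a b] by (simp add: d_def abs_le_iff)
    then have "u z - v z - G \<le> L * e powr \<theta>" using zle Kd mult_left_mono[OF dte, of L] L by linarith
    then have "lam * (u z - v z - G) \<le> lam * (L * e powr \<theta>)" using lam by (intro mult_left_mono) auto
    also have "\<dots> \<le> C * e powr \<theta>" using terms mult_right_mono[of "lam * L" C "e powr \<theta>"] by (simp add: C_def mult.assoc)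
    finally show ?thesis using h by (intro goal) linarith
  next
    case 4
    have sub: "\<Omega> \<subseteq> closure \<Omega>" by (rule closure_subset)
    have contu': "continuous_on \<Omega> u" using contu sub by (rule continuous_on_subset)
    have contw: "continuous_on \<Omega> (\<lambda>x. - v x)" using continuous_on_subset[OF contv sub] by (intro continuous_intros)
    have subw: "F_subsolution \<F>2 \<Omega> (\<lambda>p. A2 (- p)) (\<lambda>x r p. - H2 x (- r) (- p)) (\<lambda>x. - v x)"
      by (rule F_supersolution_uminus[OF \<Omega>(1) superv])
    have contH2': "continuous_on (\<Omega> \<times> UNIV \<times> UNIV) (\<lambda>(x, r, p). - H2 x (- r) (- p))"
    proof -
      have "continuous_on (\<Omega> \<times> UNIV \<times> UNIV) (\<lambda>q. - (\<lambda>(x, r, p). H2 x r p) (fst q, - fst (snd q), - snd (snd q)))"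
        by (intro continuous_on_minus continuous_on_compose2[OF contH2]) (auto intro!: continuous_intros)
      then show ?thesis by (simp add: case_prod_unfold)
    qed
    have contA2': "continuous_on (- {0}) (\<lambda>p. A2 (- p))"
      by (rule continuous_on_compose2[OF contA2]) (auto intro!: continuous_intros)
    have lim: "((\<lambda>x. trace (A (pow_grad k x) ** pow_hess k x)) \<longlongrightarrow> 0) (at 0)"
      if "((\<lambda>x. trace (A (grad (\<lambda>y. norm y powr k) x) ** hess (\<lambda>y. norm y powr k) x)) \<longlongrightarrow> 0) (at 0)" for A :: "real^'n \<Rightarrow> real^'n^'n"
    proof (rule Lim_transform_eventually[OF that])
      show "\<forall>\<^sub>F x in at 0. trace (A (grad (\<lambda>y. norm y powr k) x) ** hess (\<lambda>y. norm y powr k) x) = trace (A (pow_grad k x) ** pow_hess k x)"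
        unfolding eventually_at_filter by (intro always_eventually allI impI) (simp add: grad_hess_norm_powr)
    qed
    \<comment> \<open>The power is even: its gradient is odd and its Hessian even, so (A1) for the
      reflected field is (A1) at the point \<open>- x\<close>.\<close>
    have lim2': "((\<lambda>x. trace (A2 (- pow_grad k x) ** pow_hess k x)) \<longlongrightarrow> 0) (at 0)"
    proof -
      have "filterlim uminus (at 0) (at (0 :: real^'n))"
        using tendsto_minus[OF tendsto_ident_at[of "0 :: real^'n" UNIV]] by (simp add: filterlim_at eventually_at_filter)
      from filterlim_compose[OF lim[OF lim2] this] show ?thesis by (simp add: pow_grad_def pow_hess_def)
    qed
    have bound: "lam * (u a - v b) \<le> C * e powr \<theta> + h"
    proof (cases "a = b")
      \<comment> \<open>Maximality at \<open>(a, a)\<close>, with one variable frozen, says that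
        \<open>u\<close> and \<open>- v\<close> each have contact of order \<open>k\<close> from
        above at \<open>a\<close>.\<close>
      case True
      have ev: "\<forall>\<^sub>F x in nhds a. x \<in> \<Omega>" using \<Omega>(1) 4(1) by (rule eventually_nhds_in_open)
      have loc1: "\<forall>\<^sub>F x in nhds a. u x \<le> u a + K * norm (x - a) powr k"
        using ev
      proof eventually_elim
        case (elim x)
        then show ?case using max[of x a] sub a True by auto
      qed
      have 1: "H1 a (u a) 0 \<le> 0"
        by (rule F_subsolution_degenerate_contact[OF subu F1 \<Omega>(1) 4(1) contu' contH1 k lim[OF lim1] less_imp_le[OF K] loc1])
      have loc2: "\<forall>\<^sub>F x in nhds a. - v x \<le> - v a + K * norm (x - a) powr k"
        using ev
      proof eventually_elim
        case (elim x)
        then show ?case using max[of a x] sub a True by (auto simp: norm_minus_commute)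
      qed
      have 2: "- H2 a (v a) 0 \<le> 0"
        using F_subsolution_degenerate_contact[OF subw F2 \<Omega>(1) 4(1) contw contH2' k lim2' less_imp_le[OF K] loc2] by simp
      have "lam * (u a - v b) \<le> h" using HH[OF 4, of 0] 1 2 True by simp
      moreover have "C * e powr \<theta> \<ge> 0" using terms by (simp add: C_def)
      ultimately show ?thesis by linarith
    next
      case False
      then have d: "d > 0" by (simp add: d_def)
      define p where "p = K *\<^sub>R pow_grad k (a - b)"
      have np: "norm p = K * (k * d powr (k - 1))" using K k by (simp add: p_def norm_pow_grad d_def)
      then have p0: "p \<noteq> 0" using K k d by auto
      define \<Delta> where "\<Delta> = norm (mat_sqrt (A1 p) - mat_sqrt (A2 p))"
      have max': "u x + - v y - K * norm (x - y) powr k \<le> u a + - v b - K * norm (a - b) powr k" if "x \<in> \<Omega>" "y \<in> \<Omega>" for x y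
        using max[of x y] that sub by auto
      have "H1 a (u a) p + - H2 b (- (- v b)) (- (- p)) \<le> K * (k * (k - 1) * norm (a - b) powr (k - 2)) * (norm (mat_sqrt (A1 p) - mat_sqrt (A2 (- (- p)))))\<^sup>2"
        by (rule nondegenerate_contact[OF \<Omega>(1) 4(1,2) False subu subw contu' contw A1 _ contA1 contA2' contH1 contH2' k K max' p_def refl])
          (use A2 in auto)
      then have 1: "H1 a (u a) p - H2 b (v b) p \<le> k * (k - 1) * (K * d powr (k - 2) * \<Delta>\<^sup>2)"
        by (simp add: \<Delta>_def d_def mult_ac)
      have "\<Delta>\<^sup>2 \<le> (s * e powr (1 + (1 - \<theta>) * max \<beta> 0) * (1 + norm p powr \<beta>))\<^sup>2"
        unfolding \<Delta>_def by (rule power_mono[OF sq[OF p0]]) simp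
      then have "K * d powr (k - 2) * \<Delta>\<^sup>2 \<le> K * d powr (k - 2) * (s * e powr (1 + (1 - \<theta>) * max \<beta> 0) * (1 + norm p powr \<beta>))\<^sup>2"
        using K by (intro mult_left_mono) auto
      also have "\<dots> = s\<^sup>2 * (K * d powr (k - 2) * (e powr (1 + (1 - \<theta>) * max \<beta> 0))\<^sup>2 * (1 + (K * (k * d powr (k - 1))) powr \<beta>)\<^sup>2)"
        unfolding np power_mult_distrib by (simp only: mult_ac)
      also have "\<dots> \<le> s\<^sup>2 * (M * e powr \<theta>)"
        using penalization_balance[OF d de e(2) \<theta>(2) k L \<beta>] unfolding K_def M_def by (intro mult_left_mono) auto
      finally have "k * (k - 1) * (K * d powr (k - 2) * \<Delta>\<^sup>2) \<le> k * (k - 1) * (s\<^sup>2 * (M * e powr \<theta>))"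
        using k by (intro mult_left_mono) auto
      then have 2: "H1 a (u a) p - H2 b (v b) p \<le> (k * (k - 1) * s\<^sup>2 * M) * e powr \<theta>" using 1 by (simp add: mult.assoc)
      \<comment> \<open>Slope times distance is \<open>k * K * d powr k\<close>, which
        \<open>Kdk\<close> bounds by a multiple of \<open>e powr \<theta>\<close>, although the
        slope alone may be large.\<close>
      have 3: "L\<^sub>H * (1 + norm p) * norm (a - b) \<le> L\<^sub>H * (1 + k * L) * e powr \<theta>"
      proof -
        have "norm p * d = k * (K * d powr k)"
          using d powr_add[of d "k - 1" 1] by (simp add: np mult_ac)
        also have "\<dots> \<le> k * (L * e powr \<theta>)"
        proof (rule mult_left_mono)
          have "L * d powr \<theta> \<le> L * e powr \<theta>" using dte L by (intro mult_left_mono) auto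
          then show "K * d powr k \<le> L * e powr \<theta>" using Kdk by linarith
        qed (use k in simp)
        finally have "norm p * d \<le> k * L * e powr \<theta>" by (simp add: mult.assoc)
        moreover have "d \<le> e powr \<theta>" using de e \<theta> powr_mono'[of \<theta> 1 e] by simp
        ultimately have "(1 + norm p) * d \<le> (1 + k * L) * e powr \<theta>" by (simp add: algebra_simps)
        then show ?thesis using L\<^sub>H unfolding d_def[symmetric] by (simp add: mult.assoc)
      qed
      have "lam * (u a - v b) \<le> L\<^sub>H * (1 + norm p) * norm (a - b) + h + (H1 a (u a) p - H2 b (v b) p)" using HH[OF 4, of p] by linarith
      also have "\<dots> \<le> (L\<^sub>H * (1 + k * L) + k * (k - 1) * s\<^sup>2 * M) * e powr \<theta> + h" using 2 3 by (simp add: distrib_right)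
      also have "\<dots> \<le> C * e powr \<theta> + h"
        using terms by (intro add_right_mono mult_right_mono) (auto simp: C_def)
      finally show ?thesis .
    qed
    have "lam * (u z - v z - G) \<le> lam * (u a - v b)" using zle Kd G lam by (intro mult_left_mono) auto
    then show ?thesis using bound by (intro goal) linarith
  qed
qed

theorem theorem3p6:
  fixes N :: "real^'n^'n \<Rightarrow> real"
    and k L\<^sub>H lam c\<^sub>A \<alpha> \<beta> L :: real
  assumes "is_norm N"
    and "k > 2" and "L\<^sub>H > 0" and "lam > 0"
    and "c\<^sub>A > 0" and "\<alpha> > 0" and "\<beta> > (2 - k) / (2 * (k - 1))"
    and "L > 0"
  shows "\<exists>C\<^sub>0>0.
    \<forall>(\<Omega> :: (real^'n) set)
     (A :: real \<Rightarrow> real^'n \<Rightarrow> real^'n^'n)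
     (H :: real \<Rightarrow> real^'n \<Rightarrow> real \<Rightarrow> real^'n \<Rightarrow> real)
     (\<F> :: real \<Rightarrow> (real \<Rightarrow> real) set)
     (g :: real \<Rightarrow> real^'n \<Rightarrow> real)
     (u :: real \<Rightarrow> real^'n \<Rightarrow> real)
     (c\<^sub>H :: real \<Rightarrow> real) (\<gamma> :: real \<Rightarrow> real) (\<theta> :: real).
      open \<Omega> \<and> connected \<Omega> \<and> \<Omega> \<noteq> {} \<and> bounded \<Omega> \<and>
      (\<forall>\<epsilon>\<ge>0. continuous_on (- {0}) (A \<epsilon>) \<and> (\<forall>\<xi>. \<xi> \<noteq> 0 \<longrightarrow> A \<epsilon> \<xi> \<in> sym_nonneg)) \<and>
      (\<forall>\<epsilon>\<ge>0. continuous_on (\<Omega> \<times> UNIV \<times> UNIV) (\<lambda>(x, \<rho>, \<xi>). H \<epsilon> x \<rho> \<xi>)) \<and>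
      (\<forall>\<epsilon>\<ge>0. admissible N (A \<epsilon>) (\<F> \<epsilon>)) \<and>
      \<comment> \<open>(A1)\<close>
      (\<forall>\<^sub>F \<epsilon> in nhds 0. \<epsilon> \<ge> 0 \<longrightarrow>
        ((\<lambda>x. trace (A \<epsilon> (grad (\<lambda>y. norm y powr k) x) ** hess (\<lambda>y. norm y powr k) x))
          \<longlongrightarrow> 0) (at 0)) \<and>
      \<comment> \<open>(A2')\<close>
      (\<forall>\<epsilon>\<ge>0. \<forall>x1\<in>\<Omega>. \<forall>x2\<in>\<Omega>. \<forall>\<rho> \<xi>.
        \<bar>H \<epsilon> x1 \<rho> \<xi> - H \<epsilon> x2 \<rho> \<xi>\<bar> \<le> L\<^sub>H * (1 + norm \<xi>) * norm (x1 - x2)) \<and>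
      \<comment> \<open>(A3)\<close>
      (\<forall>\<epsilon>\<ge>0. \<forall>x\<in>\<Omega>. \<forall>\<xi> \<rho>1 \<rho>2. \<rho>1 \<ge> \<rho>2 \<longrightarrow>
        H \<epsilon> x \<rho>1 \<xi> - H \<epsilon> x \<rho>2 \<xi> \<ge> lam * (\<rho>1 - \<rho>2)) \<and>
      \<comment> \<open>(C1)\<close>
      (\<forall>\<^sub>F \<epsilon> in at_right 0. \<forall>\<xi>. \<xi> \<noteq> 0 \<longrightarrow>
        N (mat_sqrt (A \<epsilon> \<xi>) - mat_sqrt (A 0 \<xi>)) \<le> c\<^sub>A * \<epsilon> powr \<alpha> * (1 + norm \<xi> powr \<beta>)) \<and>
      \<comment> \<open>(C2')\<close>
      (\<forall>R>0. c\<^sub>H R > 0 \<and> \<gamma> R > 0 \<and>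
        (\<forall>\<^sub>F \<epsilon> in at_right 0. \<forall>x\<in>\<Omega>. \<forall>\<xi> r. \<bar>r\<bar> < R \<longrightarrow>
          \<bar>H \<epsilon> x r \<xi> - H 0 x r \<xi>\<bar> \<le> c\<^sub>H R * \<epsilon> powr \<gamma> R)) \<and>
      (\<forall>\<epsilon>\<ge>0. continuous_on (frontier \<Omega>) (g \<epsilon>) \<and>
        continuous_on (closure \<Omega>) (u \<epsilon>) \<and>
        F_solution (\<F> \<epsilon>) \<Omega> (A \<epsilon>) (H \<epsilon>) (u \<epsilon>) \<and>
        (\<forall>x\<in>frontier \<Omega>. u \<epsilon> x = g \<epsilon> x)) \<and>
      0 < \<theta> \<and> \<theta> \<le> 1 \<and>
      (\<forall>\<epsilon>\<ge>0. \<forall>x1\<in>closure \<Omega>. \<forall>x2\<in>closure \<Omega>.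
        \<bar>u \<epsilon> x1 - u \<epsilon> x2\<bar> \<le> L * norm (x1 - x2) powr \<theta>)
      \<longrightarrow>
      (\<forall>R>0. (\<forall>x\<in>closure \<Omega>. \<bar>u 0 x\<bar> < R) \<longrightarrow>
        (\<forall>\<^sub>F \<epsilon> in at_right 0.
          (SUP x\<in>closure \<Omega>. \<bar>u \<epsilon> x - u 0 x\<bar>)
            \<le> (SUP x\<in>frontier \<Omega>. \<bar>g \<epsilon> x - g 0 x\<bar>) +
               1 / lam * (C\<^sub>0 * \<epsilon> powr (\<alpha> * \<theta> / (1 + (1 - \<theta>) * max \<beta> 0)) +
                         c\<^sub>H R * \<epsilon> powr \<gamma> R)))"
proof -
  define b where "b = max \<beta> 0"
  obtain c where c: "c > 0" "\<And>M. norm M \<le> c * N M" using is_norm_dominates_norm[OF assms(1)] by blast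
  \<comment> \<open>The constant of (C1) after passing from \<open>N\<close> to the Frobenius
    norm.\<close>
  define s where "s = c * c\<^sub>A"
  have s: "s > 0" using c assms by (simp add: s_def)
  define C0 where "C0 = lam * L + L\<^sub>H * (1 + k * L) + k * (k - 1) * s\<^sup>2 * (L * (2 + 2 * (k * L) powr (2 * \<beta>)))"
  have C0: "C0 > 0"
  proof -
    have "lam * L > 0" "L\<^sub>H * (1 + k * L) > 0" "k * (k - 1) * s\<^sup>2 * (L * (2 + 2 * (k * L) powr (2 * \<beta>))) \<ge> 0"
      using assms by (auto intro!: mult_pos_pos mult_nonneg_nonneg add_pos_pos)
    then show ?thesis by (simp add: C0_def)
  qed
  show ?thesis
  proof (intro exI[of _ C0] conjI C0 allI impI, elim conjE)
    fix \<Omega> :: "(real^'n) set" and A :: "real \<Rightarrow> real^'n \<Rightarrow> real^'n^'n"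
      and H :: "real \<Rightarrow> real^'n \<Rightarrow> real \<Rightarrow> real^'n \<Rightarrow> real" and \<F> :: "real \<Rightarrow> (real \<Rightarrow> real) set"
      and g u :: "real \<Rightarrow> real^'n \<Rightarrow> real" and c\<^sub>H \<gamma> :: "real \<Rightarrow> real" and \<theta> R :: real
    assume \<Omega>: "open \<Omega>" "\<Omega> \<noteq> {}" "bounded \<Omega>"
      and A: "\<forall>\<epsilon>\<ge>0. continuous_on (- {0}) (A \<epsilon>) \<and> (\<forall>\<xi>. \<xi> \<noteq> 0 \<longrightarrow> A \<epsilon> \<xi> \<in> sym_nonneg)"
      and H: "\<forall>\<epsilon>\<ge>0. continuous_on (\<Omega> \<times> UNIV \<times> UNIV) (\<lambda>(x, \<rho>, \<xi>). H \<epsilon> x \<rho> \<xi>)"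
      and adm: "\<forall>\<epsilon>\<ge>0. admissible N (A \<epsilon>) (\<F> \<epsilon>)"
      and A1: "\<forall>\<^sub>F \<epsilon> in nhds 0. \<epsilon> \<ge> 0 \<longrightarrow>
        ((\<lambda>x. trace (A \<epsilon> (grad (\<lambda>y. norm y powr k) x) ** hess (\<lambda>y. norm y powr k) x)) \<longlongrightarrow> 0) (at 0)"
      and A2: "\<forall>\<epsilon>\<ge>0. \<forall>x1\<in>\<Omega>. \<forall>x2\<in>\<Omega>. \<forall>\<rho> \<xi>. \<bar>H \<epsilon> x1 \<rho> \<xi> - H \<epsilon> x2 \<rho> \<xi>\<bar> \<le> L\<^sub>H * (1 + norm \<xi>) * norm (x1 - x2)"
      and A3: "\<forall>\<epsilon>\<ge>0. \<forall>x\<in>\<Omega>. \<forall>\<xi> \<rho>1 \<rho>2. \<rho>1 \<ge> \<rho>2 \<longrightarrow> H \<epsilon> x \<rho>1 \<xi> - H \<epsilon> x \<rho>2 \<xi> \<ge> lam * (\<rho>1 - \<rho>2)"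
      and C1: "\<forall>\<^sub>F \<epsilon> in at_right 0. \<forall>\<xi>. \<xi> \<noteq> 0 \<longrightarrow>
        N (mat_sqrt (A \<epsilon> \<xi>) - mat_sqrt (A 0 \<xi>)) \<le> c\<^sub>A * \<epsilon> powr \<alpha> * (1 + norm \<xi> powr \<beta>)"
      and C2: "\<forall>R>0. c\<^sub>H R > 0 \<and> \<gamma> R > 0 \<and>
        (\<forall>\<^sub>F \<epsilon> in at_right 0. \<forall>x\<in>\<Omega>. \<forall>\<xi> r. \<bar>r\<bar> < R \<longrightarrow> \<bar>H \<epsilon> x r \<xi> - H 0 x r \<xi>\<bar> \<le> c\<^sub>H R * \<epsilon> powr \<gamma> R)"
      and sol: "\<forall>\<epsilon>\<ge>0. continuous_on (frontier \<Omega>) (g \<epsilon>) \<and> continuous_on (closure \<Omega>) (u \<epsilon>) \<and>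
        F_solution (\<F> \<epsilon>) \<Omega> (A \<epsilon>) (H \<epsilon>) (u \<epsilon>) \<and> (\<forall>x\<in>frontier \<Omega>. u \<epsilon> x = g \<epsilon> x)"
      and \<theta>: "0 < \<theta>" "\<theta> \<le> 1"
      and hol: "\<forall>\<epsilon>\<ge>0. \<forall>x1\<in>closure \<Omega>. \<forall>x2\<in>closure \<Omega>. \<bar>u \<epsilon> x1 - u \<epsilon> x2\<bar> \<le> L * norm (x1 - x2) powr \<theta>"
      and R: "R > 0" "\<forall>x\<in>closure \<Omega>. \<bar>u 0 x\<bar> < R"
    have pos: "\<forall>\<^sub>F \<epsilon> in at_right (0::real). 0 < \<epsilon>" by (simp add: eventually_at_filter)
    have le1: "\<forall>\<^sub>F \<epsilon> in at_right (0::real). \<epsilon> < 1" by (rule order_tendstoD(2)[OF tendsto_ident_at]) simp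
    \<comment> \<open>An eventual property for the full neighbourhood filter holds at the point 0
      itself, which supplies (A1) for the limit field.\<close>
    have lim0: "((\<lambda>x. trace (A 0 (grad (\<lambda>y. norm y powr k) x) ** hess (\<lambda>y. norm y powr k) x)) \<longlongrightarrow> 0) (at 0)"
      using eventually_nhds_x_imp_x[OF A1] by simp
    have A1': "\<forall>\<^sub>F \<epsilon> in at_right 0. \<epsilon> \<ge> 0 \<longrightarrow>
        ((\<lambda>x. trace (A \<epsilon> (grad (\<lambda>y. norm y powr k) x) ** hess (\<lambda>y. norm y powr k) x)) \<longlongrightarrow> 0) (at 0)"
      using A1 unfolding eventually_at_filter by eventually_elim simp
    have C2': "\<forall>\<^sub>F \<epsilon> in at_right 0. \<forall>x\<in>\<Omega>. \<forall>\<xi> r. \<bar>r\<bar> < R \<longrightarrow> \<bar>H \<epsilon> x r \<xi> - H 0 x r \<xi>\<bar> \<le> c\<^sub>H R * \<epsilon> powr \<gamma> R"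
      and cR: "c\<^sub>H R > 0" using C2 R(1) by auto
    \<comment> \<open>A supremum over the empty set would be meaningless; a nonempty bounded open
      set has boundary points.\<close>
    have Fr: "frontier \<Omega> \<noteq> {}" using \<Omega> frontier_eq_empty[of \<Omega>] not_bounded_UNIV by auto
    show "\<forall>\<^sub>F \<epsilon> in at_right 0. (SUP x\<in>closure \<Omega>. \<bar>u \<epsilon> x - u 0 x\<bar>) \<le> (SUP x\<in>frontier \<Omega>. \<bar>g \<epsilon> x - g 0 x\<bar>) +
        1 / lam * (C0 * \<epsilon> powr (\<alpha> * \<theta> / (1 + (1 - \<theta>) * max \<beta> 0)) + c\<^sub>H R * \<epsilon> powr \<gamma> R)"
      using pos le1 A1' C1 C2'
    proof eventually_elim
      case (elim \<epsilon>)
      \<comment> \<open>The exponent with \<open>e powr D = \<epsilon> powr \<alpha>\<close>, so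
        that \<open>e powr \<theta>\<close> is the claimed rate.\<close>
      define D where "D = 1 + (1 - \<theta>) * b"
      have D: "D > 0" using \<theta> by (simp add: D_def b_def add_pos_nonneg)
      define e where "e = \<epsilon> powr (\<alpha> / D)"
      have e: "0 < e" "e \<le> 1" using elim(1,2) D assms(6) powr_le1[of "\<alpha> / D" \<epsilon>] by (auto simp: e_def)
      have e\<theta>: "e powr \<theta> = \<epsilon> powr (\<alpha> * \<theta> / (1 + (1 - \<theta>) * max \<beta> 0))" by (simp add: e_def D_def b_def powr_powr)
      have eD: "e powr (1 + (1 - \<theta>) * max \<beta> 0) = \<epsilon> powr \<alpha>" using D by (simp add: e_def powr_powr D_def b_def)
      define G where "G = (SUP x\<in>frontier \<Omega>. \<bar>g \<epsilon> x - g 0 x\<bar>)"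
      have "compact (frontier \<Omega>)" using \<Omega>(3) by (rule compact_frontier_bounded)
      moreover have "continuous_on (frontier \<Omega>) (\<lambda>x. \<bar>g \<epsilon> x - g 0 x\<bar>)"
        using sol elim(1) by (intro continuous_intros) auto
      ultimately have "bdd_above ((\<lambda>x. \<bar>g \<epsilon> x - g 0 x\<bar>) ` frontier \<Omega>)"
        by (intro bounded_imp_bdd_above compact_imp_bounded compact_continuous_image)
      then have gG: "\<bar>g \<epsilon> x - g 0 x\<bar> \<le> G" if "x \<in> frontier \<Omega>" for x
        unfolding G_def using that by (intro cSUP_upper)
      obtain x0 where "x0 \<in> frontier \<Omega>" using Fr by blast
      then have G0: "G \<ge> 0" using gG[of x0] by (simp add: order_trans[OF abs_ge_zero])
      define h where "h = c\<^sub>H R * \<epsilon> powr \<gamma> R"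
      have h: "h \<ge> 0" using cR by (simp add: h_def)
      have \<epsilon>0: "\<epsilon> \<ge> 0" using elim(1) by simp
      have sub: "F_subsolution (\<F> t) \<Omega> (A t) (H t) (u t)" and super: "F_supersolution (\<F> t) \<Omega> (A t) (H t) (u t)"
        and cu: "continuous_on (closure \<Omega>) (u t)" and F: "\<F> t \<noteq> {}" "\<F> t \<subseteq> F_class"
        and psd: "\<And>\<xi>. \<xi> \<noteq> 0 \<Longrightarrow> A t \<xi> \<in> sym_nonneg" and cA: "continuous_on (- {0}) (A t)"
        and cH: "continuous_on (\<Omega> \<times> UNIV \<times> UNIV) (\<lambda>(x, r, p). H t x r p)"
        and holt: "\<And>x y. x \<in> closure \<Omega> \<Longrightarrow> y \<in> closure \<Omega> \<Longrightarrow> \<bar>u t x - u t y\<bar> \<le> L * norm (x - y) powr \<theta>"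
        and bd: "\<And>x. x \<in> frontier \<Omega> \<Longrightarrow> u t x = g t x" if "t \<ge> 0" for t
        using that sol adm A H hol unfolding F_solution_def admissible_def by simp_all
      have limt: "((\<lambda>x. trace (A \<epsilon> (grad (\<lambda>y. norm y powr k) x) ** hess (\<lambda>y. norm y powr k) x)) \<longlongrightarrow> 0) (at 0)"
        using elim(3) \<epsilon>0 by simp
      have sq: "norm (mat_sqrt (A \<epsilon> \<xi>) - mat_sqrt (A 0 \<xi>)) \<le> s * e powr (1 + (1 - \<theta>) * max \<beta> 0) * (1 + norm \<xi> powr \<beta>)" if "\<xi> \<noteq> 0" for \<xi>
      proof -
        have "norm (mat_sqrt (A \<epsilon> \<xi>) - mat_sqrt (A 0 \<xi>)) \<le> c * N (mat_sqrt (A \<epsilon> \<xi>) - mat_sqrt (A 0 \<xi>))" by (rule c(2))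
        also have "\<dots> \<le> c * (c\<^sub>A * \<epsilon> powr \<alpha> * (1 + norm \<xi> powr \<beta>))" using elim(4) that c(1) by (intro mult_left_mono) auto
        finally show ?thesis by (simp add: eD s_def mult.assoc)
      qed
      have sub_cl: "x \<in> closure \<Omega>" if "x \<in> \<Omega>" for x using that closure_subset by blast
      have lipH: "\<bar>H \<epsilon> x r \<xi> - H \<epsilon> y r \<xi>\<bar> \<le> L\<^sub>H * (1 + norm \<xi>) * norm (x - y)" if "x \<in> \<Omega>" "y \<in> \<Omega>" for x y r \<xi>
        using A2 \<epsilon>0 that by blast
      have monH: "H \<epsilon> x r \<xi> - H \<epsilon> x r' \<xi> \<ge> lam * (r - r')" if "x \<in> \<Omega>" "r' \<le> r" for x r r' \<xi>
        using A3 \<epsilon>0 that by blast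
      have difH: "\<bar>H \<epsilon> x (u 0 y) \<xi> - H 0 x (u 0 y) \<xi>\<bar> \<le> h" if "x \<in> \<Omega>" "y \<in> \<Omega>" for x y \<xi>
        using elim(5) R(2) that sub_cl unfolding h_def by blast
      \<comment> \<open>The chain replaces the value \<open>u \<epsilon> x\<close> by
        \<open>u 0 y\<close> using (A3), the point \<open>x\<close> by \<open>y\<close> using (A2'),
        and finally the Hamiltonian using (C2'), so that the last comparison happens at a value of
        \<open>u 0\<close>.\<close>
      have H1: "H \<epsilon> x (u \<epsilon> x) \<xi> - H 0 y (u 0 y) \<xi> \<ge> lam * (u \<epsilon> x - u 0 y) - L\<^sub>H * (1 + norm \<xi>) * norm (x - y) - h"
        if "x \<in> \<Omega>" "y \<in> \<Omega>" "u 0 y \<le> u \<epsilon> x" for x y \<xi>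
        using monH[OF that(1,3), of \<xi>] lipH[OF that(1,2), of "u 0 y" \<xi>] difH[OF that(2,2), of \<xi>] by (simp only: abs_le_iff) linarith
      \<comment> \<open>Here the Hamiltonian is exchanged at the point \<open>x\<close> with the
        value \<open>u 0 x\<close>, before point and value are moved; again (C2') is evaluated on
        \<open>u 0\<close> only.\<close>
      have H2: "H 0 x (u 0 x) \<xi> - H \<epsilon> y (u \<epsilon> y) \<xi> \<ge> lam * (u 0 x - u \<epsilon> y) - L\<^sub>H * (1 + norm \<xi>) * norm (x - y) - h"
        if "x \<in> \<Omega>" "y \<in> \<Omega>" "u \<epsilon> y \<le> u 0 x" for x y \<xi>
        using monH[OF that(2,3), of \<xi>] lipH[OF that(1,2), of "u 0 x" \<xi>] difH[OF that(1,1), of \<xi>] by (simp only: abs_le_iff) linarith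
      have sq': "norm (mat_sqrt (A 0 \<xi>) - mat_sqrt (A \<epsilon> \<xi>)) \<le> s * e powr (1 + (1 - \<theta>) * max \<beta> 0) * (1 + norm \<xi> powr \<beta>)" if "\<xi> \<noteq> 0" for \<xi>
        using sq[OF that] by (simp add: norm_minus_commute)
      have b1: "u \<epsilon> x - u 0 x \<le> G" if "x \<in> frontier \<Omega>" for x using gG[OF that] bd[OF \<epsilon>0 that] bd[OF order_refl that] by simp
      have b2: "u 0 x - u \<epsilon> x \<le> G" if "x \<in> frontier \<Omega>" for x using gG[OF that] bd[OF \<epsilon>0 that] bd[OF order_refl that] by simp
      have s0: "s \<ge> 0" using s by simp
      have est1: "u \<epsilon> z - u 0 z \<le> G + 1 / lam * (C0 * e powr \<theta> + h)" if "z \<in> closure \<Omega>" for z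
        unfolding C0_def
        by (rule one_sided_estimate[OF \<Omega>(1,3,2) sub[OF \<epsilon>0] super[OF order_refl] F[OF \<epsilon>0] F[OF order_refl] cu[OF \<epsilon>0] cu[OF order_refl]
            psd[OF \<epsilon>0] psd[OF order_refl] cA[OF \<epsilon>0] cA[OF order_refl] cH[OF \<epsilon>0] cH[OF order_refl] assms(2,8,7) \<theta> assms(3,4) limt lim0
            holt[OF \<epsilon>0] holt[OF order_refl] b1 G0 e s0 sq h H1 that])
      have est2: "u 0 z - u \<epsilon> z \<le> G + 1 / lam * (C0 * e powr \<theta> + h)" if "z \<in> closure \<Omega>" for z
        unfolding C0_def
        by (rule one_sided_estimate[OF \<Omega>(1,3,2) sub[OF order_refl] super[OF \<epsilon>0] F[OF order_refl] F[OF \<epsilon>0] cu[OF order_refl] cu[OF \<epsilon>0]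
            psd[OF order_refl] psd[OF \<epsilon>0] cA[OF order_refl] cA[OF \<epsilon>0] cH[OF order_refl] cH[OF \<epsilon>0] assms(2,8,7) \<theta> assms(3,4) lim0 limt
            holt[OF order_refl] holt[OF \<epsilon>0] b2 G0 e s0 sq' h H2 that])
      have "(SUP x\<in>closure \<Omega>. \<bar>u \<epsilon> x - u 0 x\<bar>) \<le> G + 1 / lam * (C0 * e powr \<theta> + h)"
      proof (rule cSUP_least)
        show "closure \<Omega> \<noteq> {}" using \<Omega>(2) by simp
        show "\<bar>u \<epsilon> x - u 0 x\<bar> \<le> G + 1 / lam * (C0 * e powr \<theta> + h)" if "x \<in> closure \<Omega>" for x
          using est1[OF that] est2[OF that] by (intro abs_leI) simp_all
      qed
      then show ?case unfolding e\<theta> G_def h_def .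
    qed
  qed
qed

end
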